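(* Let $\beta>0$ and, for $n\ge2$, let $A_{n}$ be the $n\times n$ $\beta$-ensemble random matrix described in the context, with eigenvalues $\lambda_{1},\dots,\lambda_{n}$ (depending on $n$). Let $$E_{n}=\frac{1}{2n}\sum_{k=1}^{n}\lambda_{k}^{2}-\frac{2}{n(n-1)}\sum_{1\le j<k\le n}\log|\lambda_{j}-\lambda_{k}|,\qquad \mu_{n}=\frac1n\sum_{k=1}^{n}\delta_{\lambda_{k}} .$$ Then $E_{n}$ converges almost surely to $3/4$ as $n\to\infty$, which is the energy of the semicircular law on $[-2,2]$. This implies that the spectral distribution $\mu_{n}$ of $A_{n}$ converges almost surely (weakly) to the semicircular law $\sigma(dx)=\frac{1}{2\pi}\mathbf{1}_{[-2,2]}(x)\sqrt{4-x^{2}}\,dx$.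
   Context: $A_{n}$ is the real symmetric tridiagonal random matrix $A_{n}=\frac{1}{\sqrt{\beta n}}M_{n}$, where the diagonal entries of $M_{n}$ are $N(0,2)$ random variables (normal with mean $0$ and variance $2$), the entries of $M_n$ in positions $(k,k+1)$ and $(k+1,k)$ are equal to a common random variable with distribution $\chi_{(n-k)\beta}$ for $k=1,\dots,n-1$, all other entries are zero, and the diagonal and superdiagonal entries are independent. Here $\chi_{\gamma}$ is the chi distribution with parameter $\gamma$ (density proportional to $x^{\gamma-1}e^{-x^{2}/2}$ on $(0,\infty)$). The matrices $A_{n}$, $n\ge2$, are defined on a common probability space. The energy of a probability measure $\mu$ on $\mathbb{R}$ is $\frac12\int x^{2}\,\mu(dx)-\iint\log|x-y|\,\mu(dx)\,\mu(dy)$. *)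

theory Defs
  imports "HOL-Probability.Probability" "Jordan_Normal_Form.Char_Poly"
begin

definition chi_density :: "real \<Rightarrow> real \<Rightarrow> real" where
  "chi_density \<gamma> x =
     (if x > 0 then x powr (\<gamma> - 1) * exp (- x\<^sup>2 / 2) / (2 powr (\<gamma> / 2 - 1) * Gamma (\<gamma> / 2)) else 0)"

text \<open>
  The law of the unnormalised random matrix \<open>M\<^sub>n\<close>. Indices start at 0, so the entry in row
  \<open>i\<close>, column \<open>Suc i\<close> is the entry in position \<open>(k, k+1)\<close> with \<open>k = Suc i\<close>.
  \<^const>\<open>normal_density\<close> is parametrised by the standard deviation.
\<close>

definition beta_ensemble :: "'a measure \<Rightarrow> real \<Rightarrow> nat \<Rightarrow> ('a \<Rightarrow> real mat) \<Rightarrow> bool" where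
  "beta_ensemble P \<beta> n X \<longleftrightarrow>
     (\<forall>\<omega>\<in>space P. X \<omega> \<in> carrier_mat n n) \<and>
     (\<forall>\<omega>\<in>space P. \<forall>i<n. \<forall>j<n. X \<omega> $$ (j, i) = X \<omega> $$ (i, j)) \<and>
     (\<forall>\<omega>\<in>space P. \<forall>i<n. \<forall>j<n. Suc i < j \<longrightarrow> X \<omega> $$ (i, j) = 0) \<and>
     (\<forall>i<n. distributed P lborel (\<lambda>\<omega>. X \<omega> $$ (i, i)) (normal_density 0 (sqrt 2))) \<and>
     (\<forall>i. Suc i < n \<longrightarrow>
        distributed P lborel (\<lambda>\<omega>. X \<omega> $$ (i, Suc i)) (chi_density (real (n - Suc i) * \<beta>))) \<and>
     prob_space.indep_vars P (\<lambda>_. borel) (\<lambda>(i, j) \<omega>. X \<omega> $$ (i, j))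
       {(i, j). i \<le> j \<and> j \<le> Suc i \<and> j < n}"

text \<open>
  The real eigenvalues in increasing order, repeated according to multiplicity. For a real
  symmetric matrix the characteristic polynomial splits, so the length is the dimension.
\<close>

definition eigenvalue_list :: "real mat \<Rightarrow> real list" where
  "eigenvalue_list A = sorted_list_of_multiset (proots (char_poly A))"

definition discrete_energy :: "nat \<Rightarrow> (nat \<Rightarrow> real) \<Rightarrow> real" where
  "discrete_energy n x =
     1 / (2 * real n) * (\<Sum>k<n. (x k)\<^sup>2)
     - 2 / (real n * (real n - 1)) * (\<Sum>k<n. \<Sum>j<k. ln \<bar>x j - x k\<bar>)"

definition empirical_measure :: "nat \<Rightarrow> (nat \<Rightarrow> real) \<Rightarrow> real measure" where
  "empirical_measure n x = distr (uniform_count_measure {..<n}) borel x"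

definition semicircle_law :: "real measure" where
  "semicircle_law =
     density lborel (\<lambda>x. ennreal (1 / (2 * pi) * indicator {-2..2} x * sqrt (4 - x\<^sup>2)))"

text \<open>
  The energy takes values in \<open>(-\<infinity>, \<infinity>]\<close>, so the logarithm is split into its negative part (infinite
  at 0) and its positive part, both integrated as nonnegative functions; \<^const>\<open>ennreal\<close> maps
  negative numbers to 0. The positive part has infinite integral only if the second
  moment is infinite; then \<open>\<infinity> - \<infinity> = \<infinity>\<close> in \<^typ>\<open>ereal\<close> gives the appropriate value.
\<close>

definition neg_part_log :: "real \<Rightarrow> ennreal" where
  "neg_part_log r = (if r = 0 then \<infinity> else ennreal (- ln r))"

definition energy :: "real measure \<Rightarrow> ereal" where
  "energy \<mu> =
     ereal (1/2) * enn2ereal (\<integral>\<^sup>+ x. ennreal (x\<^sup>2) \<partial>\<mu>)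
     + enn2ereal (\<integral>\<^sup>+ x. (\<integral>\<^sup>+ y. neg_part_log \<bar>x - y\<bar> \<partial>\<mu>) \<partial>\<mu>)
     - enn2ereal (\<integral>\<^sup>+ x. (\<integral>\<^sup>+ y. ennreal (ln \<bar>x - y\<bar>) \<partial>\<mu>) \<partial>\<mu>)"

end

theory Submission
  imports Defs "HOL-Real_Asymp.Real_Asymp"
begin

text \<open>
  Both bounds for the discrete energy come from Jacobi matrices. If \<open>p\<^sub>0, p\<^sub>1, \<dots>\<close> are the monic
  orthogonal polynomials of a weight on \<open>n\<close> points, with recurrence coefficients \<open>a\<^sub>k\<close> and \<open>c\<^sub>k\<close>, then the squared
  Vandermonde determinant of the points is a product of powers of the \<open>c\<^sub>k\<close> divided by the product of the weights,
  and the sum of the squared points is the squared Frobenius norm of the Jacobi matrix. For uniform weights on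
  arbitrary points, minimising over each \<open>c\<^sub>k\<close> separately gives a lower bound that tends to \<open>3/4\<close>. For the
  spectral weights of the random matrix the \<open>c\<^sub>k\<close> are explicit; as the product of the weights is at most \<open>1\<close>,
  the upper bound only needs all entries to be simultaneously close to their typical values, which follows from tail bounds, a union bound
  and the Borel-Cantelli lemma.

  Weak convergence is deterministic from there on. Moving the points along \<open>x \<mapsto> x \<plusminus> \<epsilon> x\<^sup>k\<close> cannot
  push the energy below the universal lower bound, so the first variation vanishes asymptotically. These loop equations
  determine the limits of all moments recursively, and the semicircle moments satisfy the same recursion.

  Along one such sequence of spectra, a truncation of the logarithm shows that the semicircle law has energy at most \<open>3/4\<close>;
  integrating the lower bound over independent semicircular points shows that it is at least \<open>3/4\<close>.
\<close>

section \<open>Vandermonde determinants of orthogonal polynomials\<close>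

text \<open>In Jacobi coefficients the energy decouples: the squared points contribute the sum of
  the \<open>c l\<close>, the squared Vandermonde determinant contributes the sum of
  \<open>(n - 1 - l) * ln (c l)\<close>. Each resulting summand is convex in \<open>c l\<close> with
  its minimum near (n - 1 - l) / n, which is also the typical squared superdiagonal entry of the
  scaled matrix. Hence both bounds tend to 1/2 minus the integral of t ln t over [0, 1], that is
  3/4.

  The obstacle is the bottom corner of the matrix. A chi variable with few degrees of freedom leaves
  a fixed relative neighbourhood of its typical value with a probability that does not decay with n.
  It is therefore allowed to be too small by a factor whose logarithm is of order \<kappa> n / (n -
  1 - l). This logarithm enters with weight n - 1 - l, so the loss is of order \<kappa> n per entry
  and of order \<kappa> after normalisation.

  Moments suffice for weak convergence because the same control of the entries confines the spectra
  to a fixed interval.\<close>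

lemma det_monic_eval:
  fixes p :: "nat \<Rightarrow> real poly"
  assumes deg: "\<And>k. k < n \<Longrightarrow> degree (p k) = k" and lc: "\<And>k. k < n \<Longrightarrow> lead_coeff (p k) = 1"
  shows "det (mat n n (\<lambda>(i,k). poly (p k) (x i))) = det (mat n n (\<lambda>(i,k). x i ^ k))"
proof -
  \<comment> \<open>Change of basis from the monomials: monic polynomials of increasing degree make
    \<open>T\<close> upper triangular with unit diagonal.\<close>
  define T where "T = mat n n (\<lambda>(l,k). coeff (p k) l)"
  have "mat n n (\<lambda>(i,k). poly (p k) (x i)) = mat n n (\<lambda>(i,k). x i ^ k) * T"
  proof (rule eq_matI)
    fix i k assume "i < dim_row (mat n n (\<lambda>(i,k). x i ^ k) * T)" "k < dim_col (mat n n (\<lambda>(i,k). x i ^ k) * T)"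
    then have ik: "i < n" "k < n" by (auto simp: T_def)
    have "poly (p k) (x i) = (\<Sum>l\<le>k. coeff (p k) l * x i ^ l)"
      using deg[OF ik(2)] by (simp add: poly_altdef)
    also have "\<dots> = (\<Sum>l\<in>{0..<n}. coeff (p k) l * x i ^ l)"
      using ik deg[OF ik(2)] by (intro sum.mono_neutral_left) (auto simp: coeff_eq_0)
    finally show "mat n n (\<lambda>(i,k). poly (p k) (x i)) $$ (i,k) = (mat n n (\<lambda>(i,k). x i ^ k) * T) $$ (i,k)"
      using ik by (simp add: T_def scalar_prod_def mult.commute)
  qed (auto simp: T_def)
  moreover have "det T = 1"
  proof -
    have "det T = prod_list (diag_mat T)"
      by (rule det_upper_triangular[of _ n]) (auto simp: T_def deg coeff_eq_0)
    also have "\<dots> = (\<Prod>k\<in>{0..<n}. T $$ (k,k))"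
      by (simp add: prod_list_diag_prod T_def)
    also have "\<dots> = 1" using lc deg by (intro prod.neutral) (auto simp: T_def)
    finally show ?thesis .
  qed
  moreover have "det (mat n n (\<lambda>(i,k). x i ^ k) * T) = det (mat n n (\<lambda>(i,k). x i ^ k)) * det T"
    by (rule det_mult) (auto simp: T_def)
  ultimately show ?thesis by simp
qed

text \<open>The determinant is the same for every monic family, so it can be read off from the
  Newton polynomials \<open>q k\<close>: they vanish at the first k points, which makes their
  evaluation matrix lower triangular.\<close>

lemma det_monic_eval_vandermonde:
  fixes p :: "nat \<Rightarrow> real poly"
  assumes "\<And>k. k < n \<Longrightarrow> degree (p k) = k" and "\<And>k. k < n \<Longrightarrow> lead_coeff (p k) = 1"
  shows "det (mat n n (\<lambda>(i,k). poly (p k) (x i))) = (\<Prod>k<n. \<Prod>j<k. x k - x j)"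
proof -
  define q where "q k = (\<Prod>j<k. [:- x j, 1:])" for k
  have q: "degree (q k) = k" "lead_coeff (q k) = 1" for k
  proof -
    show *: "degree (q k) = k" for k by (simp add: q_def degree_prod_eq_sum_degree)
    have "lead_coeff (q k) = (\<Prod>j<k. lead_coeff [:- x j, 1:])" unfolding q_def by (rule lead_coeff_prod)
    then show "lead_coeff (q k) = 1" by simp
  qed
  have q0: "poly (q k) (x i) = 0" if "i < k" for i k
    using that by (auto simp: q_def poly_prod)
  have "det (mat n n (\<lambda>(i,k). poly (p k) (x i))) = det (mat n n (\<lambda>(i,k). poly (q k) (x i)))"
    using det_monic_eval[OF assms, where x = x] det_monic_eval[OF q, where x = x and n = n] by simp
  also have "\<dots> = prod_list (diag_mat (mat n n (\<lambda>(i,k). poly (q k) (x i))))"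
    by (rule det_lower_triangular[of n]) (auto simp: q0)
  also have "\<dots> = (\<Prod>k\<in>{0..<n}. poly (q k) (x k))"
    by (simp add: prod_list_diag_prod)
  also have "\<dots> = (\<Prod>k<n. \<Prod>j<k. x k - x j)"
    by (intro prod.cong) (auto simp: q_def poly_prod)
  finally show ?thesis .
qed

lemma det_diag_fun:
  "det (mat n n (\<lambda>(i,j). if i = j then h i else 0)) = (\<Prod>i<n. h i :: real)"
  by (subst det_upper_triangular[of _ n])
     (auto simp: prod_list_diag_prod intro!: prod.cong)

text \<open>After scaling, the \<open>F k i\<close> form a square matrix, and a left inverse of a
  square matrix is a right inverse. This exchanges points and degrees: it turns orthogonality of
  polynomials into completeness, and orthogonality between points into orthogonality of
  polynomials.\<close>

lemma orthogonal_rows_columns: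
  fixes F :: "nat \<Rightarrow> nat \<Rightarrow> real"
  assumes orth: "\<And>k l. k < n \<Longrightarrow> l < n \<Longrightarrow> (\<Sum>i<n. w i * F k i * F l i) = (if k = l then h k else 0)"
    and h: "\<And>k. k < n \<Longrightarrow> h k > 0"
    and w: "\<And>k. k < n \<Longrightarrow> w k > 0"
    and ij: "i < n" "j < n"
  shows "(\<Sum>k<n. F k i * F k j / h k) = (if i = j then 1 / w i else 0)"
proof -
  define A where "A = mat n n (\<lambda>(k,i). F k i / h k)"
  define B where "B = mat n n (\<lambda>(i,k). w i * F k i)"
  have "A * B = 1\<^sub>m n"
  proof (rule eq_matI)
    fix k l assume "k < dim_row (1\<^sub>m n :: real mat)" "l < dim_col (1\<^sub>m n :: real mat)"
    then have kl: "k < n" "l < n" by auto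
    have "(A * B) $$ (k,l) = (\<Sum>i<n. F k i / h k * (w i * F l i))"
      using kl by (simp add: A_def B_def scalar_prod_def atLeast0LessThan)
    also have "\<dots> = (\<Sum>i<n. w i * F k i * F l i) / h k"
      by (simp add: sum_divide_distrib mult_ac)
    also have "\<dots> = (if k = l then 1 else 0)"
      using orth[OF kl] h[OF kl(1)] by auto
    finally show "(A * B) $$ (k,l) = 1\<^sub>m n $$ (k,l)" using kl by simp
  qed (auto simp: A_def B_def)
  then have BA: "B * A = 1\<^sub>m n"
    by (rule mat_mult_left_right_inverse[rotated 2]) (auto simp: A_def B_def)
  have "w i * (\<Sum>k<n. F k i * F k j / h k) = (\<Sum>k<n. w i * F k i * (F k j / h k))"
    by (simp add: sum_distrib_left mult_ac)
  also have "\<dots> = (B * A) $$ (i,j)"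
    using ij by (simp add: A_def B_def scalar_prod_def atLeast0LessThan)
  also have "\<dots> = (if i = j then 1 else 0)" using BA ij by simp
  finally show ?thesis using w[OF ij(1)] by (auto simp: field_simps split: if_splits)
qed

text \<open>Orthogonality says that the Gram matrix \<open>V\<^sup>T * W * V\<close> is the diagonal
  matrix \<open>H\<close>; the identity is the equality of determinants.\<close>

lemma vandermonde_sq_orthogonal:
  fixes p :: "nat \<Rightarrow> real poly"
  assumes deg: "\<And>k. k < n \<Longrightarrow> degree (p k) = k" and lc: "\<And>k. k < n \<Longrightarrow> lead_coeff (p k) = 1"
    and orth: "\<And>k l. k < n \<Longrightarrow> l < n \<Longrightarrow>
       (\<Sum>i<n. w i * poly (p k) (x i) * poly (p l) (x i)) = (if k = l then h k else 0)"
  shows "(\<Prod>i<n. w i) * (\<Prod>k<n. \<Prod>j<k. x k - x j)\<^sup>2 = (\<Prod>k<n. h k)"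
proof -
  define V where "V = mat n n (\<lambda>(i,k). poly (p k) (x i))"
  define W where "W = mat n n (\<lambda>(i,j). if i = j then w i else 0)"
  define H where "H = mat n n (\<lambda>(i,j). if i = j then h i else 0)"
  have c: "V \<in> carrier_mat n n" "W \<in> carrier_mat n n" "H \<in> carrier_mat n n"
    by (auto simp: V_def W_def H_def)
  have WV: "(W * V) $$ (i,l) = w i * poly (p l) (x i)" if "i < n" "l < n" for i l
  proof -
    have "(W * V) $$ (i,l) = (\<Sum>j\<in>{0..<n}. (if i = j then w i else 0) * poly (p l) (x j))"
      using that by (simp add: W_def V_def scalar_prod_def)
    also have "\<dots> = (\<Sum>j\<in>{0..<n}. if j = i then w i * poly (p l) (x i) else 0)"
      by (intro sum.cong) auto
    finally show ?thesis using that by simp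
  qed
  have "V\<^sup>T * (W * V) = H"
  proof (rule eq_matI)
    fix k l assume "k < dim_row H" "l < dim_col H"
    then have kl: "k < n" "l < n" using c by auto
    have "(V\<^sup>T * (W * V)) $$ (k,l) = (\<Sum>i\<in>{0..<n}. V $$ (i,k) * (W * V) $$ (i,l))"
      using kl c by (auto simp: scalar_prod_def intro!: sum.cong)
    also have "\<dots> = (\<Sum>i<n. w i * poly (p k) (x i) * poly (p l) (x i))"
      unfolding atLeast0LessThan
    proof (intro sum.cong refl)
      fix i assume "i \<in> {..<n}"
      with kl WV[of i l] show "V $$ (i,k) * (W * V) $$ (i,l) = w i * poly (p k) (x i) * poly (p l) (x i)"
        by (simp add: V_def)
    qed
    also have "\<dots> = H $$ (k,l)" using orth[OF kl] kl by (simp add: H_def)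
    finally show "(V\<^sup>T * (W * V)) $$ (k,l) = H $$ (k,l)" .
  qed (use c in auto)
  then have "det H = det V * (det W * det V)"
    using det_mult[of "V\<^sup>T" n "W * V"] det_mult[OF c(2,1)] det_transpose[OF c(1)] c by simp
  then show ?thesis
    using det_diag_fun[of n h] det_diag_fun[of n w] det_monic_eval_vandermonde[OF deg lc, of n x]
    by (simp add: H_def W_def V_def power2_eq_square mult_ac)
qed

section \<open>Three-term recurrences\<close>

text \<open>Characteristic polynomials of the leading blocks of a tridiagonal matrix with diagonal
  \<open>a\<close>, where \<open>c k\<close> is the product of the two off-diagonal entries that
  link rows k and k + 1.\<close>

fun jacobi_poly :: "(nat \<Rightarrow> real) \<Rightarrow> (nat \<Rightarrow> real) \<Rightarrow> nat \<Rightarrow> real poly" where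
  "jacobi_poly a c 0 = 1"
| "jacobi_poly a c (Suc 0) = [:- a 0, 1:]"
| "jacobi_poly a c (Suc (Suc k)) =
     [:- a (Suc k), 1:] * jacobi_poly a c (Suc k) - Polynomial.smult (c k) (jacobi_poly a c k)"

lemma jacobi_poly_monic: "degree (jacobi_poly a c k) = k \<and> lead_coeff (jacobi_poly a c k) = 1"
proof (induction k rule: less_induct)
  case (less k)
  consider "k = 0" | "k = 1" | m where "k = Suc (Suc m)" by (metis One_nat_def not0_implies_Suc)
  then show ?case
  proof cases
    case (3 m)
    let ?p = "jacobi_poly a c (Suc m)" and ?q = "Polynomial.smult (c m) (jacobi_poly a c m)"
    let ?r = "[:- a (Suc m), 1:] * ?p"
    have "degree ?p = Suc m \<and> lead_coeff ?p = 1" by (rule less.IH) (simp add: 3)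
    then have p: "degree ?p = Suc m" "lead_coeff ?p = 1" by blast+
    have q: "degree ?q \<le> m"
      using less.IH[of m] 3 degree_smult_le[of "c m" "jacobi_poly a c m"] by simp
    have "?p \<noteq> 0" using p(1) by force
    then have r: "degree ?r = Suc (Suc m)" using p by (subst degree_mult_eq) auto
    have "lead_coeff ?r = lead_coeff [:- a (Suc m), 1:] * lead_coeff ?p" by (rule lead_coeff_mult)
    then have r': "lead_coeff ?r = 1" unfolding p(2) by simp
    have "degree ?q < degree ?r" using q r by simp
    then have "degree (?r - ?q) = degree ?r" "lead_coeff (?r - ?q) = lead_coeff ?r"
      using degree_add_eq_left[of "- ?q" ?r] lead_coeff_add_le[of "- ?q" ?r]
      by (auto simp del: mult_pCons_left simp: coeff_eq_0)
    then show ?thesis using 3 r r' by simp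
  qed auto
qed

lemmas degree_jacobi_poly = jacobi_poly_monic[THEN conjunct1]
lemmas lead_coeff_jacobi_poly = jacobi_poly_monic[THEN conjunct2]

lemma jacobi_poly_recurrence:
  "x * poly (jacobi_poly a c k) x = poly (jacobi_poly a c (Suc k)) x + a k * poly (jacobi_poly a c k) x
     + (if k = 0 then 0 else c (k - 1) * poly (jacobi_poly a c (k - 1)) x)"
  by (cases k) (auto simp: algebra_simps)

text \<open>The right-hand side telescopes along the recurrence. Two free sequences over an
  arbitrary field let one identity serve both for a pair of real zeros and for a complex point with
  its conjugate.\<close>

lemma christoffel_darboux:
  fixes u v a c h :: "nat \<Rightarrow> 'a :: field"
  assumes u: "u (Suc 0) = (x - a 0) * u 0" "\<And>k. u (Suc (Suc k)) = (x - a (Suc k)) * u (Suc k) - c k * u k"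
    and v: "v (Suc 0) = (y - a 0) * v 0" "\<And>k. v (Suc (Suc k)) = (y - a (Suc k)) * v (Suc k) - c k * v k"
    and h: "\<And>k. k \<le> m \<Longrightarrow> h k \<noteq> 0" "\<And>k. k < m \<Longrightarrow> h (Suc k) = c k * h k"
  shows "(x - y) * (\<Sum>k\<le>m. u k * v k / h k) = (u (Suc m) * v m - u m * v (Suc m)) / h m"
  using h
proof (induction m)
  case 0
  then show ?case by (simp add: u v field_simps)
next
  case (Suc m)
  have ne: "h m \<noteq> 0" "c m \<noteq> 0" and hm: "h (Suc m) = c m * h m"
    using Suc.prems(1)[of m] Suc.prems(1)[of "Suc m"] Suc.prems(2)[of m] by auto
  have "(x - y) * (\<Sum>k\<le>Suc m. u k * v k / h k) =
      (u (Suc m) * v m - u m * v (Suc m)) / h m + (x - y) * (u (Suc m) * v (Suc m) / h (Suc m))"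
    using Suc by (simp add: distrib_left)
  also have "\<dots> = (u (Suc (Suc m)) * v (Suc m) - u (Suc m) * v (Suc (Suc m))) / h (Suc m)"
    unfolding hm u(2) v(2) using ne by (simp add: field_simps)
  finally show ?case .
qed

section \<open>Zeros of Jacobi polynomials are real and simple\<close>

lemma jacobi_poly_wronskian_pos:
  assumes "\<And>l. l < m \<Longrightarrow> c l > 0"
  shows "poly (pderiv (jacobi_poly a c (Suc m))) x * poly (jacobi_poly a c m) x
       - poly (pderiv (jacobi_poly a c m)) x * poly (jacobi_poly a c (Suc m)) x > 0"
  using assms
proof (induction m)
  case 0
  then show ?case by (simp add: pderiv_pCons)
next
  case (Suc m)
  let ?p = "\<lambda>k. poly (jacobi_poly a c k) x" and ?d = "\<lambda>k. poly (pderiv (jacobi_poly a c k)) x"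
  have d: "?d (Suc (Suc m)) = ?p (Suc m) + (x - a (Suc m)) * ?d (Suc m) - c m * ?d m"
    by (simp add: pderiv_mult pderiv_diff pderiv_smult pderiv_pCons pderiv_add algebra_simps)
  have p: "?p (Suc (Suc m)) = (x - a (Suc m)) * ?p (Suc m) - c m * ?p m" by (simp add: algebra_simps)
  \<comment> \<open>Confluent form of the Christoffel-Darboux identity: each Wronskian is a square
    plus a positive multiple of the preceding one. A double zero would make it vanish.\<close>
  have "?d (Suc (Suc m)) * ?p (Suc m) - ?d (Suc m) * ?p (Suc (Suc m)) =
      (?p (Suc m))\<^sup>2 + c m * (?d (Suc m) * ?p m - ?d m * ?p (Suc m))"
    unfolding d p by (simp add: algebra_simps power2_eq_square)
  moreover have "c m * (?d (Suc m) * ?p m - ?d m * ?p (Suc m)) > 0"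
    using Suc by simp
  ultimately show ?case by (simp add: add_nonneg_pos)
qed

lemma map_poly_jacobi_poly_rec:
  fixes z :: complex and a c :: "nat \<Rightarrow> real"
  defines "u \<equiv> \<lambda>k. poly (map_poly of_real (jacobi_poly a c k)) z"
  shows "u 0 = 1" "u (Suc 0) = (z - of_real (a 0)) * u 0"
    "u (Suc (Suc k)) = (z - of_real (a (Suc k))) * u (Suc k) - of_real (c k) * u k"
proof -
  have [simp]: "map_poly complex_of_real (p - q) = map_poly of_real p - map_poly of_real q"
    "map_poly complex_of_real (p * q) = map_poly of_real p * map_poly of_real q"
    "map_poly complex_of_real (Polynomial.smult r q) = Polynomial.smult (of_real r) (map_poly of_real q)" for p q r
    by (auto intro!: poly_eqI simp: coeff_map_poly coeff_mult)
  show "u 0 = 1" "u (Suc 0) = (z - of_real (a 0)) * u 0"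
    by (simp_all add: u_def map_poly_pCons)
  have "u (Suc (Suc k)) = poly (map_poly of_real ([:- a (Suc k), 1:] * jacobi_poly a c (Suc k)
      - Polynomial.smult (c k) (jacobi_poly a c k))) z"
    by (simp add: u_def del: mult_pCons_left)
  also have "\<dots> = poly (map_poly of_real [:- a (Suc k), 1:]) z * u (Suc k) - of_real (c k) * u k"
    by (simp add: u_def del: mult_pCons_left jacobi_poly.simps)
  finally show "u (Suc (Suc k)) = (z - of_real (a (Suc k))) * u (Suc k) - of_real (c k) * u k"
    by (simp add: map_poly_pCons)
qed

text \<open>This replaces self-adjointness. For a zero z and its conjugate the right-hand side of
  \<open>christoffel_darboux\<close> vanishes, whereas the sum on the left is at least its first
  term, which is 1. So z equals its conjugate.\<close>

lemma jacobi_poly_complex_root_real: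
  fixes z :: complex
  assumes c: "\<And>l. Suc l < n \<Longrightarrow> c l > 0" and root: "poly (map_poly of_real (jacobi_poly a c n)) z = 0"
  shows "z \<in> \<real>"
proof (cases n)
  case 0
  then show ?thesis using root by simp
next
  case (Suc m)
  define h where "h k = (\<Prod>l<k. c l)" for k
  have h: "h k > 0" if "k \<le> m" for k using that c Suc by (auto simp: h_def intro!: prod_pos)
  define u where "u k = poly (map_poly of_real (jacobi_poly a c k)) z" for k
  have uc: "poly (map_poly of_real (jacobi_poly a c k)) (cnj z) = cnj (u k)" for k
    unfolding u_def by (subst poly_cnj_real) (auto simp: coeff_map_poly)
  note ru = map_poly_jacobi_poly_rec[where a = a and c = c and z = z, folded u_def]
  note rv = map_poly_jacobi_poly_rec[where a = a and c = c and z = "cnj z", unfolded uc]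
  have "(z - cnj z) * (\<Sum>k\<le>m. u k * cnj (u k) / of_real (h k)) =
     (u (Suc m) * cnj (u m) - u m * cnj (u (Suc m))) / of_real (h m)"
  proof (rule christoffel_darboux[where a = "\<lambda>k. of_real (a k)" and c = "\<lambda>k. of_real (c k)"])
    show "complex_of_real (h k) \<noteq> 0" if "k \<le> m" for k using h[OF that] by simp
  qed (use ru rv in \<open>auto simp: h_def\<close>)
  moreover have "u (Suc m) = 0" using root Suc by (simp add: u_def)
  moreover have sum_eq: "(\<Sum>k\<le>m. u k * cnj (u k) / of_real (h k)) = of_real (\<Sum>k\<le>m. (cmod (u k))\<^sup>2 / h k)"
    by (simp add: complex_norm_square del: of_real_power)
  moreover have "(\<Sum>k\<le>m. (cmod (u k))\<^sup>2 / h k) \<ge> (cmod (u 0))\<^sup>2 / h 0"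
    using h by (intro member_le_sum) (auto intro!: divide_nonneg_pos)
  then have "(\<Sum>k\<le>m. (cmod (u k))\<^sup>2 / h k) > 0" using ru(1) by (simp add: h_def)
  ultimately have "z = cnj z" unfolding sum_eq of_real_eq_0_iff by (auto simp del: of_real_sum)
  then show ?thesis by (metis Reals_cnj_iff)
qed

text \<open>A square-free complex polynomial has as many zeros as its degree. The Wronskian rules
  out double zeros, and since all zeros are real the count carries over to the reals.\<close>

lemma card_jacobi_poly_roots:
  assumes c: "\<And>l. Suc l < n \<Longrightarrow> c l > 0"
  shows "card {x. poly (jacobi_poly a c n) x = 0} = n"
proof -
  let ?p = "jacobi_poly a c n"
  let ?P = "map_poly complex_of_real ?p"
  have real: "z \<in> \<real>" if "poly ?P z = 0" for z
    using jacobi_poly_complex_root_real[OF c that] by simp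
  have ev: "poly (map_poly complex_of_real q) (of_real r) = of_real (poly q r)" for q r
    by (induction q) (auto simp: map_poly_pCons)
  have "rsquarefree ?P"
    unfolding rsquarefree_roots
  proof (intro allI notI)
    fix z assume z: "poly ?P z = 0 \<and> poly (pderiv ?P) z = 0"
    then obtain r where r: "z = of_real r" using real by (auto elim: Reals_cases)
    have "poly ?p r = 0" "poly (pderiv ?p) r = 0"
      using z unfolding r of_real_hom.map_poly_pderiv[symmetric] ev by auto
    moreover obtain m where "n = Suc m" using \<open>poly ?p r = 0\<close> by (cases n) auto
    ultimately show False using jacobi_poly_wronskian_pos[of m c a r] c by simp
  qed
  then have "card {z. poly ?P z = 0} = degree ?P"
    using rsquarefree_card_degree[of ?P] unfolding rsquarefree_def by simp
  also have "\<dots> = n" by (simp add: degree_jacobi_poly)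
  also have "{z. poly ?P z = 0} = of_real ` {x. poly ?p x = 0}"
    using real ev by (fastforce elim: Reals_cases)
  also have "card \<dots> = card {x. poly ?p x = 0}" by (intro card_image) (auto intro: inj_onI)
  finally show ?thesis .
qed

section \<open>Trace and Vandermonde determinant of the zeros\<close>

lemma jacobi_trace_identity:
  fixes w x h :: "nat \<Rightarrow> real"
  assumes n: "n > 0"
    and orth: "\<And>k l. k < n \<Longrightarrow> l < n \<Longrightarrow>
       (\<Sum>i<n. w i * poly (jacobi_poly a c k) (x i) * poly (jacobi_poly a c l) (x i)) = (if k = l then h k else 0)"
    and w: "\<And>i. i < n \<Longrightarrow> w i > 0" and h: "\<And>k. k < n \<Longrightarrow> h k > 0"
    and hS: "\<And>k. Suc k < n \<Longrightarrow> h (Suc k) = c k * h k"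
    and root: "\<And>i. i < n \<Longrightarrow> poly (jacobi_poly a c n) (x i) = 0"
  shows "(\<Sum>i<n. (x i)\<^sup>2) = (\<Sum>k<n. (a k)\<^sup>2) + 2 * (\<Sum>k<n-1. c k)"
proof -
  define p where "p k i = poly (jacobi_poly a c k) (x i)" for k i
  note orth = orth[folded p_def]
  \<comment> \<open>Completeness of the polynomials on the points. It is inserted below as a
    partition of 1 that distributes each squared point over the rows of the Jacobi matrix.\<close>
  have compl: "(\<Sum>k<n. p k i * p k i / h k) = 1 / w i" if "i < n" for i
    using orthogonal_rows_columns[where F = p, OF orth h w that that] by auto
  \<comment> \<open>In row k of the symmetric Jacobi matrix, \<open>s k\<close> and
    \<open>t k\<close> are the squared entries left and right of the diagonal.
    \<open>s 0 = 0\<close> makes the truncated index \<open>k - 1\<close> harmless, and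
    \<open>t\<close> is cut off in the last row because the polynomial of degree n vanishes at the
    points.\<close>
  define s where "s k = (if k = 0 then 0 else c (k - 1))" for k
  define t where "t k = (if Suc k < n then c k else 0)" for k
  have row: "(\<Sum>i<n. w i * (x i * p k i)\<^sup>2) / h k = t k + (a k)\<^sup>2 + s k" if k: "k < n" for k
  proof -
    have rec: "x i * p k i = p (Suc k) i + a k * p k i + s k * p (k - 1) i" for i
      using jacobi_poly_recurrence[of "x i" a c k] by (auto simp: p_def s_def)
    have "(\<Sum>i<n. w i * (x i * p k i)\<^sup>2) =
        (\<Sum>i<n. w i * p (Suc k) i * p (Suc k) i) + (a k)\<^sup>2 * (\<Sum>i<n. w i * p k i * p k i)
        + (s k)\<^sup>2 * (\<Sum>i<n. w i * p (k - 1) i * p (k - 1) i)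
        + 2 * a k * (\<Sum>i<n. w i * p (Suc k) i * p k i)
        + 2 * s k * (\<Sum>i<n. w i * p (Suc k) i * p (k - 1) i)
        + 2 * a k * s k * (\<Sum>i<n. w i * p k i * p (k - 1) i)"
      unfolding rec by (simp add: power2_eq_square algebra_simps sum.distrib sum_distrib_left)
    moreover have Suc_orth: "(\<Sum>i<n. w i * p (Suc k) i * p l i) = 0" if "l \<le> k" for l
    proof (cases "Suc k < n")
      case True then show ?thesis using orth[of "Suc k" l] that k by auto
    next
      case False
      then have "Suc k = n" using k by simp
      then show ?thesis using root by (auto simp: p_def)
    qed
    note Suc_orth[of k] Suc_orth[of "k - 1"]
    moreover have "(\<Sum>i<n. w i * p (Suc k) i * p (Suc k) i) = t k * h k"
    proof (cases "Suc k < n")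
      case True then show ?thesis using orth[of "Suc k" "Suc k"] hS[of k] by (simp add: t_def)
    next
      case False
      then have "Suc k = n" using k by simp
      then show ?thesis using root by (auto simp: p_def t_def)
    qed
    moreover have "s k * (\<Sum>i<n. w i * p k i * p (k - 1) i) = 0"
      using orth[of k "k - 1"] k by (auto simp: s_def)
    moreover have "(s k)\<^sup>2 * (\<Sum>i<n. w i * p (k - 1) i * p (k - 1) i) = s k * h k"
      using orth[of "k - 1" "k - 1"] hS[of "k - 1"] k by (cases k) (auto simp: s_def power2_eq_square)
    ultimately have "(\<Sum>i<n. w i * (x i * p k i)\<^sup>2) = (t k + (a k)\<^sup>2 + s k) * h k"
      using orth[of k k] k by (simp add: algebra_simps)
    then show ?thesis using h[OF k] by simp
  qed
  have "(\<Sum>i<n. (x i)\<^sup>2) = (\<Sum>i<n. \<Sum>k<n. w i * (x i * p k i)\<^sup>2 / h k)"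
  proof (intro sum.cong refl)
    fix i assume "i \<in> {..<n}"
    then have i: "i < n" by simp
    have "(\<Sum>k<n. w i * (x i * p k i)\<^sup>2 / h k) = w i * (x i)\<^sup>2 * (\<Sum>k<n. p k i * p k i / h k)"
      by (simp add: sum_distrib_left power2_eq_square mult_ac)
    also have "\<dots> = (x i)\<^sup>2" using compl[OF i] w[OF i] by simp
    finally show "(x i)\<^sup>2 = (\<Sum>k<n. w i * (x i * p k i)\<^sup>2 / h k)" by simp
  qed
  also have "\<dots> = (\<Sum>k<n. (\<Sum>i<n. w i * (x i * p k i)\<^sup>2) / h k)"
    by (subst sum.swap) (simp add: sum_divide_distrib)
  also have "\<dots> = (\<Sum>k<n. t k + (a k)\<^sup>2 + s k)" using row by (intro sum.cong) auto
  also have "\<dots> = (\<Sum>k<n. t k) + (\<Sum>k<n. (a k)\<^sup>2) + (\<Sum>k<n. s k)" by (simp add: sum.distrib)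
  also obtain m where m: "n = Suc m" using n by (cases n) auto
  have "(\<Sum>k<n. t k) = (\<Sum>k<n-1. c k)" by (simp add: t_def m)
  moreover have "(\<Sum>k<n. s k) = (\<Sum>k<n-1. c k)" by (simp add: m sum.lessThan_Suc_shift s_def del: sum.lessThan_Suc)
  ultimately show ?thesis by simp
qed

definition vdm :: "nat \<Rightarrow> (nat \<Rightarrow> real) \<Rightarrow> real" where
  "vdm n x = (\<Prod>k<n. \<Prod>j<k. x k - x j)"

lemma sum_ln_dist_eq:
  assumes "inj_on x {..<n}"
  shows "2 * (\<Sum>k<n. \<Sum>j<k. ln \<bar>x j - x k\<bar>) = ln ((vdm n x)\<^sup>2)" and "vdm n x \<noteq> 0"
proof -
  have ne: "x k \<noteq> x j" if "k < n" "j < k" for k j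
    using inj_onD[OF assms, of k j] that by auto
  then show "vdm n x \<noteq> 0" by (auto simp: vdm_def)
  have "ln ((vdm n x)\<^sup>2) = 2 * ln \<bar>vdm n x\<bar>"
    using ln_realpow[of "\<bar>vdm n x\<bar>" 2] \<open>vdm n x \<noteq> 0\<close> by simp
  also have "\<bar>vdm n x\<bar> = (\<Prod>k<n. \<Prod>j<k. \<bar>x j - x k\<bar>)"
    by (simp add: vdm_def abs_prod abs_minus_commute)
  also have "ln \<dots> = (\<Sum>k<n. \<Sum>j<k. ln \<bar>x j - x k\<bar>)"
    using ne by (subst ln_prod) (auto intro!: sum.cong ln_prod simp: prod_pos ne ne[symmetric])
  finally show "2 * (\<Sum>k<n. \<Sum>j<k. ln \<bar>x j - x k\<bar>) = ln ((vdm n x)\<^sup>2)" by simp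
qed

lemma coeff_jacobi_poly_self: "coeff (jacobi_poly a c k) k = 1"
  using lead_coeff_jacobi_poly[of a c k] by (simp add: degree_jacobi_poly)

text \<open>At zeros of the polynomial of degree n, Christoffel-Darboux makes the vectors of
  polynomial values at different points orthogonal. Transposing gives orthogonal polynomials for the
  weights \<open>1 / K i\<close>, the spectral weights of the Jacobi matrix. Each \<open>K i\<close>
  contains the term 1 of degree 0, so the weights are at most 1 and dropping them from the
  Vandermonde identity leaves an inequality in the right direction.\<close>

lemma jacobi_roots_vdm_trace:
  assumes n: "n > 0" and c: "\<And>l. Suc l < n \<Longrightarrow> c l > 0" and inj: "inj_on x {..<n}"
    and root: "\<And>i. i < n \<Longrightarrow> poly (jacobi_poly a c n) (x i) = 0"
  shows "(\<Prod>k<n. \<Prod>l<k. c l) \<le> (vdm n x)\<^sup>2"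
    and "(\<Sum>i<n. (x i)\<^sup>2) = (\<Sum>k<n. (a k)\<^sup>2) + 2 * (\<Sum>k<n-1. c k)"
proof -
  define p where "p k i = poly (jacobi_poly a c k) (x i)" for k i
  define h where "h k = (\<Prod>l<k. c l)" for k
  have h: "h k > 0" if "k < n" for k using c that by (auto simp: h_def intro!: prod_pos)
  define K where "K i = (\<Sum>k<n. p k i * p k i / h k)" for i
  have K1: "K i \<ge> 1" if "i < n" for i
  proof -
    have "p 0 i * p 0 i / h 0 \<le> K i"
      unfolding K_def using h n by (intro member_le_sum) (auto simp: less_imp_le)
    then show ?thesis by (simp add: p_def h_def)
  qed
  have rows: "(\<Sum>k<n. 1 / h k * p k i * p k j) = (if i = j then K i else 0)" if "i < n" "j < n" for i j
  proof (cases "i = j")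
    case True then show ?thesis by (simp add: K_def mult_ac)
  next
    case False
    obtain m where m: "n = Suc m" using n by (cases n) auto
    have "(x i - x j) * (\<Sum>k\<le>m. p k i * p k j / h k) = (p (Suc m) i * p m j - p m i * p (Suc m) j) / h m"
    proof (rule christoffel_darboux[where a = a and c = c])
      show "h k \<noteq> 0" if "k \<le> m" for k using h[of k] that m by auto
    qed (auto simp: p_def h_def algebra_simps)
    also have "\<dots> = 0" using root[OF that(1)] root[OF that(2)] by (simp add: p_def m)
    finally have "(\<Sum>k<n. p k i * p k j / h k) = 0"
      using inj_onD[OF inj, of i j] that False by (auto simp: m lessThan_Suc_atMost)
    then show ?thesis using False by (simp add: mult_ac)
  qed
  \<comment> \<open>Here the points index the rows and the degrees the columns, so the roles of
    \<open>w\<close> and \<open>h\<close> are exchanged.\<close>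
  have orth: "(\<Sum>i<n. 1 / K i * p k i * p l i) = (if k = l then h k else 0)" if "k < n" "l < n" for k l
    using orthogonal_rows_columns[where F = "\<lambda>i k. p k i" and w = "\<lambda>k. 1 / h k" and h = K,
        OF rows _ _ that] K1 h by (force simp: mult_ac)
  have "(\<Prod>i<n. 1 / K i) * (vdm n x)\<^sup>2 = (\<Prod>k<n. h k)"
    unfolding vdm_def
    by (rule vandermonde_sq_orthogonal[where p = "jacobi_poly a c"])
       (use orth in \<open>auto simp: p_def degree_jacobi_poly coeff_jacobi_poly_self\<close>)
  moreover have "(\<Prod>i<n. 1 / K i) * (vdm n x)\<^sup>2 \<le> 1 * (vdm n x)\<^sup>2"
    using K1 by (intro mult_right_mono prod_le_1) (force simp: divide_le_eq)+
  ultimately show "(\<Prod>k<n. \<Prod>l<k. c l) \<le> (vdm n x)\<^sup>2" by (simp add: h_def)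
  show "(\<Sum>i<n. (x i)\<^sup>2) = (\<Sum>k<n. (a k)\<^sup>2) + 2 * (\<Sum>k<n-1. c k)"
    by (rule jacobi_trace_identity[where w = "\<lambda>i. 1 / K i" and h = h, OF n _ _ h _ root])
       (use orth K1 in \<open>force simp: p_def h_def\<close>)+
qed

section \<open>Jacobi coefficients of an arbitrary finite point set\<close>

fun lanczos :: "(real poly \<Rightarrow> real poly \<Rightarrow> real) \<Rightarrow> nat \<Rightarrow> real poly" where
  "lanczos ip 0 = 1"
| "lanczos ip (Suc 0) = [:- (ip [:0, 1:] 1 / ip 1 1), 1:]"
| "lanczos ip (Suc (Suc k)) = (let p = lanczos ip (Suc k); q = lanczos ip k in
     [:- (ip (pCons 0 p) p / ip p p), 1:] * p - Polynomial.smult (ip p p / ip q q) q)"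

text \<open>Stieltjes procedure for the counting measure of the points. Its total mass is n rather
  than 1, so each of the n squared norms carries a factor n, whence \<open>real n ^ n\<close>. The
  last claim drops the squares of the diagonal coefficients from the trace identity.\<close>

lemma jacobi_parameters_exist:
  assumes n: "n > 0" and inj: "inj_on x {..<n}"
  obtains c where "\<And>l. Suc l < n \<Longrightarrow> c l > (0::real)"
    "(vdm n x)\<^sup>2 = real n ^ n * (\<Prod>k<n. \<Prod>l<k. c l)"
    "2 * (\<Sum>k<n-1. c k) \<le> (\<Sum>i<n. (x i)\<^sup>2)"
proof -
  define ip where "ip f g = (\<Sum>i<n. poly f (x i) * poly g (x i))" for f g
  define a where "a k = ip (pCons 0 (lanczos ip k)) (lanczos ip k) / ip (lanczos ip k) (lanczos ip k)" for k
  define c where "c k = ip (lanczos ip (Suc k)) (lanczos ip (Suc k)) / ip (lanczos ip k) (lanczos ip k)" for k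
  \<comment> \<open>The coefficients \<open>a\<close> and \<open>c\<close> are computed from the
    polynomials that they generate, so \<open>lanczos\<close> had to be defined without them. The
    identification holds for every k, including degrees where a norm is 0 and the quotients take
    their default value.\<close>
  have L: "lanczos ip k = jacobi_poly a c k" for k
  proof (induction k rule: less_induct)
    case (less k)
    consider "k = 0" | "k = 1" | m where "k = Suc (Suc m)" by (metis One_nat_def not0_implies_Suc)
    then show ?case
    proof cases
      case 2 then show ?thesis by (simp add: a_def one_pCons)
    next
      case (3 m)
      have "lanczos ip k = [:- a (Suc m), 1:] * lanczos ip (Suc m) - Polynomial.smult (c m) (lanczos ip m)"
        unfolding 3 by (simp add: a_def c_def Let_def del: mult_pCons_left)
      then show ?thesis using less.IH[of m] less.IH[of "Suc m"] 3 by (simp del: mult_pCons_left)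
    qed simp
  qed
  define p where "p k i = poly (jacobi_poly a c k) (x i)" for k i
  define N where "N k = (\<Sum>i<n. p k i * p k i)" for k
  have N_pos: "N k > 0" if "k < n" for k
  proof -
    have ne: "jacobi_poly a c k \<noteq> 0" using lead_coeff_jacobi_poly[of a c k] by auto
    have "\<exists>i<n. p k i \<noteq> 0"
    proof (rule ccontr)
      assume "\<not> ?thesis"
      then have "x ` {..<n} \<subseteq> {y. poly (jacobi_poly a c k) y = 0}" by (auto simp: p_def)
      then have "card (x ` {..<n}) \<le> card {y. poly (jacobi_poly a c k) y = 0}"
        using ne by (intro card_mono poly_roots_finite)
      also have "\<dots> \<le> k" using poly_roots_degree[OF ne] by (simp add: degree_jacobi_poly)
      finally show False using that inj by (simp add: card_image)
    qed
    then obtain i where "i < n" "p k i \<noteq> 0" by auto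
    then show ?thesis unfolding N_def by (intro sum_pos2[of _ i]) (auto simp: power2_eq_square[symmetric])
  qed
  have cN: "c k = N (Suc k) / N k" for k by (simp add: c_def L ip_def N_def p_def)
  have aN: "a k * N k = (\<Sum>i<n. x i * p k i * p k i)" if "k < n" for k
    using N_pos[OF that] by (simp add: a_def L ip_def N_def p_def mult_ac)
  define s where "s k = (if k = 0 then 0 else c (k - 1))" for k
  have rec: "x i * p k i = p (Suc k) i + a k * p k i + s k * p (k - 1) i" for k i
    using jacobi_poly_recurrence[of "x i" a c k] by (auto simp: p_def s_def)
  \<comment> \<open>The range includes m = n: the polynomial of degree n is orthogonal to all
    earlier ones, and this will force it to vanish at the points.\<close>
  have orth: "(\<Sum>i<n. p m i * p j i) = 0" if "m \<le> n" "j < m" for m j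
    using that
  proof (induction m arbitrary: j rule: less_induct)
    case (less m)
    obtain k where m: "m = Suc k" using less.prems by (cases m) auto
    have k: "k < n" and jk: "j \<le> k" using less.prems m by auto
    have IH: "(\<Sum>i<n. p k i * p l i) = 0" if "l < k" for l using less.IH[of k l] that m k by auto
    have IH': "(\<Sum>i<n. p (k-1) i * p l i) = 0" if "l < k - 1" for l
      using less.IH[of "k-1" l] that m k by auto
    have eq: "(\<Sum>i<n. p m i * p j i) = (\<Sum>i<n. x i * p k i * p j i) - a k * (\<Sum>i<n. p k i * p j i)
        - s k * (\<Sum>i<n. p (k-1) i * p j i)"
      unfolding rec m by (simp add: algebra_simps sum.distrib sum_distrib_left)
    show ?case
    proof (cases "j = k")
      case True
      have "s k * (\<Sum>i<n. p (k-1) i * p k i) = 0"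
        using IH[of "k - 1"] by (cases k) (auto simp: s_def mult_ac)
      moreover have "(\<Sum>i<n. p k i * p k i) = N k" by (simp add: N_def)
      ultimately show ?thesis using aN[OF k] eq True by simp
    next
      case False
      then have j: "j < k" using jk by simp
      have "(\<Sum>i<n. x i * p k i * p j i) = (\<Sum>i<n. p k i * (x i * p j i))" by (simp add: mult_ac)
      also have "\<dots> = (\<Sum>i<n. p k i * p (Suc j) i) + a j * (\<Sum>i<n. p k i * p j i) + s j * (\<Sum>i<n. p k i * p (j-1) i)"
        unfolding rec by (simp add: algebra_simps sum.distrib sum_distrib_left)
      also have "\<dots> = (\<Sum>i<n. p k i * p (Suc j) i)" using IH[of j] IH[of "j-1"] j by auto
      finally have e1: "(\<Sum>i<n. x i * p k i * p j i) = (\<Sum>i<n. p k i * p (Suc j) i)" .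
      \<comment> \<open>The coefficient \<open>c (k - 1)\<close> matters only when
        \<open>Suc j = k\<close>, where it cancels the squared norm; for smaller j every sum
        vanishes by induction.\<close>
      show ?thesis
      proof (cases "Suc j = k")
        case True
        then have "s k * (\<Sum>i<n. p (k-1) i * p j i) = N k" using N_pos[of j] k
          by (auto simp: s_def cN N_def[symmetric])
        moreover have "(\<Sum>i<n. p k i * p (Suc j) i) = N k" using True by (simp add: N_def)
        ultimately show ?thesis using eq e1 IH[OF j] by simp
      next
        case False
        then show ?thesis using eq e1 IH[OF j] IH[of "Suc j"] IH'[of j] j by simp
      qed
    qed
  qed
  have orthN: "(\<Sum>i<n. 1 * p k i * p l i) = (if k = l then N k else 0)" if "k < n" "l < n" for k l
  proof (cases k l rule: linorder_cases)
    case less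
    have "(\<Sum>i<n. p k i * p l i) = (\<Sum>i<n. p l i * p k i)" by (simp add: mult.commute)
    then show ?thesis using orth[of l k] less that by simp
  next
    case greater then show ?thesis using orth[of k l] that by simp
  qed (simp add: N_def)
  have compl: "(\<Sum>k<n. p k i * p k j / N k) = (if i = j then 1 else 0)" if "i < n" "j < n" for i j
    using orthogonal_rows_columns[where F = p and w = "\<lambda>_. 1" and h = N, OF orthN N_pos _ that] by simp
  \<comment> \<open>The polynomials of degree below n span all functions on the points. Expanding
    the point mass at \<open>x j\<close> in them writes the value of the polynomial of degree n as a
    combination of vanishing inner products.\<close>
  have root: "poly (jacobi_poly a c n) (x j) = 0" if "j < n" for j
  proof -
    have "p n j = (\<Sum>i<n. p n i * (if i = j then 1 else 0))" using that by (simp add: if_distrib cong: if_cong)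
    also have "\<dots> = (\<Sum>i<n. p n i * (\<Sum>k<n. p k i * p k j / N k))"
      using compl that by (intro sum.cong) auto
    also have "\<dots> = (\<Sum>k<n. p k j / N k * (\<Sum>i<n. p n i * p k i))"
      unfolding sum_distrib_left by (subst sum.swap) (simp add: mult_ac)
    also have "\<dots> = 0" using orth[of n] by (intro sum.neutral) auto
    finally show ?thesis by (simp add: p_def)
  qed
  have NS: "N (Suc k) = c k * N k" if "Suc k < n" for k using N_pos[of k] that by (simp add: cN)
  have N: "N k = real n * (\<Prod>l<k. c l)" if "k < n" for k
    using that
  proof (induction k)
    case 0 then show ?case by (simp add: N_def p_def)
  qed (simp add: NS)
  have "(\<Prod>i<n. 1) * (vdm n x)\<^sup>2 = (\<Prod>k<n. N k)"
    unfolding vdm_def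
    by (rule vandermonde_sq_orthogonal[where p = "jacobi_poly a c"])
       (use orthN in \<open>auto simp: p_def degree_jacobi_poly coeff_jacobi_poly_self\<close>)
  also have "\<dots> = (\<Prod>k<n. real n * (\<Prod>l<k. c l))" by (rule prod.cong) (auto simp: N)
  also have "\<dots> = real n ^ n * (\<Prod>k<n. \<Prod>l<k. c l)" by (simp add: prod.distrib)
  finally have 1: "(vdm n x)\<^sup>2 = real n ^ n * (\<Prod>k<n. \<Prod>l<k. c l)" by simp
  have "(\<Sum>i<n. (x i)\<^sup>2) = (\<Sum>k<n. (a k)\<^sup>2) + 2 * (\<Sum>k<n-1. c k)"
    by (rule jacobi_trace_identity[where w = "\<lambda>_. 1" and h = N, OF n _ _ N_pos NS root])
       (use orthN in \<open>auto simp: p_def\<close>)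
  moreover have "(\<Sum>k<n. (a k)\<^sup>2) \<ge> 0" by (intro sum_nonneg) auto
  moreover have "c l > 0" if "Suc l < n" for l using N_pos[of l] N_pos[of "Suc l"] that by (simp add: cN)
  ultimately show ?thesis using that[of c] 1 by simp
qed


section \<open>Eigenvalues of symmetric tridiagonal matrices\<close>

lemma jacobi_eigenvector_recurrence:
  fixes a b :: "nat \<Rightarrow> real"
  assumes b: "\<And>i. Suc i < n \<Longrightarrow> b i \<noteq> 0"
    and root: "poly (jacobi_poly a (\<lambda>i. (b i)\<^sup>2) n) r = 0"
  defines "v \<equiv> \<lambda>k. poly (jacobi_poly a (\<lambda>i. (b i)\<^sup>2) k) r / (\<Prod>l<k. b l)"
  assumes k: "k < n"
  shows "r * v k = (if k = 0 then 0 else b (k - 1) * v (k - 1)) + a k * v k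
      + (if Suc k < n then b k * v (Suc k) else 0)"
proof -
  define p where "p k = poly (jacobi_poly a (\<lambda>i. (b i)\<^sup>2) k) r" for k
  \<comment> \<open>Division by these products symmetrises the recurrence: its off-diagonal
    coefficients 1 and \<open>b\<close>-squared both become \<open>b\<close>.\<close>
  define q where "q k = (\<Prod>l<k. b l)" for k
  have q: "q k \<noteq> 0" if "k < n" for k using b that by (auto simp: q_def)
  have v: "v k = p k / q k" for k by (simp add: v_def p_def q_def)
  have rec: "r * p k = p (Suc k) + a k * p k + (if k = 0 then 0 else (b (k - 1))\<^sup>2 * p (k - 1))"
    unfolding p_def by (rule jacobi_poly_recurrence)
  have "p (Suc k) / q k = (if Suc k < n then b k * v (Suc k) else 0)"
  proof (cases "Suc k < n")
    case True then show ?thesis using b[OF True] by (simp add: v q_def)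
  next
    case False
    then have "Suc k = n" using k by simp
    then show ?thesis using root by (simp add: p_def)
  qed
  moreover have "(if k = 0 then 0 else (b (k - 1))\<^sup>2 * p (k - 1)) / q k = (if k = 0 then 0 else b (k - 1) * v (k - 1))"
  proof (cases k)
    case (Suc m) then show ?thesis using b[of m] k by (simp add: v q_def power2_eq_square)
  qed simp
  moreover have "r * v k = p (Suc k) / q k + a k * v k + (if k = 0 then 0 else (b (k - 1))\<^sup>2 * p (k - 1)) / q k"
    using arg_cong[OF rec, of "\<lambda>t. t / q k"] by (simp add: v add_divide_distrib)
  ultimately show ?thesis by simp
qed

text \<open>Reading the eigenvector equation in a coordinate of maximal absolute value gives a
  row-sum bound of Gershgorin type. The coordinate \<open>v 0 = 1\<close> keeps that maximum
  positive.\<close>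

lemma jacobi_root_bound:
  fixes a b :: "nat \<Rightarrow> real"
  assumes b: "\<And>i. Suc i < n \<Longrightarrow> b i \<noteq> 0" and n: "n > 0"
    and root: "poly (jacobi_poly a (\<lambda>i. (b i)\<^sup>2) n) r = 0"
    and aB: "\<And>i. i < n \<Longrightarrow> \<bar>a i\<bar> \<le> \<alpha>" and bB: "\<And>i. Suc i < n \<Longrightarrow> \<bar>b i\<bar> \<le> \<gamma>" and "\<gamma> \<ge> 0"
  shows "\<bar>r\<bar> \<le> \<alpha> + 2 * \<gamma>"
proof -
  define v where "v k = poly (jacobi_poly a (\<lambda>i. (b i)\<^sup>2) k) r / (\<Prod>l<k. b l)" for k
  obtain k where k: "k < n" and max: "\<And>j. j < n \<Longrightarrow> \<bar>v j\<bar> \<le> \<bar>v k\<bar>"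
  proof -
    have "finite ((\<lambda>j. \<bar>v j\<bar>) ` {..<n})" "(\<lambda>j. \<bar>v j\<bar>) ` {..<n} \<noteq> {}" using n by auto
    note fin = this
    from Max_in[OF fin] obtain k where k: "k < n" "Max ((\<lambda>j. \<bar>v j\<bar>) ` {..<n}) = \<bar>v k\<bar>" by auto
    show ?thesis by (rule that[OF k(1)]) (use Max_ge[OF fin(1)] k(2) in auto)
  qed
  have "v 0 = 1" by (simp add: v_def)
  then have vk: "\<bar>v k\<bar> > 0" using max[OF n] by simp
  let ?s = "if k = 0 then 0 else b (k - 1) * v (k - 1)" and ?t = "if Suc k < n then b k * v (Suc k) else 0"
  have "\<bar>r\<bar> * \<bar>v k\<bar> = \<bar>?s + a k * v k + ?t\<bar>"
    unfolding abs_mult[symmetric] v_def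
    by (rule arg_cong[of _ _ abs]) (rule jacobi_eigenvector_recurrence[OF b root k])
  also have "\<dots> \<le> \<bar>?s\<bar> + \<bar>a k * v k\<bar> + \<bar>?t\<bar>" by linarith
  also have "\<bar>?s\<bar> \<le> \<gamma> * \<bar>v k\<bar>"
    using bB[of "k - 1"] max[of "k - 1"] k \<open>\<gamma> \<ge> 0\<close> by (auto simp: abs_mult intro!: mult_mono)
  also have "\<bar>a k * v k\<bar> \<le> \<alpha> * \<bar>v k\<bar>" using aB[OF k] by (simp add: abs_mult mult_right_mono)
  also have "\<bar>?t\<bar> \<le> \<gamma> * \<bar>v k\<bar>"
    using bB[of k] max[of "Suc k"] \<open>\<gamma> \<ge> 0\<close> by (auto simp: abs_mult intro!: mult_mono)
  finally have "\<bar>r\<bar> * \<bar>v k\<bar> \<le> (\<alpha> + 2 * \<gamma>) * \<bar>v k\<bar>" by (simp add: algebra_simps)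
  then show ?thesis using vk by simp
qed

text \<open>Each of the n zeros of \<open>J\<close> is an eigenvalue by the explicit eigenvector,
  while the characteristic polynomial has at most n roots counted with multiplicity. So its root
  multiset is the set of zeros, which also shows that the eigenvalues are simple.\<close>

lemma eigenvalue_list_tridiagonal:
  fixes A :: "real mat"
  assumes A: "A \<in> carrier_mat n n"
    and sym: "\<And>i j. i < n \<Longrightarrow> j < n \<Longrightarrow> A $$ (j, i) = A $$ (i, j)"
    and tri: "\<And>i j. i < n \<Longrightarrow> j < n \<Longrightarrow> Suc i < j \<Longrightarrow> A $$ (i, j) = 0"
    and ne: "\<And>i. Suc i < n \<Longrightarrow> A $$ (i, Suc i) \<noteq> 0"
  defines "J \<equiv> jacobi_poly (\<lambda>i. A $$ (i, i)) (\<lambda>i. (A $$ (i, Suc i))\<^sup>2) n"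
  shows "inj_on (\<lambda>i. eigenvalue_list A ! i) {..<n}"
    and "i < n \<Longrightarrow> poly J (eigenvalue_list A ! i) = 0"
proof -
  let ?b = "\<lambda>i. A $$ (i, Suc i)"
  define S where "S = {r. poly J r = 0}"
  have card: "card S = n" unfolding S_def J_def by (rule card_jacobi_poly_roots) (use ne in auto)
  have fin: "finite S" unfolding S_def
    using jacobi_poly_monic by (intro poly_roots_finite) (metis J_def coeff_0 zero_neq_one)
  have row: "(\<Sum>j<n. A $$ (k, j) * v j) = (if k = 0 then 0 else ?b (k - 1) * v (k - 1)) + A $$ (k, k) * v k
      + (if Suc k < n then ?b k * v (Suc k) else 0)" if k: "k < n" for k v
  proof -
    have "A $$ (k, j) * v j = (if k \<noteq> 0 \<and> j = k - 1 then ?b (k - 1) * v (k - 1) else 0)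
        + (if j = k then A $$ (k, k) * v k else 0) + (if j = Suc k then ?b k * v (Suc k) else 0)"
      if j: "j < n" for j
    proof -
      consider "Suc j < k" | "Suc j = k" | "j = k" | "j = Suc k" | "Suc k < j" by linarith
      then show ?thesis
        using sym[OF j k] sym[OF k j] tri[OF j k] tri[OF k j] by cases auto
    qed
    then have "(\<Sum>j<n. A $$ (k, j) * v j) = (\<Sum>j<n. (if k \<noteq> 0 \<and> j = k - 1 then ?b (k - 1) * v (k - 1) else 0)
        + (if j = k then A $$ (k, k) * v k else 0) + (if j = Suc k then ?b k * v (Suc k) else 0))"
      by (intro sum.cong) auto
    then show ?thesis using k by (cases k) (auto simp: sum.distrib)
  qed
  have "S \<subseteq> {r. poly (char_poly A) r = 0}"
  proof
    fix r assume "r \<in> S"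
    then have r: "poly J r = 0" by (simp add: S_def)
    then have n: "n > 0" by (cases n) (auto simp: J_def)
    define v where "v k = poly (jacobi_poly (\<lambda>i. A $$ (i, i)) (\<lambda>i. (?b i)\<^sup>2) k) r / (\<Prod>l<k. ?b l)" for k
    have "eigenvector A (vec n v) r"
      unfolding eigenvector_def
    proof (intro conjI)
      show "vec n v \<in> carrier_vec (dim_row A)" using A by auto
      have "vec n v $ 0 = 1" using n by (simp add: v_def)
      moreover have "0\<^sub>v n $ 0 = (0 :: real)" using n by simp
      ultimately show "vec n v \<noteq> 0\<^sub>v (dim_row A)" using A by (metis carrier_matD(1) zero_neq_one)
      show "A *\<^sub>v vec n v = r \<cdot>\<^sub>v vec n v"
      proof (rule eq_vecI)
        fix k assume "k < dim_vec (r \<cdot>\<^sub>v vec n v)"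
        then have k: "k < n" by simp
        have "(A *\<^sub>v vec n v) $ k = (\<Sum>j<n. A $$ (k, j) * v j)"
          using A k by (auto simp: scalar_prod_def atLeast0LessThan intro!: sum.cong)
        also have "\<dots> = r * v k"
          unfolding row[OF k] v_def
          by (rule jacobi_eigenvector_recurrence[symmetric, OF _ _ k]) (use ne r in \<open>auto simp: J_def\<close>)
        finally show "(A *\<^sub>v vec n v) $ k = (r \<cdot>\<^sub>v vec n v) $ k" using k by simp
      qed (use A in auto)
    qed
    then have "eigenvalue A r" unfolding eigenvalue_def by blast
    then show "r \<in> {r. poly (char_poly A) r = 0}" using eigenvalue_root_char_poly[OF A] by simp
  qed
  moreover have cp: "char_poly A \<noteq> 0" "degree (char_poly A) = n"
    using degree_monic_char_poly[OF A] by auto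
  ultimately have "mset_set S \<subseteq># proots (char_poly A)"
    using fin by (intro mset_subset_eqI) (auto simp: count_mset_set' order_root Suc_le_eq)
  moreover have "size (proots (char_poly A)) \<le> size (mset_set S)"
    using size_proots_le[of "char_poly A"] cp card by simp
  ultimately have "proots (char_poly A) = mset_set S"
    by (metis mset_subset_size subset_mset.le_imp_less_or_eq leD)
  then have ev: "eigenvalue_list A = sorted_list_of_set S"
    by (simp add: eigenvalue_list_def)
  have len: "length (eigenvalue_list A) = n" and dist: "distinct (eigenvalue_list A)"
    and set: "set (eigenvalue_list A) = S"
    using fin card by (simp_all add: ev)
  show "inj_on (\<lambda>i. eigenvalue_list A ! i) {..<n}"
    using nth_eq_iff_index_eq[OF dist] len by (intro inj_onI) simp
  show "poly J (eigenvalue_list A ! i) = 0" if "i < n"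
    using nth_mem[of i "eigenvalue_list A"] len that unfolding set S_def by simp
qed

section \<open>Bounds for the discrete energy\<close>

lemma x_ln_x_sum_step:
  assumes "j \<ge> (1::real)"
  defines "G \<equiv> \<lambda>x::real. x\<^sup>2 / 2 * ln x - x\<^sup>2 / 4"
  shows "j * ln j \<le> G (j + 1) - G j" "G (j + 1) - G j \<le> (j + 1) * ln (j + 1)"
proof -
  \<comment> \<open>\<open>G\<close> is a primitive of x ln x, which increases on [1, infinity); the
    increment of \<open>G\<close> therefore lies between the values at the two ends.\<close>
  have "\<exists>z. j < z \<and> z < j + 1 \<and> G (j + 1) - G j = (j + 1 - j) * (z * ln z)"
  proof (rule MVT2)
    show "(G has_real_derivative z * ln z) (at z)" if "j \<le> z" "z \<le> j + 1" for z
      unfolding G_def using that assms(1)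
      by (auto intro!: derivative_eq_intros simp: power2_eq_square field_simps)
  qed simp
  then obtain z where z: "j < z" "z < j + 1" "G (j + 1) - G j = z * ln z" by auto
  show "j * ln j \<le> G (j + 1) - G j"
    unfolding z(3) using z assms(1) by (intro mult_mono) auto
  show "G (j + 1) - G j \<le> (j + 1) * ln (j + 1)"
    unfolding z(3) using z assms(1) by (intro mult_mono) auto
qed

text \<open>Comparison with the integral of x ln x from 1 to m. The constant 1 / 4 is minus the
  primitive at 1, and \<open>m * ln m\<close> allows for the last summand.\<close>

lemma sum_x_ln_x_bounds:
  fixes m :: nat
  assumes "m \<ge> 1"
  defines "S \<equiv> \<Sum>j=1..m. real j * ln (real j)"
  shows "(real m)\<^sup>2 / 2 * ln m - (real m)\<^sup>2 / 4 \<le> S"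
    and "S \<le> (real m)\<^sup>2 / 2 * ln m - (real m)\<^sup>2 / 4 + 1 / 4 + m * ln m"
proof -
  have "(real m)\<^sup>2 / 2 * ln m - (real m)\<^sup>2 / 4 \<le> (\<Sum>j=1..m. real j * ln (real j)) \<and>
    (\<Sum>j=1..m. real j * ln (real j)) \<le> (real m)\<^sup>2 / 2 * ln m - (real m)\<^sup>2 / 4 + 1 / 4 + m * ln m"
    using assms(1)
  proof (induction m rule: dec_induct)
    case base
    then show ?case by simp
  next
    case (step m)
    have m: "real m \<ge> 1" "real (Suc m) = real m + 1" using step by auto
    have "(\<Sum>j=1..Suc m. real j * ln (real j)) = (\<Sum>j=1..m. real j * ln (real j)) + (real m + 1) * ln (real m + 1)"
      by (simp add: add.commute)
    then show ?case using step.IH x_ln_x_sum_step[OF m(1)] unfolding m(2) by linarith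
  qed
  then show "(real m)\<^sup>2 / 2 * ln m - (real m)\<^sup>2 / 4 \<le> S"
    and "S \<le> (real m)\<^sup>2 / 2 * ln m - (real m)\<^sup>2 / 4 + 1 / 4 + m * ln m"
    by (auto simp: S_def)
qed

lemma sum_real_atLeastLessThan: "(\<Sum>j=1..<n. real j) = real n * (real n - 1) / 2"
proof (induction n)
  case (Suc n)
  then show ?case by (cases n) (auto simp: field_simps)
qed simp

text \<open>For t close to n this is a Riemann sum of u ln u over [0, 1], an integral with value
  -1/4. The scale t stays free because the lower energy bound uses n - 1 and the upper one uses
  n.\<close>

definition xlogx_mean :: "nat \<Rightarrow> real \<Rightarrow> real" where
  "xlogx_mean n t = (\<Sum>j=1..<n. real j * ln (real j / t)) / (real n * (real n - 1))"

lemma xlogx_mean_eq: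
  assumes "n \<ge> 2" "t > 0"
  shows "xlogx_mean n t = (\<Sum>j=1..n-1. real j * ln (real j)) / (real n * (real n - 1)) - ln t / 2"
proof -
  have "(\<Sum>j=1..<n. real j * ln (real j / t)) = (\<Sum>j=1..<n. real j * ln (real j) - real j * ln t)"
    using assms by (intro sum.cong) (auto simp: ln_div algebra_simps)
  also have "\<dots> = (\<Sum>j=1..<n. real j * ln (real j)) - (\<Sum>j=1..<n. real j) * ln t"
    by (simp add: sum_subtractf sum_distrib_right)
  finally have "xlogx_mean n t = (\<Sum>j=1..<n. real j * ln (real j)) / (real n * (real n - 1)) - ln t / 2"
    using assms unfolding xlogx_mean_def sum_real_atLeastLessThan by (simp add: diff_divide_distrib)
  moreover have "{1..<n} = {1..n-1}" using assms by auto
  ultimately show ?thesis by simp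
qed

text \<open>The weights j add up to n (n - 1) / 2, so changing the scale shifts the mean by half a
  difference of logarithms. The reference scale is n - 1.\<close>

lemma xlogx_mean_limit:
  fixes t :: "nat \<Rightarrow> real"
  assumes t: "\<And>n. n \<ge> 2 \<Longrightarrow> t n > 0" and lim: "(\<lambda>n. ln (real n - 1) - ln (t n)) \<longlonglongrightarrow> 0"
  shows "(\<lambda>n. xlogx_mean n (t n)) \<longlonglongrightarrow> -1/4"
proof -
  let ?S = "\<lambda>n::nat. (\<Sum>j=1..n-1. real j * ln (real j)) / (real n * (real n - 1)) - ln (real n - 1) / 2"
  have "?S \<longlonglongrightarrow> -1/4"
  proof (rule tendsto_sandwich)
    show "\<forall>\<^sub>F n in sequentially.
       ((real n - 1)\<^sup>2 / 2 * ln (real n - 1) - (real n - 1)\<^sup>2 / 4) / (real n * (real n - 1)) - ln (real n - 1) / 2 \<le> ?S n"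
      using eventually_ge_at_top[of 2]
    proof eventually_elim
      case (elim n)
      then show ?case using sum_x_ln_x_bounds(1)[of "n-1"]
        by (intro diff_right_mono divide_right_mono) (auto simp: of_nat_diff)
    qed
    show "\<forall>\<^sub>F n in sequentially. ?S n \<le>
       ((real n - 1)\<^sup>2 / 2 * ln (real n - 1) - (real n - 1)\<^sup>2 / 4 + 1/4 + (real n - 1) * ln (real n - 1)) / (real n * (real n - 1))
         - ln (real n - 1) / 2"
      using eventually_ge_at_top[of 2]
    proof eventually_elim
      case (elim n)
      then show ?case using sum_x_ln_x_bounds(2)[of "n-1"]
        by (intro diff_right_mono divide_right_mono) (auto simp: of_nat_diff)
    qed
  qed (real_asymp)+
  from tendsto_add[OF this tendsto_divide[OF lim tendsto_const[of 2]]]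
  have "(\<lambda>n. ?S n + (ln (real n - 1) - ln (t n)) / 2) \<longlonglongrightarrow> -1/4" by simp
  moreover have "\<forall>\<^sub>F n in sequentially. ?S n + (ln (real n - 1) - ln (t n)) / 2 = xlogx_mean n (t n)"
    using eventually_ge_at_top[of 2]
    by eventually_elim (use t in \<open>simp add: xlogx_mean_eq diff_divide_distrib\<close>)
  ultimately show ?thesis by (rule Lim_transform_eventually)
qed

text \<open>Value of the decoupled minimisation: 1 / 2 is the quadratic part at the optimum, and the
  last term stems from the mass n of the counting measure.\<close>

definition fekete_bound :: "nat \<Rightarrow> real" where
  "fekete_bound n = 1 / 2 - xlogx_mean n (real n - 1) - ln (real n) / (real n - 1)"

lemma fekete_bound_limit: "fekete_bound \<longlonglongrightarrow> 3 / 4"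
proof -
  have "(\<lambda>n. xlogx_mean n (real n - 1)) \<longlonglongrightarrow> -1/4" by (rule xlogx_mean_limit) auto
  moreover have "(\<lambda>n. ln (real n) / (real n - 1)) \<longlonglongrightarrow> 0" by real_asymp
  ultimately have "(\<lambda>n. 1 / 2 - xlogx_mean n (real n - 1) - ln (real n) / (real n - 1)) \<longlonglongrightarrow> 1/2 - (-1/4) - 0"
    by (intro tendsto_intros)
  then show ?thesis by (simp add: fekete_bound_def[abs_def])
qed

lemma sum_sum_lessThan:
  fixes f :: "nat \<Rightarrow> real"
  shows "(\<Sum>k<n. \<Sum>l<k. f l) = (\<Sum>l<n-1. real (n - 1 - l) * f l)"
proof (cases n)
  case (Suc m)
  have "(\<Sum>k<Suc m. \<Sum>l<k. f l) = (\<Sum>l<m. real (m - l) * f l)"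
  proof (induction m)
    case (Suc m)
    have "(\<Sum>l<Suc m. real (Suc m - l) * f l) = (\<Sum>l<Suc m. real (m - l) * f l + f l)"
      by (intro sum.cong) (auto simp: Suc_diff_le algebra_simps less_Suc_eq_le)
    also have "\<dots> = (\<Sum>l<m. real (m - l) * f l) + (\<Sum>l<Suc m. f l)" by (simp add: sum.distrib)
    finally show ?case using Suc.IH by simp
  qed simp
  then show ?thesis using Suc by simp
qed simp

lemma sum_reflect_index:
  fixes n :: nat and f :: "nat \<Rightarrow> real"
  shows "(\<Sum>l<n-1. f (n - 1 - l)) = (\<Sum>j=1..<n. f j)"
  by (rule sum.reindex_bij_witness[of _ "\<lambda>j. n - 1 - j" "\<lambda>l. n - 1 - l"]) auto

lemma ln_prod_prod_lessThan:
  assumes "\<And>l. Suc l < n \<Longrightarrow> c l > 0"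
  shows "(\<Prod>k<n. \<Prod>l<k. c l) > 0" "ln (\<Prod>k<n. \<Prod>l<k. c l) = (\<Sum>l<n-1. real (n - 1 - l) * ln (c l :: real))"
proof -
  have pos: "(\<Prod>l<k. c l) > 0" if "k < n" for k using that assms by (intro prod_pos ballI) auto
  then show "(\<Prod>k<n. \<Prod>l<k. c l) > 0" by (rule prod_pos) (simp add: pos)
  have "ln (\<Prod>k<n. \<Prod>l<k. c l) = (\<Sum>k<n. ln (\<Prod>l<k. c l))"
  proof (rule ln_prod)
    show "(\<Prod>l<k. c l) \<noteq> 0" if "k \<in> {..<n}" for k using pos[of k] that by (intro less_imp_neq[symmetric]) simp
  qed simp
  also have "\<dots> = (\<Sum>k<n. \<Sum>l<k. ln (c l))"
  proof (intro sum.cong refl ln_prod)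
    fix k l assume "k \<in> {..<n}" "l \<in> {..<k}"
    then have "c l > 0" by (intro assms) auto
    then show "c l \<noteq> 0" by simp
  qed auto
  finally show "ln (\<Prod>k<n. \<Prod>l<k. c l) = (\<Sum>l<n-1. real (n - 1 - l) * ln (c l :: real))"
    by (simp add: sum_sum_lessThan)
qed

lemma discrete_energy_vdm:
  assumes "inj_on x {..<n}"
  shows "discrete_energy n x = (\<Sum>k<n. (x k)\<^sup>2) / (2 * real n) - ln ((vdm n x)\<^sup>2) / (real n * (real n - 1))"
  unfolding discrete_energy_def sum_ln_dist_eq(1)[OF assms, symmetric] by simp

text \<open>Each \<open>ln (c l)\<close> is bounded by a tangent of the logarithm. The tangent
  points are such that all slopes, after weighting, equal n - 1; the linear terms then add up to a
  multiple of the sum of the \<open>c l\<close>, which the quadratic part of the energy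
  absorbs.\<close>

lemma discrete_energy_ge_fekete:
  assumes n: "n \<ge> 2" and inj: "inj_on x {..<n}"
  shows "discrete_energy n x \<ge> fekete_bound n"
proof -
  obtain c where c: "\<And>l. Suc l < n \<Longrightarrow> c l > (0::real)"
    and V: "(vdm n x)\<^sup>2 = real n ^ n * (\<Prod>k<n. \<Prod>l<k. c l)"
    and T: "2 * (\<Sum>k<n-1. c k) \<le> (\<Sum>i<n. (x i)\<^sup>2)"
    using jacobi_parameters_exist[of n x] n inj by auto
  have lnc: "(\<Prod>k<n. \<Prod>l<k. c l) > 0"
    "ln (\<Prod>k<n. \<Prod>l<k. c l) = (\<Sum>l<n-1. real (n - 1 - l) * ln (c l))"
    by (rule ln_prod_prod_lessThan(1)[OF c], assumption) (rule ln_prod_prod_lessThan(2)[OF c])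
  have "ln ((vdm n x)\<^sup>2) = ln (real n ^ n) + ln (\<Prod>k<n. \<Prod>l<k. c l)"
    unfolding V by (rule ln_mult_pos) (use n lnc(1) in auto)
  then have lnV: "ln ((vdm n x)\<^sup>2) = real n * ln n + (\<Sum>l<n-1. real (n - 1 - l) * ln (c l))"
    using n lnc(2) by (simp add: ln_realpow)
  have "real (n - 1 - l) * ln (c l) \<le> (real n - 1) * c l - real (n - 1 - l)
      + real (n - 1 - l) * ln (real (n - 1 - l) / (real n - 1))" if "l < n - 1" for l
  proof -
    \<comment> \<open>\<open>d\<close> is the minimiser of
      \<open>(n - 1) * c - (n - 1 - l) * ln c\<close> over c > 0.\<close>
    define d where "d = real (n - 1 - l) / (real n - 1)"
    have d: "d > 0" "real (n - 1 - l) = d * (real n - 1)" using that n by (auto simp: d_def)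
    have cl: "c l > 0" using that by (intro c) linarith
    then have "ln (c l) = ln (c l / d) + ln d" using d(1) by (simp add: ln_div)
    also have "\<dots> \<le> c l / d - 1 + ln d" using cl d(1) ln_le_minus_one[of "c l / d"] by simp
    finally have "real (n - 1 - l) * ln (c l) \<le> real (n - 1 - l) * (c l / d - 1 + ln d)"
      by (rule mult_left_mono) simp
    also have "\<dots> = (real n - 1) * c l - real (n - 1 - l) + real (n - 1 - l) * ln d"
      unfolding d(2) using d(1) by (simp add: algebra_simps)
    finally show ?thesis by (simp add: d_def)
  qed
  then have "(\<Sum>l<n-1. real (n - 1 - l) * ln (c l)) \<le> (\<Sum>l<n-1. (real n - 1) * c l - real (n - 1 - l)
      + real (n - 1 - l) * ln (real (n - 1 - l) / (real n - 1)))"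
    by (intro sum_mono) auto
  also have "\<dots> = (real n - 1) * (\<Sum>l<n-1. c l) - (\<Sum>l<n-1. real (n - 1 - l))
      + (\<Sum>l<n-1. real (n - 1 - l) * ln (real (n - 1 - l) / (real n - 1)))"
    by (simp add: sum.distrib sum_subtractf sum_distrib_left)
  also have "(\<Sum>l<n-1. real (n - 1 - l)) = (\<Sum>j=1..<n. real j)" by (rule sum_reflect_index)
  also note sum_real_atLeastLessThan
  also have "(\<Sum>l<n-1. real (n - 1 - l) * ln (real (n - 1 - l) / (real n - 1))) =
      real n * (real n - 1) * xlogx_mean n (real n - 1)"
    using n by (subst sum_reflect_index[where f = "\<lambda>j. real j * ln (real j / (real n - 1))"]) (simp add: xlogx_mean_def)
  finally have "ln ((vdm n x)\<^sup>2) \<le> real n * ln n + (real n - 1) * (\<Sum>l<n-1. c l)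
      - real n * (real n - 1) / 2 + real n * (real n - 1) * xlogx_mean n (real n - 1)"
    unfolding lnV by simp
  then have "ln ((vdm n x)\<^sup>2) / (real n * (real n - 1)) \<le> (real n * ln n + (real n - 1) * (\<Sum>l<n-1. c l)
      - real n * (real n - 1) / 2 + real n * (real n - 1) * xlogx_mean n (real n - 1)) / (real n * (real n - 1))"
    using n by (intro divide_right_mono) auto
  also have "\<dots> = ln n / (real n - 1) + (\<Sum>l<n-1. c l) / real n - 1 / 2 + xlogx_mean n (real n - 1)"
  proof -
    have "real n \<noteq> 0" "real n - 1 \<noteq> 0" using n by auto
    then show ?thesis by (simp add: add_divide_distrib diff_divide_distrib)
  qed
  also have "(\<Sum>l<n-1. c l) / real n \<le> (\<Sum>i<n. (x i)\<^sup>2) / (2 * real n)"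
    using T n by (simp add: field_simps)
  finally show ?thesis
    unfolding discrete_energy_vdm[OF inj] fekete_bound_def by simp
qed

text \<open>The lower bound on \<open>c l\<close> deteriorates for l near n, but
  \<open>ln (c l)\<close> has weight n - 1 - l, so every l loses at most \<kappa> n. After division
  by n (n - 1) this costs \<kappa>; a second \<kappa> comes from the quadratic part.\<close>

lemma discrete_energy_jacobi_le:
  assumes n: "n \<ge> 2" and inj: "inj_on x {..<n}"
    and root: "\<And>i. i < n \<Longrightarrow> poly (jacobi_poly a c n) (x i) = 0"
    and a: "\<And>i. i < n \<Longrightarrow> (a i)\<^sup>2 \<le> \<alpha>"
    and c_le: "\<And>l. Suc l < n \<Longrightarrow> c l \<le> real (n - 1 - l) / real n + \<kappa>"
    and c_ge: "\<And>l. Suc l < n \<Longrightarrow> c l \<ge> real (n - 1 - l) / real n * exp (- \<kappa> * real n / real (n - 1 - l))"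
    and \<kappa>: "\<kappa> \<ge> 0"
  shows "discrete_energy n x \<le> 1 / 2 - xlogx_mean n (real n) + \<alpha> / 2 + 2 * \<kappa>"
proof -
  have c: "c l > 0" if "Suc l < n" for l
    using c_ge[OF that] that by (intro less_le_trans[OF _ c_ge[OF that]] mult_pos_pos) auto
  have n0: "n > 0" using n by simp
  have J: "(\<Prod>k<n. \<Prod>l<k. c l) \<le> (vdm n x)\<^sup>2" "(\<Sum>i<n. (x i)\<^sup>2) = (\<Sum>k<n. (a k)\<^sup>2) + 2 * (\<Sum>k<n-1. c k)"
    by (rule jacobi_roots_vdm_trace(1)[OF n0 c inj root], assumption+) (rule jacobi_roots_vdm_trace(2)[OF n0 c inj root])
  have P: "(\<Prod>k<n. \<Prod>l<k. c l) > 0"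
    "ln (\<Prod>k<n. \<Prod>l<k. c l) = (\<Sum>l<n-1. real (n - 1 - l) * ln (c l))"
    by (rule ln_prod_prod_lessThan(1)[OF c], assumption) (rule ln_prod_prod_lessThan(2)[OF c])
  have "(\<Sum>l<n-1. real (n - 1 - l) * ln (real (n - 1 - l) / real n) - \<kappa> * real n) \<le>
      (\<Sum>l<n-1. real (n - 1 - l) * ln (c l))"
  proof (intro sum_mono)
    fix l assume "l \<in> {..<n-1}"
    then have l: "Suc l < n" by auto
    have "ln (real (n - 1 - l) / real n) - \<kappa> * real n / real (n - 1 - l)
       = ln (real (n - 1 - l) / real n * exp (- \<kappa> * real n / real (n - 1 - l)))"
      using l by (subst ln_mult) auto
    also have "\<dots> \<le> ln (c l)"
      using c_ge[OF l] l by (subst ln_le_cancel_iff) (auto intro!: mult_pos_pos c)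
    finally have "real (n - 1 - l) * (ln (real (n - 1 - l) / real n) - \<kappa> * real n / real (n - 1 - l))
       \<le> real (n - 1 - l) * ln (c l)"
      by (rule mult_left_mono) simp
    then show "real (n - 1 - l) * ln (real (n - 1 - l) / real n) - \<kappa> * real n \<le> real (n - 1 - l) * ln (c l)"
      using l by (simp add: right_diff_distrib)
  qed
  also have "\<dots> = ln (\<Prod>k<n. \<Prod>l<k. c l)" using P(2) by simp
  also have "\<dots> \<le> ln ((vdm n x)\<^sup>2)" using J(1) P(1) by (rule ln_mono)
  also have "(\<Sum>l<n-1. real (n - 1 - l) * ln (real (n - 1 - l) / real n) - \<kappa> * real n)
      = real n * (real n - 1) * xlogx_mean n (real n) - (real n - 1) * \<kappa> * real n"
    using n unfolding sum_subtractf sum_reflect_index[where f = "\<lambda>j. real j * ln (real j / real n)"]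
    by (simp add: of_nat_diff xlogx_mean_def)
  finally have "(real n * (real n - 1) * xlogx_mean n (real n) - (real n - 1) * \<kappa> * real n) / (real n * (real n - 1))
      \<le> ln ((vdm n x)\<^sup>2) / (real n * (real n - 1))"
    using n by (intro divide_right_mono) auto
  moreover have "real n * (real n - 1) * xlogx_mean n (real n) - (real n - 1) * \<kappa> * real n
      = real n * (real n - 1) * (xlogx_mean n (real n) - \<kappa>)" by (simp add: algebra_simps)
  ultimately have 1: "xlogx_mean n (real n) - \<kappa> \<le> ln ((vdm n x)\<^sup>2) / (real n * (real n - 1))"
    using n by simp
  have "(\<Sum>k<n-1. c k) \<le> (\<Sum>l<n-1. real (n - 1 - l) / real n + \<kappa>)"
    using c_le by (intro sum_mono) auto
  also have "\<dots> = (\<Sum>l<n-1. real (n - 1 - l)) / real n + (real n - 1) * \<kappa>"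
    using n by (simp add: sum.distrib sum_divide_distrib of_nat_diff)
  also have "(\<Sum>l<n-1. real (n - 1 - l)) = (\<Sum>j=1..<n. real j)" by (rule sum_reflect_index)
  also note sum_real_atLeastLessThan
  also have "real n * (real n - 1) / 2 / real n + (real n - 1) * \<kappa> \<le> real n / 2 + real n * \<kappa>"
    using n \<kappa> by (intro add_mono mult_right_mono) auto
  finally have "2 * (\<Sum>k<n-1. c k) \<le> real n + 2 * real n * \<kappa>" by simp
  moreover have "(\<Sum>k<n. (a k)\<^sup>2) \<le> real n * \<alpha>" using sum_mono[of "{..<n}" "\<lambda>k. (a k)\<^sup>2" "\<lambda>_. \<alpha>"] a by simp
  ultimately have "(\<Sum>k<n. (x k)\<^sup>2) \<le> real n * \<alpha> + real n + 2 * real n * \<kappa>" unfolding J(2) by linarith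
  then have "(\<Sum>k<n. (x k)\<^sup>2) / (2 * real n) \<le> (real n * \<alpha> + real n + 2 * real n * \<kappa>) / (2 * real n)"
    by (intro divide_right_mono) auto
  also have "\<dots> = \<alpha> / 2 + 1 / 2 + \<kappa>" using n by (simp add: field_simps)
  finally show ?thesis using 1 unfolding discrete_energy_vdm[OF inj] by simp
qed

section \<open>Loop equations\<close>

lemma sum_triangle_symmetric:
  fixes q :: "nat \<Rightarrow> nat \<Rightarrow> real"
  assumes "\<And>j k. q j k = q k j"
  shows "2 * (\<Sum>k<n. \<Sum>j<k. q j k) = (\<Sum>j<n. \<Sum>k<n. q j k) - (\<Sum>j<n. q j j)"
proof (induction n)
  case (Suc n)
  have "(\<Sum>j<Suc n. \<Sum>k<Suc n. q j k) = (\<Sum>j<n. \<Sum>k<n. q j k) + (\<Sum>j<n. q j n) + (\<Sum>k<n. q n k) + q n n"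
    by (simp add: sum.distrib)
  moreover have "(\<Sum>k<n. q n k) = (\<Sum>j<n. q j n)" using assms by simp
  ultimately show ?case using Suc by simp
qed simp

text \<open>First-order expansion of the energy under the displacement e f, with \<Lambda> as first
  variation. The difference quotients \<open>q\<close> of f turn every distance into itself times 1
  + e q, which is at least 1/2; this preserves distinctness and allows ln (1 + u) >= u - 2 u^2. The
  normalisation by the number of pairs makes the remainder independent of n.\<close>

lemma discrete_energy_perturb_le:
  assumes n: "n \<ge> 2" and inj: "inj_on x {..<n}"
    and q: "\<And>i j. i < n \<Longrightarrow> j < n \<Longrightarrow> f (x i) - f (x j) = q i j * (x i - x j)"
    and L: "\<And>i j. i < n \<Longrightarrow> j < n \<Longrightarrow> \<bar>q i j\<bar> \<le> L" and F: "\<And>i. i < n \<Longrightarrow> \<bar>f (x i)\<bar> \<le> F"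
    and e: "\<bar>e\<bar> * L \<le> 1 / 2"
  defines "\<Lambda> \<equiv> (\<Sum>k<n. x k * f (x k)) / real n - 2 / (real n * (real n - 1)) * (\<Sum>k<n. \<Sum>j<k. q j k)"
  shows "inj_on (\<lambda>i. x i + e * f (x i)) {..<n}"
    and "discrete_energy n (\<lambda>i. x i + e * f (x i)) \<le> discrete_energy n x + e * \<Lambda> + e\<^sup>2 * (F\<^sup>2 / 2 + 2 * L\<^sup>2)"
proof -
  let ?y = "\<lambda>i. x i + e * f (x i)"
  have y: "?y i - ?y j = (x i - x j) * (1 + e * q i j)" if "i < n" "j < n" for i j
  proof -
    have "?y i - ?y j = (x i - x j) + e * (f (x i) - f (x j))" by (simp add: algebra_simps)
    then show ?thesis unfolding q[OF that] by (simp add: algebra_simps)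
  qed
  have eq: "\<bar>e * q i j\<bar> \<le> 1 / 2" "\<bar>e * q i j\<bar> \<le> \<bar>e\<bar> * L" if "i < n" "j < n" for i j
    using mult_left_mono[OF L[OF that], of "\<bar>e\<bar>"] e by (auto simp: abs_mult)
  have pos: "1 + e * q i j > 0" if "i < n" "j < n" for i j using eq(1)[OF that] by linarith
  show "inj_on ?y {..<n}"
  proof (rule inj_onI)
    fix i j assume ij: "i \<in> {..<n}" "j \<in> {..<n}" "?y i = ?y j"
    then have "(x i - x j) * (1 + e * q i j) = 0" using y[of i j] by simp
    then show "i = j" using pos[of i j] ij inj_onD[OF inj] by auto
  qed
  have ne: "x j \<noteq> x k" if "k < n" "j < k" for j k using inj_onD[OF inj, of j k] that by auto
  have "(\<Sum>k<n. \<Sum>j<k. ln \<bar>?y j - ?y k\<bar>) \<ge>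
      (\<Sum>k<n. \<Sum>j<k. ln \<bar>x j - x k\<bar> + (e * q j k - 2 * (e * L)\<^sup>2))"
  proof (intro sum_mono)
    fix k j assume "k \<in> {..<n}" "j \<in> {..<k}"
    then have jk: "j < n" "k < n" "j < k" by auto
    have "ln \<bar>?y j - ?y k\<bar> = ln \<bar>x j - x k\<bar> + ln (1 + e * q j k)"
      unfolding y[OF jk(1,2)] using ne[OF jk(2,3)] pos[OF jk(1,2)]
      by (simp add: abs_mult ln_mult)
    moreover have "\<bar>ln (1 + e * q j k) - e * q j k\<bar> \<le> 2 * (e * q j k)\<^sup>2"
      using abs_ln_one_plus_x_minus_x_bound[OF eq(1)[OF jk(1,2)]] .
    moreover have "(e * q j k)\<^sup>2 \<le> (e * L)\<^sup>2"
      using power_mono[OF eq(2)[OF jk(1,2)], of 2] by (simp add: power_mult_distrib)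
    ultimately show "ln \<bar>x j - x k\<bar> + (e * q j k - 2 * (e * L)\<^sup>2) \<le> ln \<bar>?y j - ?y k\<bar>"
      by linarith
  qed
  also have "(\<Sum>k<n. \<Sum>j<k. ln \<bar>x j - x k\<bar> + (e * q j k - 2 * (e * L)\<^sup>2)) =
      (\<Sum>k<n. \<Sum>j<k. ln \<bar>x j - x k\<bar>) + e * (\<Sum>k<n. \<Sum>j<k. q j k) - (\<Sum>k<n. real k) * (2 * (e * L)\<^sup>2)"
    by (simp add: sum.distrib sum_subtractf sum_distrib_left sum_distrib_right)
  also have "(\<Sum>k<n. real k) = real n * (real n - 1) / 2"
    by (induction n) (auto simp: field_simps)
  finally have *: "2 / (real n * (real n - 1)) * ((\<Sum>k<n. \<Sum>j<k. ln \<bar>x j - x k\<bar>) + e * (\<Sum>k<n. \<Sum>j<k. q j k)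
        - real n * (real n - 1) / 2 * (2 * (e * L)\<^sup>2)) \<le> 2 / (real n * (real n - 1)) * (\<Sum>k<n. \<Sum>j<k. ln \<bar>?y j - ?y k\<bar>)"
    using n by (intro mult_left_mono) auto
  have log: "2 / (real n * (real n - 1)) * (\<Sum>k<n. \<Sum>j<k. ln \<bar>x j - x k\<bar>)
      + e * (2 / (real n * (real n - 1)) * (\<Sum>k<n. \<Sum>j<k. q j k)) - 2 * (e * L)\<^sup>2
      \<le> 2 / (real n * (real n - 1)) * (\<Sum>k<n. \<Sum>j<k. ln \<bar>?y j - ?y k\<bar>)"
  proof -
    have eq: "2 / N * (A + e * B - N / 2 * D) = 2 / N * A + e * (2 / N * B) - D" if "N \<noteq> 0" for N A B D :: real
      using that by (simp add: field_simps)
    have N0: "real n * (real n - 1) \<noteq> 0" using n by auto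
    from * show ?thesis unfolding eq[OF N0] .
  qed
  have "(\<Sum>k<n. (?y k)\<^sup>2) \<le> (\<Sum>k<n. (x k)\<^sup>2 + 2 * e * (x k * f (x k)) + e\<^sup>2 * F\<^sup>2)"
  proof (intro sum_mono)
    fix k assume "k \<in> {..<n}"
    then have "(f (x k))\<^sup>2 \<le> F\<^sup>2" using F[of k] abs_le_square_iff[of "f (x k)" F] by auto
    then have "e\<^sup>2 * (f (x k))\<^sup>2 \<le> e\<^sup>2 * F\<^sup>2" by (rule mult_left_mono) simp
    then show "(?y k)\<^sup>2 \<le> (x k)\<^sup>2 + 2 * e * (x k * f (x k)) + e\<^sup>2 * F\<^sup>2"
      by (simp add: power2_eq_square algebra_simps)
  qed
  also have "\<dots> = (\<Sum>k<n. (x k)\<^sup>2) + 2 * e * (\<Sum>k<n. x k * f (x k)) + real n * (e\<^sup>2 * F\<^sup>2)"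
    by (simp add: sum.distrib sum_distrib_left)
  finally have "1 / (2 * real n) * (\<Sum>k<n. (?y k)\<^sup>2) \<le>
      1 / (2 * real n) * ((\<Sum>k<n. (x k)\<^sup>2) + 2 * e * (\<Sum>k<n. x k * f (x k)) + real n * (e\<^sup>2 * F\<^sup>2))"
    by (rule mult_left_mono) simp
  also have "\<dots> = 1 / (2 * real n) * (\<Sum>k<n. (x k)\<^sup>2) + e * ((\<Sum>k<n. x k * f (x k)) / real n) + e\<^sup>2 * F\<^sup>2 / 2"
    using n by (simp add: field_simps)
  finally show "discrete_energy n ?y \<le> discrete_energy n x + e * \<Lambda> + e\<^sup>2 * (F\<^sup>2 / 2 + 2 * L\<^sup>2)"
    using log unfolding discrete_energy_def \<Lambda>_def by (simp add: algebra_simps)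
qed

definition emp_moment :: "nat \<Rightarrow> (nat \<Rightarrow> real) \<Rightarrow> nat \<Rightarrow> real" where
  "emp_moment n x k = (\<Sum>i<n. x i ^ k) / real n"

text \<open>Displacements by +e and -e along u^k both keep the energy above the universal bound,
  which confines the first variation from both sides. It is expressed by moments after completing
  the triangle j < i to the full square: this produces the factor n / (n - 1), and the diagonal,
  where the difference quotient is the derivative k u^(k-1), gives the correction term.\<close>

lemma loop_equation_defect:
  assumes n: "n \<ge> 2" and inj: "inj_on x {..<n}" and R: "\<And>i. i < n \<Longrightarrow> \<bar>x i\<bar> \<le> R" "R \<ge> 1"
    and e: "e > 0" "e * (real k * R ^ k) \<le> 1 / 2"
  shows "\<bar>emp_moment n x (Suc k) - (real n / (real n - 1) * (\<Sum>l<k. emp_moment n x l * emp_moment n x (k - 1 - l))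
      - real k / (real n - 1) * emp_moment n x (k - 1))\<bar>
      \<le> (discrete_energy n x - fekete_bound n) / e + e * ((R ^ k)\<^sup>2 / 2 + 2 * (real k * R ^ k)\<^sup>2)"
proof -
  define q where "q i j = (\<Sum>l<k. x i ^ l * x j ^ (k - 1 - l))" for i j
  have q_sym: "q i j = q j i" for i j
    unfolding q_def
    by (rule sum.reindex_bij_witness[of _ "\<lambda>l. k - 1 - l" "\<lambda>l. k - 1 - l"]) (auto simp: mult.commute)
  have q: "x i ^ k - x j ^ k = q i j * (x i - x j)" for i j
  proof (cases k)
    case (Suc m)
    show ?thesis unfolding Suc diff_power_eq_sum q_def by (simp add: mult.commute)
  qed (simp add: q_def)
  have bound: "\<bar>x i ^ l\<bar> \<le> R ^ l" if "i < n" for i l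
    using power_mono[OF R(1)[OF that], of l] by (simp add: power_abs)
  have L: "\<bar>q i j\<bar> \<le> real k * R ^ k" if "i < n" "j < n" for i j
  proof -
    have "\<bar>q i j\<bar> \<le> (\<Sum>l<k. \<bar>x i ^ l * x j ^ (k - 1 - l)\<bar>)" unfolding q_def by (rule sum_abs)
    also have "\<dots> \<le> (\<Sum>l<k. R ^ k)"
    proof (intro sum_mono)
      fix l assume "l \<in> {..<k}"
      have "\<bar>x i ^ l * x j ^ (k - 1 - l)\<bar> \<le> R ^ l * R ^ (k - 1 - l)"
        unfolding abs_mult using bound that R(2) by (intro mult_mono) auto
      also have "\<dots> \<le> R ^ k" using R(2) \<open>l \<in> {..<k}\<close>
        by (simp add: power_add[symmetric] power_increasing)
      finally show "\<bar>x i ^ l * x j ^ (k - 1 - l)\<bar> \<le> R ^ k" .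
    qed
    finally show ?thesis by simp
  qed
  define \<Lambda> where "\<Lambda> = (\<Sum>i<n. x i * x i ^ k) / real n - 2 / (real n * (real n - 1)) * (\<Sum>i<n. \<Sum>j<i. q j i)"
  define C where "C = (R ^ k)\<^sup>2 / 2 + 2 * (real k * R ^ k)\<^sup>2"
  have "fekete_bound n \<le> discrete_energy n x + s * \<Lambda> + s\<^sup>2 * C" if "\<bar>s\<bar> = e" for s
  proof -
    have s: "\<bar>s\<bar> * (real k * R ^ k) \<le> 1 / 2" using e that by simp
    note P = discrete_energy_perturb_le[OF n inj, of "\<lambda>u. u ^ k" q "real k * R ^ k" "R ^ k" s, OF q L bound s]
    show ?thesis using discrete_energy_ge_fekete[OF n P(1)] P(2) unfolding \<Lambda>_def C_def by linarith
  qed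
  from this[of e] this[of "- e"] e(1) have "\<bar>e * \<Lambda>\<bar> \<le> (discrete_energy n x - fekete_bound n) + e\<^sup>2 * C"
    by (auto simp: abs_le_iff)
  then have "\<bar>\<Lambda>\<bar> \<le> ((discrete_energy n x - fekete_bound n) + e\<^sup>2 * C) / e"
    using e(1) by (simp add: abs_mult field_simps)
  also have "\<dots> = (discrete_energy n x - fekete_bound n) / e + e * C"
    using e(1) by (simp add: field_simps power2_eq_square)
  finally have main: "\<bar>\<Lambda>\<bar> \<le> (discrete_energy n x - fekete_bound n) / e + e * C" .
  have "(\<Sum>i<n. \<Sum>j<n. q i j) = (\<Sum>l<k. (\<Sum>i<n. x i ^ l) * (\<Sum>j<n. x j ^ (k - 1 - l)))"
  proof -
    have "(\<Sum>i<n. \<Sum>j<n. q i j) = (\<Sum>i<n. \<Sum>l<k. \<Sum>j<n. x i ^ l * x j ^ (k - 1 - l))"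
      unfolding q_def by (intro sum.cong refl sum.swap)
    also have "\<dots> = (\<Sum>l<k. \<Sum>i<n. \<Sum>j<n. x i ^ l * x j ^ (k - 1 - l))" by (rule sum.swap)
    finally show ?thesis by (simp add: sum_product)
  qed
  also have "\<dots> = real n * real n * (\<Sum>l<k. emp_moment n x l * emp_moment n x (k - 1 - l))"
    unfolding sum_distrib_left using n by (intro sum.cong refl) (simp add: emp_moment_def sum_distrib_left[symmetric])
  finally have S1: "(\<Sum>i<n. \<Sum>j<n. q i j) = real n * real n * (\<Sum>l<k. emp_moment n x l * emp_moment n x (k - 1 - l))" .
  have S2: "(\<Sum>j<n. q j j) = real k * (real n * emp_moment n x (k - 1))"
  proof -
    have "q j j = real k * x j ^ (k - 1)" for j
      unfolding q_def by (simp add: power_add[symmetric])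
    then show ?thesis using n by (simp add: emp_moment_def sum_distrib_left[symmetric])
  qed
  have S0: "(\<Sum>i<n. x i * x i ^ k) / real n = emp_moment n x (Suc k)" by (simp add: emp_moment_def)
  have "\<Lambda> = emp_moment n x (Suc k) - 1 / (real n * (real n - 1)) * (2 * (\<Sum>i<n. \<Sum>j<i. q j i))"
    unfolding \<Lambda>_def S0 by simp
  also have "2 * (\<Sum>i<n. \<Sum>j<i. q j i) = real n * real n * (\<Sum>l<k. emp_moment n x l * emp_moment n x (k - 1 - l))
      - real k * (real n * emp_moment n x (k - 1))"
    using sum_triangle_symmetric[of q n] q_sym S1 S2 by simp
  also have "1 / (real n * (real n - 1)) * (real n * real n * (\<Sum>l<k. emp_moment n x l * emp_moment n x (k - 1 - l))
      - real k * (real n * emp_moment n x (k - 1))) = real n / (real n - 1) * (\<Sum>l<k. emp_moment n x l * emp_moment n x (k - 1 - l))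
      - real k / (real n - 1) * emp_moment n x (k - 1)"
  proof -
    have eq: "1 / (N * D) * (N * N * S - k' * (N * m)) = N / D * S - k' / D * m"
      if "N \<noteq> 0" "D \<noteq> 0" for N D S k' m :: real
      using that by (simp add: field_simps)
    show ?thesis by (rule eq) (use n in auto)
  qed
  finally show ?thesis using main unfolding C_def by simp
qed

text \<open>The limiting loop equation expresses the moment of order k + 1 by those of order below
  k, so strong induction applies. The step size e stays fixed while n grows: the energy defect
  divided by e tends to 0, and the remaining term of order e is as small as desired.\<close>

lemma emp_moments_converge:
  fixes x :: "nat \<Rightarrow> nat \<Rightarrow> real" and m :: "nat \<Rightarrow> real"
  assumes E: "(\<lambda>n. discrete_energy n (x n)) \<longlonglongrightarrow> 3 / 4"
    and inj: "\<forall>\<^sub>F n in sequentially. inj_on (x n) {..<n}"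
    and R: "\<forall>\<^sub>F n in sequentially. \<forall>i<n. \<bar>x n i\<bar> \<le> R"
    and m0: "m 0 = 1" and mS: "\<And>k. m (Suc k) = (\<Sum>l<k. m l * m (k - 1 - l))"
  shows "(\<lambda>n. emp_moment n (x n) k) \<longlonglongrightarrow> m k"
proof (induction k rule: less_induct)
  case (less k)
  show ?case
  proof (cases k)
    case 0
    have "\<forall>\<^sub>F n in sequentially. 1 = emp_moment n (x n) 0"
      using eventually_gt_at_top[of 0] by eventually_elim (simp add: emp_moment_def)
    from Lim_transform_eventually[OF tendsto_const this] show ?thesis using 0 m0 by simp
  next
    case (Suc k')
    define S where "S n = real n / (real n - 1) * (\<Sum>l<k'. emp_moment n (x n) l * emp_moment n (x n) (k' - 1 - l))
      - real k' / (real n - 1) * emp_moment n (x n) (k' - 1)" for n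
    define R' where "R' = max 1 R"
    define C where "C = (R' ^ k')\<^sup>2 / 2 + 2 * (real k' * R' ^ k')\<^sup>2"
    have "(\<lambda>n. real n / (real n - 1)) \<longlonglongrightarrow> 1" "(\<lambda>n. real k' / (real n - 1)) \<longlonglongrightarrow> 0" by real_asymp+
    then have "S \<longlonglongrightarrow> 1 * (\<Sum>l<k'. m l * m (k' - 1 - l)) - 0 * m (k' - 1)"
      unfolding S_def using Suc by (intro tendsto_intros less.IH) auto
    then have S: "S \<longlonglongrightarrow> m k" using Suc by (simp add: mS)
    have "(\<lambda>n. emp_moment n (x n) k - S n) \<longlonglongrightarrow> 0"
    proof (rule tendstoI)
      fix \<delta> :: real assume \<delta>: "\<delta> > 0"
      \<comment> \<open>The first bound is the step restriction in the loop equation, the second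
        makes the quadratic remainder at most half of \<delta>. Each \<open>+ 1\<close> keeps a
        denominator positive.\<close>
      define e where "e = min (1 / (2 * (real k' * R' ^ k' + 1))) (\<delta> / (2 * (C + 1)))"
      have R': "R' \<ge> 1" "R \<le> R'" by (auto simp: R'_def)
      have kR: "real k' * R' ^ k' \<ge> 0" using R' by auto
      have C: "C \<ge> 0" by (simp add: C_def)
      have e: "e > 0" using kR C \<delta> by (auto simp: e_def)
      have "e * (real k' * R' ^ k') \<le> 1 / (2 * (real k' * R' ^ k' + 1)) * (real k' * R' ^ k')"
        using kR by (intro mult_right_mono) (auto simp: e_def)
      also have "\<dots> \<le> 1 / 2" using kR by (simp add: field_simps)
      finally have e2: "e * (real k' * R' ^ k') \<le> 1 / 2" .
      have "e * C \<le> \<delta> / (2 * (C + 1)) * C" using C by (intro mult_right_mono) (auto simp: e_def)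
      also have "\<dots> \<le> \<delta> / 2" using C \<delta> by (simp add: field_simps)
      finally have e3: "e * C \<le> \<delta> / 2" .
      have "(\<lambda>n. (discrete_energy n (x n) - fekete_bound n) / e) \<longlonglongrightarrow> (3/4 - 3/4) / e"
        using e by (intro tendsto_intros E fekete_bound_limit) auto
      then have "\<forall>\<^sub>F n in sequentially. (discrete_energy n (x n) - fekete_bound n) / e < \<delta> / 2"
        using \<delta> by (intro order_tendstoD) auto
      then show "\<forall>\<^sub>F n in sequentially. dist (emp_moment n (x n) k - S n) 0 < \<delta>"
        using inj R eventually_ge_at_top[of 2]
      proof eventually_elim
        case (elim n)
        have "\<bar>x n i\<bar> \<le> R'" if "i < n" for i using elim(3) that R'(2) by force
        from loop_equation_defect[OF elim(4,2) this R'(1) e e2]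
        have "\<bar>emp_moment n (x n) k - S n\<bar> \<le> (discrete_energy n (x n) - fekete_bound n) / e + e * C"
          unfolding S_def C_def Suc .
        then have "\<bar>emp_moment n (x n) k - S n\<bar> < \<delta>" using elim(1) e3 by linarith
        then show ?case by simp
      qed
    qed
    from tendsto_add[OF this S] show ?thesis by simp
  qed
qed

section \<open>The semicircle law\<close>

definition sc_int :: "nat \<Rightarrow> real" where
  "sc_int k = integral {-2..2} (\<lambda>x. x ^ k * sqrt (4 - x\<^sup>2))"

lemma sc_has_integral: "((\<lambda>x. x ^ k * sqrt (4 - x\<^sup>2)) has_integral sc_int k) {-2..2}"
  unfolding sc_int_def by (intro integrable_integral integrable_continuous_real continuous_intros)

lemma sqrt_four_minus_sq_deriv:
  assumes "x \<in> {-2<..<2::real}"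
  shows "((\<lambda>x. sqrt (4 - x\<^sup>2)) has_real_derivative (- x / sqrt (4 - x\<^sup>2))) (at x)"
    and "sqrt (4 - x\<^sup>2) > 0"
proof -
  have "\<bar>x\<bar> < 2" using assms by auto
  then have "\<bar>x\<bar>\<^sup>2 < 2\<^sup>2" by (intro power_strict_mono) auto
  then have "4 - x\<^sup>2 > 0" by simp
  then show "((\<lambda>x. sqrt (4 - x\<^sup>2)) has_real_derivative (- x / sqrt (4 - x\<^sup>2))) (at x)"
    and "sqrt (4 - x\<^sup>2) > 0"
    by (auto intro!: derivative_eq_intros simp: field_simps)
qed

text \<open>Differentiating the primitives below leaves the root in a denominator; a factor under
  that root removes it.\<close>

lemma divide_sqrt_mult:
  fixes u :: real
  assumes "u > 0"
  shows "y / sqrt u * (p * u) = y * p * sqrt u"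
proof -
  have "y / sqrt u * (p * u) = y * p * (u / sqrt u)" by simp
  then show ?thesis using real_div_sqrt[of u] assms by simp
qed

lemma sc_int_0: "sc_int 0 = 2 * pi"
proof -
  let ?F = "\<lambda>x. x / 2 * sqrt (4 - x\<^sup>2) + 2 * arcsin (x / 2)"
  have "((\<lambda>x. sqrt (4 - x\<^sup>2)) has_integral (?F 2 - ?F (-2))) {-2..2}"
  proof (rule fundamental_theorem_of_calculus_interior)
    show "continuous_on {-2..2} ?F"
      by (intro continuous_intros) auto
    fix x :: real assume x: "x \<in> {-2<..<2}"
    note d = sqrt_four_minus_sq_deriv[OF x]
    have "sqrt (1 - (x / 2)\<^sup>2) = sqrt (4 - x\<^sup>2) / 2"
    proof -
      have "sqrt (4 - x\<^sup>2) = sqrt (4 * (1 - (x / 2)\<^sup>2))" by (simp add: power_divide)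
      also have "\<dots> = 2 * sqrt (1 - (x / 2)\<^sup>2)" unfolding real_sqrt_mult by simp
      finally show ?thesis by simp
    qed
    moreover have "sqrt (4 - x\<^sup>2) * sqrt (4 - x\<^sup>2) = 4 - x\<^sup>2" using d(2) by simp
    ultimately have "(?F has_real_derivative sqrt (4 - x\<^sup>2)) (at x)"
      using x d(2) by (auto intro!: derivative_eq_intros d(1) simp: field_simps power2_eq_square)
    then show "(?F has_vector_derivative sqrt (4 - x\<^sup>2)) (at x)"
      by (simp add: has_real_derivative_iff_has_vector_derivative)
  qed simp
  moreover have "?F 2 - ?F (-2) = 2 * pi" by (simp add: arcsin_minus_1)
  ultimately show ?thesis unfolding sc_int_def by (simp add: integral_unique)
qed

lemma sc_int_1: "sc_int 1 = 0"
proof -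
  let ?F = "\<lambda>x. - (1 / 3) * (4 - x\<^sup>2) * sqrt (4 - x\<^sup>2)"
  have "((\<lambda>x. x ^ 1 * sqrt (4 - x\<^sup>2)) has_integral (?F 2 - ?F (-2))) {-2..2}"
  proof (rule fundamental_theorem_of_calculus_interior)
    show "continuous_on {-2..2} ?F" by (intro continuous_intros)
    fix x :: real assume x: "x \<in> {-2<..<2}"
    note d = sqrt_four_minus_sq_deriv[OF x]
    have pos: "4 - x\<^sup>2 > 0" using d(2) by simp
    have p: "((\<lambda>x. - (1 / 3) * (4 - x\<^sup>2)) has_real_derivative 2 / 3 * x) (at x)"
      by (auto intro!: derivative_eq_intros)
    have "(?F has_real_derivative 2 / 3 * x * sqrt (4 - x\<^sup>2) + - x / sqrt (4 - x\<^sup>2) * (- (1 / 3) * (4 - x\<^sup>2))) (at x)"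
      by (rule DERIV_mult[OF p d(1)])
    also have "2 / 3 * x * sqrt (4 - x\<^sup>2) + - x / sqrt (4 - x\<^sup>2) * (- (1 / 3) * (4 - x\<^sup>2)) = x ^ 1 * sqrt (4 - x\<^sup>2)"
      unfolding divide_sqrt_mult[OF pos] by simp
    finally show "(?F has_vector_derivative x ^ 1 * sqrt (4 - x\<^sup>2)) (at x)"
      by (simp add: has_real_derivative_iff_has_vector_derivative)
  qed simp
  then show ?thesis unfolding sc_int_def by (simp add: integral_unique)
qed

text \<open>Integration by parts: x^(k+1) (4 - x^2)^(3/2) vanishes at both ends, and its derivative
  is a combination of the two integrands.\<close>

lemma sc_int_rec: "(real k + 4) * sc_int (k + 2) = 4 * (real k + 1) * sc_int k"
proof -
  let ?F = "\<lambda>x. x ^ (k + 1) * (4 - x\<^sup>2) * sqrt (4 - x\<^sup>2)"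
  let ?f = "\<lambda>x. 4 * (real k + 1) * (x ^ k * sqrt (4 - x\<^sup>2)) - (real k + 4) * (x ^ (k + 2) * sqrt (4 - x\<^sup>2))"
  have "(?f has_integral (?F 2 - ?F (-2))) {-2..2}"
  proof (rule fundamental_theorem_of_calculus_interior)
    show "continuous_on {-2..2} ?F" by (intro continuous_intros)
    fix x :: real assume x: "x \<in> {-2<..<2}"
    note d = sqrt_four_minus_sq_deriv[OF x]
    have pos: "4 - x\<^sup>2 > 0" using d(2) by simp
    have p: "((\<lambda>x. x ^ (k + 1) * (4 - x\<^sup>2)) has_real_derivative
        (real k + 1) * x ^ k * (4 - x\<^sup>2) + x ^ (k + 1) * (- 2 * x)) (at x)"
    proof -
      have p1: "((\<lambda>x. x ^ (k + 1)) has_real_derivative (real k + 1) * x ^ k) (at x)"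
        using DERIV_pow[of "k + 1" x] by (simp add: add.commute)
      have p2: "((\<lambda>x. 4 - x\<^sup>2) has_real_derivative - 2 * x) (at x)"
        by (auto intro!: derivative_eq_intros)
      from DERIV_mult[OF p1 p2] show ?thesis by (simp add: mult_ac)
    qed
    have "(?F has_real_derivative ((real k + 1) * x ^ k * (4 - x\<^sup>2) + x ^ (k + 1) * (- 2 * x)) * sqrt (4 - x\<^sup>2)
        + - x / sqrt (4 - x\<^sup>2) * (x ^ (k + 1) * (4 - x\<^sup>2))) (at x)"
      by (rule DERIV_mult[OF p d(1)])
    also have "- x / sqrt (4 - x\<^sup>2) * (x ^ (k + 1) * (4 - x\<^sup>2)) = - x * x ^ (k + 1) * sqrt (4 - x\<^sup>2)"
      by (rule divide_sqrt_mult[OF pos])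
    also have "((real k + 1) * x ^ k * (4 - x\<^sup>2) + x ^ (k + 1) * (- 2 * x)) * sqrt (4 - x\<^sup>2)
        + - x * x ^ (k + 1) * sqrt (4 - x\<^sup>2) = ?f x"
      by (simp add: algebra_simps power2_eq_square)
    finally show "(?F has_vector_derivative ?f x) (at x)"
      by (simp add: has_real_derivative_iff_has_vector_derivative)
  qed simp
  then have "(?f has_integral 0) {-2..2}" by simp
  moreover have "(?f has_integral (4 * (real k + 1) * sc_int k - (real k + 4) * sc_int (k + 2))) {-2..2}"
    by (rule has_integral_diff[OF has_integral_mult_right[OF sc_has_integral] has_integral_mult_right[OF sc_has_integral]])
  ultimately have "0 = 4 * (real k + 1) * sc_int k - (real k + 4) * sc_int (k + 2)" by (rule has_integral_unique)
  then show ?thesis by simp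
qed

definition sc_moment :: "nat \<Rightarrow> real" where "sc_moment k = sc_int k / (2 * pi)"

lemma sc_moment_odd: "odd k \<Longrightarrow> sc_moment k = 0"
proof (induction k rule: less_induct)
  case (less k)
  show ?case
  proof (cases "k = 1")
    case True then show ?thesis by (simp add: sc_moment_def sc_int_1[simplified])
  next
    case False
    obtain m where m: "k = 2 * m + 1" using less.prems by (rule oddE)
    then obtain m' where "m = Suc m'" using False by (cases m) auto
    then obtain l where l: "k = l + 2" "odd l" using m by (intro that[of "2 * m' + 1"]) auto
    then have "sc_int l = 0" using less.IH[of l] by (simp add: sc_moment_def)
    then show ?thesis using sc_int_rec[of l] l by (simp add: sc_moment_def)
  qed
qed

text \<open>Catalan numbers, written as coefficients of -sqrt (1 - 4 z) / 2. In this form their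
  convolution is a Vandermonde convolution of binomials.\<close>

lemma sc_moment_even: "sc_moment (2 * k) = - (1 / 2) * (- 4) ^ Suc k * (1 / 2 gchoose Suc k)"
proof (induction k)
  case 0
  then show ?case by (simp add: sc_moment_def sc_int_0)
next
  case (Suc k)
  have g: "(1 / 2 gchoose Suc (Suc k)) = ((1 / 2 :: real) gchoose Suc k) * (1 / 2 - real (Suc k)) / real (Suc (Suc k))"
    using gbinomial_absorption[of "Suc k" "1 / 2 :: real"] gbinomial_mult_1[of "1 / 2 :: real" "Suc k"]
    by (simp add: field_simps)
  have "(2 * real k + 4) * sc_moment (2 * Suc k) = 4 * (2 * real k + 1) * sc_moment (2 * k)"
    using sc_int_rec[of "2 * k"] by (simp add: sc_moment_def field_simps)
  then have "sc_moment (2 * Suc k) = 4 * (2 * real k + 1) / (2 * real k + 4) * sc_moment (2 * k)"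
    by (simp add: field_simps)
  also have "\<dots> = - (1 / 2) * (- 4) ^ Suc (Suc k) * (1 / 2 gchoose Suc (Suc k))"
    unfolding Suc.IH g by (simp add: field_simps)
  finally show ?case .
qed

text \<open>For even k each product contains an odd moment. For odd k only even indices survive, and
  the claim is the Catalan recursion.\<close>

lemma sc_moment_Suc: "sc_moment (Suc k) = (\<Sum>l<k. sc_moment l * sc_moment (k - 1 - l))"
proof (cases "even k")
  case True
  have "(\<Sum>l<k. sc_moment l * sc_moment (k - 1 - l)) = 0"
  proof (intro sum.neutral ballI)
    fix l assume "l \<in> {..<k}"
    then have "l < k" by simp
    then have "odd l \<or> odd (k - 1 - l)" using True by presburger
    then show "sc_moment l * sc_moment (k - 1 - l) = 0"
      using sc_moment_odd[of l] sc_moment_odd[of "k - 1 - l"] by (metis mult_zero_left mult_zero_right)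
  qed
  then show ?thesis using True by (simp add: sc_moment_odd)
next
  case False
  then obtain m where k: "k = Suc (2 * m)" by (auto elim: oddE)
  let ?g = "\<lambda>i. (1 / 2 :: real) gchoose i"
  have "(\<Sum>l<k. sc_moment l * sc_moment (k - 1 - l)) = (\<Sum>l\<in>(\<lambda>i. 2 * i) ` {..m}. sc_moment l * sc_moment (k - 1 - l))"
  proof (intro sum.mono_neutral_right ballI)
    fix l assume "l \<in> {..<k} - (\<lambda>i. 2 * i) ` {..m}"
    then have "odd l" using k by (auto elim!: evenE)
    then show "sc_moment l * sc_moment (k - 1 - l) = 0" by (simp add: sc_moment_odd)
  qed (auto simp: k)
  also have "\<dots> = (\<Sum>i\<le>m. sc_moment (2 * i) * sc_moment (2 * (m - i)))"
    by (subst sum.reindex) (auto simp: k inj_on_def diff_mult_distrib2)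
  also have "\<dots> = (\<Sum>i\<le>m. 1 / 4 * (- 4) ^ (m + 2) * (?g (Suc i) * ?g (Suc (m - i))))"
  proof (intro sum.cong refl)
    fix i assume "i \<in> {..m}"
    then have "m + 2 = Suc i + Suc (m - i)" by simp
    then have "(- 4 :: real) ^ (m + 2) = (- 4) ^ Suc i * (- 4) ^ Suc (m - i)" by (simp only: power_add)
    then show "sc_moment (2 * i) * sc_moment (2 * (m - i)) = 1 / 4 * (- 4) ^ (m + 2) * (?g (Suc i) * ?g (Suc (m - i)))"
      unfolding sc_moment_even by simp
  qed
  also have "\<dots> = 1 / 4 * (- 4) ^ (m + 2) * (\<Sum>i\<le>m. ?g (Suc i) * ?g (Suc (m - i)))"
    by (simp add: sum_distrib_left)
  also have "(\<Sum>i\<le>m. ?g (Suc i) * ?g (Suc (m - i))) = - 2 * ?g (m + 2)"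
  proof -
    \<comment> \<open>The square of sqrt (1 - 4 z) is linear, so its coefficient of order m + 2 is
      0. The two end terms i = 0 and i = m + 2 fall outside the shifted sum and make up the
      -2.\<close>
    have "(\<Sum>i\<in>{0..Suc (Suc m)}. ?g i * ?g (Suc (Suc m) - i)) = (1 gchoose Suc (Suc m))"
      using gbinomial_Vandermonde[of "1 / 2 :: real" "1 / 2" "Suc (Suc m)"] by simp
    also have "\<dots> = of_nat (1 choose Suc (Suc m))" by (metis binomial_gbinomial of_nat_1)
    also have "\<dots> = 0" by simp
    finally have "(\<Sum>i\<le>Suc (Suc m). ?g i * ?g (Suc (Suc m) - i)) = 0" by (simp only: atLeast0AtMost)
    moreover have "(\<Sum>i\<le>Suc (Suc m). ?g i * ?g (Suc (Suc m) - i)) =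
        (\<Sum>i\<le>Suc m. ?g i * ?g (Suc (Suc m) - i)) + ?g (Suc (Suc m))"
      by simp
    moreover have "(\<Sum>i\<le>Suc m. ?g i * ?g (Suc (Suc m) - i)) = ?g (Suc (Suc m)) + (\<Sum>i\<le>m. ?g (Suc i) * ?g (Suc m - i))"
      unfolding sum.atMost_Suc_shift by simp
    moreover have "(\<Sum>i\<le>m. ?g (Suc i) * ?g (Suc m - i)) = (\<Sum>i\<le>m. ?g (Suc i) * ?g (Suc (m - i)))"
      by (intro sum.cong) (auto simp: Suc_diff_le)
    ultimately show ?thesis by simp
  qed
  also have "1 / 4 * (- 4) ^ (m + 2) * (- 2 * ?g (m + 2)) = sc_moment (2 * Suc m)"
    unfolding sc_moment_even by simp
  finally show ?thesis by (simp add: k)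
qed

lemma sc_moment_0: "sc_moment 0 = 1" by (simp add: sc_moment_def sc_int_0)

lemma semicircle_moment:
  "integrable semicircle_law (\<lambda>x. x ^ k)" "integral\<^sup>L semicircle_law (\<lambda>x. x ^ k) = sc_moment k"
proof -
  let ?d = "\<lambda>x::real. 1 / (2 * pi) * indicator {-2..2} x * sqrt (4 - x\<^sup>2)"
  \<comment> \<open>Outside [-2, 2] the real root of a negative number is negative, so nonnegativity
    rests on the indicator.\<close>
  have nn: "AE x in lborel. 0 \<le> ?d x"
  proof (intro AE_I2)
    fix x :: real
    show "0 \<le> ?d x"
      using abs_le_square_iff[of x 2] by (cases "x \<in> {-2..2}") (auto simp: indicator_def abs_le_iff)
  qed
  have i: "set_integrable lborel {-2..2} (\<lambda>x. x ^ k * sqrt (4 - x\<^sup>2))"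
    by (intro borel_integrable_atLeastAtMost' continuous_intros)
  have eq: "(\<lambda>x. ?d x *\<^sub>R x ^ k) = (\<lambda>x. 1 / (2 * pi) * (indicator {-2..2} x *\<^sub>R (x ^ k * sqrt (4 - x\<^sup>2))))"
    by (auto simp: indicator_def)
  have int: "integrable lborel (\<lambda>x. ?d x *\<^sub>R x ^ k)"
    unfolding eq using i unfolding set_integrable_def by (rule integrable_mult_right)
  show "integrable semicircle_law (\<lambda>x. x ^ k)"
    unfolding semicircle_law_def by (subst integrable_density) (use int nn in auto)
  have "integral\<^sup>L semicircle_law (\<lambda>x. x ^ k) = integral\<^sup>L lborel (\<lambda>x. ?d x *\<^sub>R x ^ k)"
    unfolding semicircle_law_def by (subst integral_density) (use nn in auto)
  also have "\<dots> = 1 / (2 * pi) * (LINT x:{-2..2}|lborel. x ^ k * sqrt (4 - x\<^sup>2))"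
    unfolding eq set_lebesgue_integral_def by (rule integral_mult_right_zero)
  also have "\<dots> = sc_moment k"
    using set_borel_integral_eq_integral(2)[OF i] by (simp add: sc_moment_def sc_int_def)
  finally show "integral\<^sup>L semicircle_law (\<lambda>x. x ^ k) = sc_moment k" .
qed

lemma sets_semicircle [simp, measurable_cong]: "sets semicircle_law = sets borel"
  and space_semicircle [simp]: "space semicircle_law = UNIV"
  by (simp_all add: semicircle_law_def)

lemma AE_semicircle_bounded: "AE x in semicircle_law. \<bar>x\<bar> \<le> 2"
  unfolding semicircle_law_def by (subst AE_density) (auto simp: indicator_def)

lemma real_distribution_semicircle: "real_distribution semicircle_law"
proof -
  interpret finite_measure semicircle_law
  proof
    have "integrable semicircle_law (\<lambda>x. 1 :: real)" using semicircle_moment(1)[of 0] by simp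
    then show "emeasure semicircle_law (space semicircle_law) \<noteq> \<infinity>"
      by (simp add: integrable_iff_bounded)
  qed
  have "measure semicircle_law (space semicircle_law) = 1"
    using semicircle_moment(2)[of 0] by (simp add: sc_moment_0)
  then have "prob_space semicircle_law"
    by (intro prob_spaceI) (simp add: emeasure_eq_measure)
  then show ?thesis
    by (simp add: real_distribution_def real_distribution_axioms_def)
qed

section \<open>Method of moments on a fixed bounded interval\<close>

lemma moments_imp_weak_conv:
  assumes M: "\<And>n. real_distribution (M n)" and L: "real_distribution L"
    and bM: "\<And>n. AE x in M n. \<bar>x\<bar> \<le> R" and bL: "AE x in L. \<bar>x\<bar> \<le> R"
    and mom: "\<And>k. (\<lambda>n. integral\<^sup>L (M n) (\<lambda>x. x ^ k)) \<longlonglongrightarrow> integral\<^sup>L L (\<lambda>x. x ^ k)"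
  shows "weak_conv_m M L"
proof (rule levy_continuity[OF M L])
  fix t :: real
  define S where "S N k = (\<Sum>j\<le>k. ((\<i> * t) ^ j / fact j) * integral\<^sup>L N (\<lambda>x. x ^ j))" for N :: "real measure" and k
  \<comment> \<open>The Taylor remainder of the characteristic function depends on the measure only
    through R, so one degree k serves for all n and for the limit.\<close>
  have approx: "cmod (char N t - S N k) \<le> 2 * (\<bar>t\<bar> ^ k / fact k * R ^ k)"
    if N: "real_distribution N" and bN: "AE x in N. \<bar>x\<bar> \<le> R" for N k
  proof -
    interpret real_distribution N by (rule N)
    have bj: "AE x in N. \<bar>x\<bar> ^ j \<le> R ^ j" for j
      using bN by eventually_elim (rule power_mono, auto)
    have int: "integrable N (\<lambda>x. x ^ j)" for j
    proof (rule integrable_const_bound[where B = "R ^ j"])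
      show "AE x in N. norm (x ^ j) \<le> R ^ j" using bj[of j] by (simp add: power_abs)
    qed simp
    have int': "integrable N (\<lambda>x. \<bar>x\<bar> ^ k)"
      using integrable_norm[OF int[of k]] by (simp add: power_abs)
    have "integral\<^sup>L N (\<lambda>x. \<bar>x\<bar> ^ k) \<le> integral\<^sup>L N (\<lambda>x. R ^ k)"
      by (rule integral_mono_AE[OF int' _ bj]) simp
    then have "integral\<^sup>L N (\<lambda>x. \<bar>x\<bar> ^ k) \<le> R ^ k" using prob_space by simp
    then have "2 * \<bar>t\<bar> ^ k / fact k * integral\<^sup>L N (\<lambda>x. \<bar>x\<bar> ^ k) \<le> 2 * \<bar>t\<bar> ^ k / fact k * R ^ k"
      by (intro mult_left_mono) auto
    with char_approx1[where n = k and t = t, OF int] show ?thesis unfolding S_def by simp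
  qed
  show "(\<lambda>n. char (M n) t) \<longlonglongrightarrow> char L t"
  proof (rule tendstoI)
    fix e :: real assume e: "e > 0"
    have "(\<lambda>k. \<bar>t * R\<bar> ^ k / fact k) \<longlonglongrightarrow> 0"
      using summable_LIMSEQ_zero[OF summable_exp[of "\<bar>t * R\<bar>"]] by (simp add: divide_inverse mult.commute)
    then have "\<forall>\<^sub>F k in sequentially. \<bar>t * R\<bar> ^ k / fact k < e / 8"
      using e by (intro order_tendstoD) auto
    then obtain k where k: "\<bar>t * R\<bar> ^ k / fact k < e / 8"
      by (auto simp: eventually_sequentially)
    have "\<bar>t\<bar> ^ k / fact k * R ^ k \<le> \<bar>\<bar>t\<bar> ^ k / fact k * R ^ k\<bar>" by (rule abs_ge_self)
    also have "\<dots> = \<bar>t * R\<bar> ^ k / fact k" by (simp add: abs_mult power_mult_distrib power_abs)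
    finally have k2: "2 * (\<bar>t\<bar> ^ k / fact k * R ^ k) < e / 4" using k by linarith
    have "(\<lambda>n. S (M n) k) \<longlonglongrightarrow> S L k" unfolding S_def
      by (intro tendsto_intros tendsto_of_real mom)
    then have "\<forall>\<^sub>F n in sequentially. dist (S (M n) k) (S L k) < e / 4"
      using e by (intro tendstoD) auto
    then show "\<forall>\<^sub>F n in sequentially. dist (char (M n) t) (char L t) < e"
    proof eventually_elim
      case (elim n)
      have "dist (char (M n) t) (char L t) \<le> dist (char (M n) t) (S (M n) k) + dist (S (M n) k) (S L k) + dist (S L k) (char L t)"
        using dist_triangle[of "char (M n) t" "char L t" "S (M n) k"] dist_triangle[of "S (M n) k" "char L t" "S L k"]
        by linarith
      also have "\<dots> < e"
      proof -
        have "dist (char (M n) t) (S (M n) k) \<le> 2 * (\<bar>t\<bar> ^ k / fact k * R ^ k)"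
          "dist (S L k) (char L t) \<le> 2 * (\<bar>t\<bar> ^ k / fact k * R ^ k)"
          using approx[OF M bM, of n k] approx[OF L bL, of k] by (simp_all add: dist_norm norm_minus_commute)
        then show ?thesis using elim k2 e by linarith
      qed
      finally show ?case .
    qed
  qed
qed

section \<open>Concentration of the matrix entries\<close>

lemma chi_density_nonneg: "\<gamma> > 0 \<Longrightarrow> chi_density \<gamma> x \<ge> 0"
  by (auto simp: chi_density_def intro!: divide_nonneg_nonneg mult_nonneg_nonneg Gamma_real_pos less_imp_le)

lemma chi_density_scale:
  assumes "s > 0"
  shows "s * chi_density \<gamma> (s * z) = s powr \<gamma> * exp ((1 - s\<^sup>2) * z\<^sup>2 / 2) * chi_density \<gamma> z"
proof (cases "z > 0")
  case True
  have e: "exp (- (s * z)\<^sup>2 / 2) = exp ((1 - s\<^sup>2) * z\<^sup>2 / 2) * exp (- z\<^sup>2 / 2)"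
    by (simp add: exp_add[symmetric] power_mult_distrib field_simps)
  have "s * (s * z) powr (\<gamma> - 1) = s powr \<gamma> * z powr (\<gamma> - 1)"
    using assms True by (simp add: powr_mult powr_diff)
  then show ?thesis using True assms unfolding chi_density_def e by (simp add: mult_ac)
next
  case False
  then have "\<not> s * z > 0" using assms by (simp add: zero_less_mult_iff)
  then show ?thesis using False by (simp add: chi_density_def)
qed

text \<open>
  Rescaling the variable by \<open>sqrt q\<close> multiplies the density by an explicit factor that is bounded on the
  rescaled set: the optimal Chernoff bound for both tails, without evaluating the Gamma function.
\<close>

lemma (in prob_space) chi_tail:
  assumes X: "distributed M lborel X (chi_density \<gamma>)" and \<gamma>: "\<gamma> > 0" and q: "q > 0"
    and A: "A \<in> sets borel" "\<And>x. x \<in> A \<Longrightarrow> x > 0 \<Longrightarrow> (1 - q) * x\<^sup>2 \<le> (1 - q) * (q * \<gamma>)"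
  shows "prob (X -` A \<inter> space M) \<le> exp (- (\<gamma> / 2) * (q - 1 - ln q))"
proof -
  define s where "s = sqrt q"
  have s: "s > 0" "s\<^sup>2 = q" using q by (auto simp: s_def)
  define C where "C = s powr \<gamma> * exp ((1 - q) * \<gamma> / 2)"
  have C: "C = exp (- (\<gamma> / 2) * (q - 1 - ln q))"
  proof -
    have "ln s = ln q / 2" using q by (simp add: s_def ln_sqrt)
    then show ?thesis using s(1) by (simp add: C_def powr_def exp_add[symmetric] field_simps)
  qed
  have m [measurable]: "(\<lambda>x. ennreal (chi_density \<gamma> x)) \<in> borel_measurable borel"
    using distributed_borel_measurable[OF X] by simp
  have [measurable]: "A \<in> sets borel" by (rule A)
  have one: "(\<integral>\<^sup>+ x. ennreal (chi_density \<gamma> x) \<partial>lborel) = 1"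
    using distributed_emeasure[OF X, of UNIV] emeasure_space_1 by simp
  have "emeasure M (X -` A \<inter> space M) = (\<integral>\<^sup>+ x. ennreal (chi_density \<gamma> x) * indicator A x \<partial>lborel)"
    using distributed_emeasure[OF X, of A] by simp
  also have "\<dots> = ennreal \<bar>s\<bar> * (\<integral>\<^sup>+ z. ennreal (chi_density \<gamma> (0 + s * z)) * indicator A (0 + s * z) \<partial>lborel)"
    using s by (subst nn_integral_real_affine[of _ s 0]) auto
  also have "\<dots> = (\<integral>\<^sup>+ z. ennreal \<bar>s\<bar> * (ennreal (chi_density \<gamma> (s * z)) * indicator A (s * z)) \<partial>lborel)"
    by (subst nn_integral_cmult) auto
  also have "\<dots> \<le> (\<integral>\<^sup>+ z. ennreal C * ennreal (chi_density \<gamma> z) \<partial>lborel)"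
  proof (intro nn_integral_mono)
    fix z
    show "ennreal \<bar>s\<bar> * (ennreal (chi_density \<gamma> (s * z)) * indicator A (s * z)) \<le> ennreal C * ennreal (chi_density \<gamma> z)"
    proof (cases "s * z \<in> A \<and> z > 0")
      case True
      have "(1 - q) * (s * z)\<^sup>2 \<le> (1 - q) * (q * \<gamma>)" using True s by (intro A(2)) auto
      then have "q * ((1 - q) * z\<^sup>2) \<le> q * ((1 - q) * \<gamma>)" using s by (simp add: power_mult_distrib mult_ac)
      then have "(1 - q) * z\<^sup>2 \<le> (1 - q) * \<gamma>" using q by simp
      then have "s powr \<gamma> * exp ((1 - s\<^sup>2) * z\<^sup>2 / 2) \<le> C"
        unfolding C_def s(2) by (intro mult_left_mono) auto
      then have "s * chi_density \<gamma> (s * z) \<le> C * chi_density \<gamma> z"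
        unfolding chi_density_scale[OF s(1)] by (intro mult_right_mono chi_density_nonneg \<gamma>)
      then show ?thesis using True s chi_density_nonneg[OF \<gamma>]
        by (simp add: ennreal_mult[symmetric] C_def ennreal_leI)
    next
      case False
      then have "indicator A (s * z) = (0 :: ennreal) \<or> chi_density \<gamma> (s * z) = 0"
        using s by (auto simp: chi_density_def zero_less_mult_iff)
      then show ?thesis by auto
    qed
  qed
  also have "\<dots> = ennreal C" using one by (subst nn_integral_cmult) auto
  finally show ?thesis
    unfolding C by (simp add: emeasure_eq_measure)
qed

text \<open>Markov's inequality for the sixth moment, 15 * 2^3 = 120. With t of order n and a union
  over n entries this leaves order n^(-2), which is summable; the fourth moment would leave 1 /
  n.\<close>

lemma (in prob_space) normal_tail:
  assumes X: "distributed M lborel X (normal_density 0 (sqrt 2))" and t: "t > 0"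
  shows "prob (X -` {x. x\<^sup>2 > t} \<inter> space M) \<le> 120 / t ^ 3"
proof -
  have [measurable]: "{x::real. x\<^sup>2 > t} \<in> sets borel" by measurable
  have "has_bochner_integral lborel (\<lambda>x. normal_density 0 (sqrt 2) x * (x - 0) ^ (2 * 3))
      (fact (2 * 3) / ((2 / (sqrt 2)\<^sup>2) ^ 3 * fact 3))"
    by (rule normal_moment_even) simp
  moreover have "fact (2 * 3) / ((2 / (sqrt 2)\<^sup>2) ^ 3 * fact 3) = (120 :: real)"
    by (simp add: fact_numeral)
  ultimately have hb: "has_bochner_integral lborel (\<lambda>x. normal_density 0 (sqrt 2) x * x ^ 6) 120" by simp
  then have m6: "(\<integral>\<^sup>+ x. ennreal (normal_density 0 (sqrt 2) x * x ^ 6) \<partial>lborel) = ennreal 120"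
    using nn_integral_eq_integral[of lborel "\<lambda>x. normal_density 0 (sqrt 2) x * x ^ 6"]
    by (simp add: has_bochner_integral_iff)
  have "emeasure M (X -` {x. x\<^sup>2 > t} \<inter> space M) =
      (\<integral>\<^sup>+ x. ennreal (normal_density 0 (sqrt 2) x) * indicator {x. x\<^sup>2 > t} x \<partial>lborel)"
    using distributed_emeasure[OF X, of "{x. x\<^sup>2 > t}"] by simp
  also have "\<dots> \<le> (\<integral>\<^sup>+ x. ennreal (1 / t ^ 3) * ennreal (normal_density 0 (sqrt 2) x * x ^ 6) \<partial>lborel)"
  proof (intro nn_integral_mono)
    fix x :: real
    show "ennreal (normal_density 0 (sqrt 2) x) * indicator {x. x\<^sup>2 > t} x
        \<le> ennreal (1 / t ^ 3) * ennreal (normal_density 0 (sqrt 2) x * x ^ 6)"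
    proof (cases "x\<^sup>2 > t")
      case True
      have "t ^ 3 \<le> (x\<^sup>2) ^ 3" using True t by (intro power_mono) auto
      then have "1 \<le> x ^ 6 / t ^ 3" using t by (simp flip: power_mult)
      then have "normal_density 0 (sqrt 2) x * 1 \<le> normal_density 0 (sqrt 2) x * (x ^ 6 / t ^ 3)"
        by (intro mult_left_mono) auto
      then show ?thesis using True t by (simp add: ennreal_mult'[symmetric] ennreal_leI mult_ac)
    qed simp
  qed
  also have "\<dots> = ennreal (1 / t ^ 3) * ennreal 120"
    using m6 by (subst nn_integral_cmult) auto
  also have "\<dots> = ennreal (1 / t ^ 3 * 120)" using t by (intro ennreal_mult[symmetric]) auto
  finally show ?thesis using t by (subst (asm) emeasure_eq_measure) (simp add: ennreal_le_iff)
qed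

text \<open>Convexity between 0 and y. With t = j / n it converts tail exponents for j into
  exponents linear in n.\<close>

lemma exp_mult_le:
  fixes t y :: real
  assumes "0 \<le> t" "t \<le> 1"
  shows "exp (t * y) \<le> 1 - t + t * exp y"
proof -
  have "convex_on UNIV (exp :: real \<Rightarrow> real)" by (rule exp_convex)
  from convex_onD[OF this, of t 0 y] assms show ?thesis by (simp add: algebra_simps)
qed


text \<open>The choice q = exp (- \<kappa> n / j) makes -j ln q equal to \<kappa> n, and convexity
  bounds the remaining j (q - 1) below by its value at j = n. The tolerance thus widens for small j
  in such a way that the rate is uniform in j and linear in n.\<close>

lemma (in prob_space) chi_lower_tail:
  assumes X: "distributed M lborel X (chi_density (real j * \<beta>))"
    and j: "0 < j" "j \<le> n" and \<beta>: "\<beta> > 0" and \<kappa>: "\<kappa> > 0"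
  shows "prob (X -` {..<sqrt (\<beta> * j) * exp (- \<kappa> * n / (2 * real j))} \<inter> space M)
    \<le> exp (- (\<beta> / 2) * (exp (- \<kappa>) - 1 + \<kappa>) * real n)"
proof -
  define q where "q = exp (- \<kappa> * n / j)"
  have q: "q > 0" "q \<le> 1" using j \<kappa> by (auto simp: q_def)
  have r2: "(sqrt (\<beta> * j) * exp (- \<kappa> * n / (2 * real j)))\<^sup>2 = q * (real j * \<beta>)"
    using \<beta> j by (simp add: power_mult_distrib q_def exp_double[symmetric] mult_ac)
  have "prob (X -` {..<sqrt (\<beta> * j) * exp (- \<kappa> * n / (2 * real j))} \<inter> space M) \<le>
      exp (- (real j * \<beta> / 2) * (q - 1 - ln q))"
  proof (rule chi_tail[OF X _ q(1)])
    fix x assume x: "x \<in> {..<sqrt (\<beta> * j) * exp (- \<kappa> * n / (2 * real j))}" "x > 0"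
    then have "x\<^sup>2 \<le> q * (real j * \<beta>)" unfolding r2[symmetric] by (intro power_mono) auto
    then show "(1 - q) * x\<^sup>2 \<le> (1 - q) * (q * (real j * \<beta>))" using q by (intro mult_left_mono) auto
  qed (use j \<beta> in auto)
  also have "\<dots> \<le> exp (- (\<beta> / 2) * (exp (- \<kappa>) - 1 + \<kappa>) * real n)"
  proof -
    have "exp (real j / n * (- \<kappa> * n / j)) \<le> 1 - real j / n + real j / n * q"
      unfolding q_def using j by (intro exp_mult_le) auto
    moreover have "real j / n * (- \<kappa> * n / j) = - \<kappa>" using j by simp
    ultimately have "real n * exp (- \<kappa>) \<le> real n * (1 - real j / n + real j / n * q)"
      by (intro mult_left_mono) auto
    also have "\<dots> = real n - real j + real j * q" using j by (simp add: field_simps)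
    finally have "real n * (exp (- \<kappa>) - 1 + \<kappa>) \<le> j * q - j + \<kappa> * n" by (simp add: algebra_simps)
    also have "\<dots> = real j * (q - 1 - ln q)" using j by (simp add: q_def field_simps)
    finally have "\<beta> / 2 * (real n * (exp (- \<kappa>) - 1 + \<kappa>)) \<le> \<beta> / 2 * (real j * (q - 1 - ln q))"
      using \<beta> by (intro mult_left_mono) auto
    moreover have "\<beta> / 2 * (real j * (q - 1 - ln q)) = real j * \<beta> / 2 * (q - 1 - ln q)" by simp
    ultimately show ?thesis by (simp add: mult_ac)
  qed
  finally show ?thesis .
qed

text \<open>Above the typical value a tolerance for the square that is proportional to n suffices,
  i.e. q = 1 + \<kappa> n / j. Then j (q - 1) is exactly \<kappa> n, and j ln q is largest at j =
  n.\<close>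

lemma (in prob_space) chi_upper_tail:
  assumes X: "distributed M lborel X (chi_density (real j * \<beta>))"
    and j: "0 < j" "j \<le> n" and \<beta>: "\<beta> > 0" and \<kappa>: "\<kappa> > 0"
  shows "prob (X -` {sqrt (\<beta> * j + \<kappa> * \<beta> * n)<..} \<inter> space M)
    \<le> exp (- (\<beta> / 2) * (\<kappa> - ln (1 + \<kappa>)) * real n)"
proof -
  define q where "q = 1 + \<kappa> * n / j"
  have q: "q > 0" "q \<ge> 1" using j \<kappa> by (auto simp: q_def add_pos_nonneg)
  have r2: "\<beta> * j + \<kappa> * \<beta> * n = q * (real j * \<beta>)" using j by (simp add: q_def field_simps)
  have "prob (X -` {sqrt (\<beta> * j + \<kappa> * \<beta> * n)<..} \<inter> space M) \<le> exp (- (real j * \<beta> / 2) * (q - 1 - ln q))"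
  proof (rule chi_tail[OF X _ q(1)])
    fix x assume x: "x \<in> {sqrt (\<beta> * j + \<kappa> * \<beta> * n)<..}" "x > 0"
    then have "sqrt (q * (real j * \<beta>)) ^ 2 \<le> x\<^sup>2" unfolding r2 using q \<beta> by (intro power_mono) auto
    then have "q * (real j * \<beta>) \<le> x\<^sup>2" using q \<beta> by simp
    then show "(1 - q) * x\<^sup>2 \<le> (1 - q) * (q * (real j * \<beta>))" using q by (intro mult_left_mono_neg) auto
  qed (use j \<beta> in auto)
  also have "\<dots> \<le> exp (- (\<beta> / 2) * (\<kappa> - ln (1 + \<kappa>)) * real n)"
  proof -
    have "exp (real j / n * ln q) \<le> 1 - real j / n + real j / n * exp (ln q)"
      using j by (intro exp_mult_le) auto
    also have "\<dots> = 1 + \<kappa>" using j q by (simp add: q_def field_simps)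
    finally have "real j / n * ln q \<le> ln (1 + \<kappa>)" using \<kappa> by (subst ln_ge_iff) auto
    then have "real n * (real j / n * ln q) \<le> real n * ln (1 + \<kappa>)" by (rule mult_left_mono) simp
    then have "j * ln q \<le> n * ln (1 + \<kappa>)" using j by simp
    moreover have "real j * (q - 1) = \<kappa> * n" using j by (simp add: q_def)
    ultimately have "(\<kappa> - ln (1 + \<kappa>)) * n \<le> real j * (q - 1 - ln q)" by (simp add: algebra_simps)
    then have "\<beta> / 2 * ((\<kappa> - ln (1 + \<kappa>)) * n) \<le> \<beta> / 2 * (real j * (q - 1 - ln q))"
      using \<beta> by (intro mult_left_mono) auto
    moreover have "\<beta> / 2 * (real j * (q - 1 - ln q)) = real j * \<beta> / 2 * (q - 1 - ln q)" by simp
    ultimately show ?thesis by (simp add: mult_ac)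
  qed
  finally show ?thesis .
qed

text \<open>Tolerances before scaling. The lower one for the superdiagonal is a factor that weakens
  towards the last rows, the upper one is additive in the square; both fail with probability
  exponentially small in n, uniformly in the row. The 2 in the exponent appears because the entry
  itself is bounded, not its square.\<close>

definition entries_good :: "real \<Rightarrow> real \<Rightarrow> nat \<Rightarrow> real mat \<Rightarrow> bool" where
  "entries_good \<beta> \<kappa> n m \<longleftrightarrow> (\<forall>i<n. (m $$ (i, i))\<^sup>2 \<le> \<kappa> * n) \<and>
    (\<forall>i. Suc i < n \<longrightarrow>
       sqrt (\<beta> * real (n - Suc i)) * exp (- \<kappa> * n / (2 * real (n - Suc i))) \<le> m $$ (i, Suc i) \<and>
       m $$ (i, Suc i) \<le> sqrt (\<beta> * real (n - Suc i) + \<kappa> * \<beta> * n))"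

lemma (in prob_space) prob_entries_bad:
  assumes X: "beta_ensemble M \<beta> n X" and n: "n \<ge> 2" and \<beta>: "\<beta> > 0" and \<kappa>: "\<kappa> > 0"
  obtains B where "B \<in> sets M" "\<And>\<omega>. \<omega> \<in> space M - B \<Longrightarrow> entries_good \<beta> \<kappa> n (X \<omega>)"
    "prob B \<le> real n * (120 / (\<kappa> * n) ^ 3)
      + real n * (exp (- (\<beta> / 2) * (exp (- \<kappa>) - 1 + \<kappa>) * real n) + exp (- (\<beta> / 2) * (\<kappa> - ln (1 + \<kappa>)) * real n))"
proof -
  let ?a = "\<lambda>i \<omega>. X \<omega> $$ (i, i)" and ?b = "\<lambda>i \<omega>. X \<omega> $$ (i, Suc i)"
  have da: "distributed M lborel (?a i) (normal_density 0 (sqrt 2))" if "i < n" for i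
    using X that by (simp add: beta_ensemble_def)
  have db: "distributed M lborel (?b i) (chi_density (real (n - Suc i) * \<beta>))" if "Suc i < n" for i
    using X that by (simp add: beta_ensemble_def)
  have ma: "?a i \<in> borel_measurable M" if "i < n" for i
    using distributed_measurable[OF da[OF that]] by simp
  have mb: "?b i \<in> borel_measurable M" if "Suc i < n" for i
    using distributed_measurable[OF db[OF that]] by simp
  define lo where "lo i = sqrt (\<beta> * real (n - Suc i)) * exp (- \<kappa> * n / (2 * real (n - Suc i)))" for i
  define up where "up i = sqrt (\<beta> * real (n - Suc i) + \<kappa> * \<beta> * n)" for i
  define B1 where "B1 i = ?a i -` {x. x\<^sup>2 > \<kappa> * n} \<inter> space M" for i
  define B2 where "B2 i = (?b i -` {..<lo i} \<inter> space M) \<union> (?b i -` {up i<..} \<inter> space M)" for i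
  have s: "{x::real. x\<^sup>2 > \<kappa> * n} \<in> sets borel" by measurable
  have B1: "B1 i \<in> sets M" if "i < n" for i
    unfolding B1_def using ma[OF that] s by (rule measurable_sets)
  have B2a: "?b i -` {..<lo i} \<inter> space M \<in> sets M" "?b i -` {up i<..} \<inter> space M \<in> sets M" if "Suc i < n" for i
    using mb[OF that] by (auto intro: measurable_sets)
  then have B2: "B2 i \<in> sets M" if "Suc i < n" for i
    using that unfolding B2_def by auto
  have P1: "prob (B1 i) \<le> 120 / (\<kappa> * n) ^ 3" if "i < n" for i
    unfolding B1_def by (rule normal_tail[OF da[OF that]]) (use n \<kappa> in auto)
  define e where "e = exp (- (\<beta> / 2) * (exp (- \<kappa>) - 1 + \<kappa>) * real n) + exp (- (\<beta> / 2) * (\<kappa> - ln (1 + \<kappa>)) * real n)"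
  have P2: "prob (B2 i) \<le> e" if "Suc i < n" for i
  proof -
    have "prob (B2 i) \<le> prob (?b i -` {..<lo i} \<inter> space M) + prob (?b i -` {up i<..} \<inter> space M)"
      unfolding B2_def using B2a[OF that] by (rule measure_Un_le)
    also have "\<dots> \<le> e"
      unfolding e_def lo_def up_def using that \<beta> \<kappa>
      by (intro add_mono chi_lower_tail[OF db[OF that]] chi_upper_tail[OF db[OF that]]) auto
    finally show ?thesis .
  qed
  define B where "B = (\<Union>i\<in>{..<n}. B1 i) \<union> (\<Union>i\<in>{..<n-1}. B2 i)"
  have Bs: "(\<Union>i\<in>{..<n}. B1 i) \<in> sets M" "(\<Union>i\<in>{..<n-1}. B2 i) \<in> sets M"
    using B1 B2 by (auto intro!: sets.finite_UN)
  show thesis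
  proof (rule that[of B])
    show "B \<in> sets M" using Bs by (auto simp: B_def)
    show "entries_good \<beta> \<kappa> n (X \<omega>)" if "\<omega> \<in> space M - B" for \<omega>
    proof -
      have "\<not> (X \<omega> $$ (i, i))\<^sup>2 > \<kappa> * n" if "i < n" for i
        using \<open>\<omega> \<in> space M - B\<close> that by (auto simp: B_def B1_def)
      moreover have "\<not> X \<omega> $$ (i, Suc i) < lo i \<and> \<not> X \<omega> $$ (i, Suc i) > up i" if "Suc i < n" for i
        using \<open>\<omega> \<in> space M - B\<close> that by (auto simp: B_def B2_def)
      ultimately show ?thesis unfolding entries_good_def lo_def up_def by (meson not_less)
    qed
    have "prob B \<le> prob (\<Union>i\<in>{..<n}. B1 i) + prob (\<Union>i\<in>{..<n-1}. B2 i)"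
      unfolding B_def by (rule measure_Un_le[OF Bs])
    also have "prob (\<Union>i\<in>{..<n}. B1 i) \<le> (\<Sum>i\<in>{..<n}. prob (B1 i))"
      using B1 by (intro finite_measure_subadditive_finite) auto
    also have "\<dots> \<le> (\<Sum>i\<in>{..<n}. 120 / (\<kappa> * n) ^ 3)" using P1 by (intro sum_mono) auto
    also have "prob (\<Union>i\<in>{..<n-1}. B2 i) \<le> (\<Sum>i\<in>{..<n-1}. prob (B2 i))"
      using B2 by (intro finite_measure_subadditive_finite) auto
    also have "\<dots> \<le> (\<Sum>i\<in>{..<n-1}. e)" using P2 by (intro sum_mono) auto
    also have "\<dots> \<le> real n * e" by (auto simp: e_def intro!: mult_right_mono)
    finally show "prob B \<le> real n * (120 / (\<kappa> * n) ^ 3)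
      + real n * (exp (- (\<beta> / 2) * (exp (- \<kappa>) - 1 + \<kappa>) * real n) + exp (- (\<beta> / 2) * (\<kappa> - ln (1 + \<kappa>)) * real n))"
      by (simp add: e_def)
  qed
qed

lemma summable_n_exp: "c > 0 \<Longrightarrow> summable (\<lambda>n. real n * exp (- c * real n))"
proof (rule summable_comparison_test_bigo)
  show "summable (\<lambda>n. norm (1 / real n ^ 2))"
    using inverse_power_summable[of 2, where ?'a = real] by (simp add: inverse_eq_divide)
  assume "c > 0"
  then show "(\<lambda>n. real n * exp (- c * real n)) \<in> O(\<lambda>n. 1 / real n ^ 2)" by real_asymp
qed

lemma (in prob_space) AE_eventually_entries_good:
  assumes X: "\<And>n. n \<ge> 2 \<Longrightarrow> beta_ensemble M \<beta> n (X n)" and \<beta>: "\<beta> > 0" and \<kappa>: "\<kappa> > 0"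
  shows "AE \<omega> in M. \<forall>\<^sub>F n in sequentially. entries_good \<beta> \<kappa> n (X n \<omega>)"
proof -
  define c1 where "c1 = \<beta> / 2 * (exp (- \<kappa>) - 1 + \<kappa>)"
  define c2 where "c2 = \<beta> / 2 * (\<kappa> - ln (1 + \<kappa>))"
  define p where "p n = real n * (120 / (\<kappa> * n) ^ 3)
      + real n * (exp (- (\<beta> / 2) * (exp (- \<kappa>) - 1 + \<kappa>) * real n) + exp (- (\<beta> / 2) * (\<kappa> - ln (1 + \<kappa>)) * real n))" for n
  have p_eq: "p = (\<lambda>n. real n * (120 / (\<kappa> * n) ^ 3) + (real n * exp (- c1 * real n) + real n * exp (- c2 * real n)))"
    unfolding p_def c1_def c2_def distrib_left[of "real _" "exp _"] by simp
  have "\<exists>B. n \<ge> 2 \<longrightarrow> B \<in> sets M \<and> (\<forall>\<omega>\<in>space M - B. entries_good \<beta> \<kappa> n (X n \<omega>)) \<and> prob B \<le> p n" for n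
  proof (cases "n \<ge> 2")
    case True
    obtain B where "B \<in> sets M" "\<And>\<omega>. \<omega> \<in> space M - B \<Longrightarrow> entries_good \<beta> \<kappa> n (X n \<omega>)"
      "prob B \<le> real n * (120 / (\<kappa> * n) ^ 3)
        + real n * (exp (- (\<beta> / 2) * (exp (- \<kappa>) - 1 + \<kappa>) * real n) + exp (- (\<beta> / 2) * (\<kappa> - ln (1 + \<kappa>)) * real n))"
      by (rule prob_entries_bad[OF X[OF True] True \<beta> \<kappa>]) blast
    moreover from this(3) have "prob B \<le> p n" unfolding p_def .
    ultimately show ?thesis by (intro exI[of _ B]) auto
  qed auto
  then have "\<exists>B. \<forall>n. n \<ge> 2 \<longrightarrow> B n \<in> sets M \<and> (\<forall>\<omega>\<in>space M - B n. entries_good \<beta> \<kappa> n (X n \<omega>)) \<and> prob (B n) \<le> p n"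
    by (intro choice allI)
  then obtain B where B: "n \<ge> 2 \<Longrightarrow> B n \<in> sets M" "n \<ge> 2 \<Longrightarrow> \<omega> \<in> space M - B n \<Longrightarrow> entries_good \<beta> \<kappa> n (X n \<omega>)"
    "n \<ge> 2 \<Longrightarrow> prob (B n) \<le> p n" for n \<omega> by blast
  \<comment> \<open>The laws are given only from n = 2 on; an empty exceptional set below keeps the
    whole sequence measurable.\<close>
  define B' where "B' n = (if n \<ge> 2 then B n else {})" for n
  have "AE \<omega> in M. \<forall>\<^sub>F n in sequentially. \<omega> \<in> space M - B' n"
  proof (rule borel_cantelli_AE1)
    show "B' n \<in> sets M" for n using B(1) by (simp add: B'_def)
    show "emeasure M (B' n) < \<infinity>" for n by (simp add: less_top[symmetric])
    \<comment> \<open>Strict inequality is needed for a positive decay rate, hence the equality case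
      of ln y <= y - 1 is excluded.\<close>
    have "exp (- \<kappa>) - 1 + \<kappa> \<noteq> 0"
      using ln_eq_minus_one[of "exp (- \<kappa>)"] \<kappa> by auto
    then have c1: "c1 > 0" using exp_ge_add_one_self[of "- \<kappa>"] \<beta> by (auto simp: c1_def)
    have c2: "c2 > 0" using ln_add_one_self_less_self[OF \<kappa>] \<beta> by (auto simp: c2_def)
    have "summable p" unfolding p_eq
    proof (intro summable_add summable_n_exp c1 c2)
      have "summable (\<lambda>n. 120 / \<kappa> ^ 3 * (1 / real n ^ 2))"
        using inverse_power_summable[of 2, where ?'a = real] by (intro summable_mult) (simp add: inverse_eq_divide)
      moreover have "real n * (120 / (\<kappa> * n) ^ 3) = 120 / \<kappa> ^ 3 * (1 / real n ^ 2)" for n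
        by (cases "n = 0") (auto simp: power_mult_distrib power2_eq_square power3_eq_cube)
      ultimately show "summable (\<lambda>n. real n * (120 / (\<kappa> * real n) ^ 3))" by simp
    qed
    then show "summable (\<lambda>n. prob (B' n))"
    proof (rule summable_comparison_test_ev[rotated])
      show "\<forall>\<^sub>F n in sequentially. norm (prob (B' n)) \<le> p n"
        using eventually_ge_at_top[of 2] by eventually_elim (use B(3) in \<open>simp add: B'_def\<close>)
    qed
  qed
  then show ?thesis
  proof eventually_elim
    case (elim \<omega>)
    from elim eventually_ge_at_top[of 2] show ?case
      by eventually_elim (use B(2) in \<open>auto simp: B'_def\<close>)
  qed
qed

section \<open>The energy of the semicircle law\<close>

text \<open>Minus the logarithm of the distance, capped at L from above. Continuity allows passage
  to the limit in pair averages, and the diagonal takes the finite value L.\<close>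

definition trunc_log :: "real \<Rightarrow> real \<Rightarrow> real" where
  "trunc_log L r = - ln (max \<bar>r\<bar> (exp (- L)))"

lemma continuous_trunc_log: "continuous_on A (trunc_log L)"
  unfolding trunc_log_def by (intro continuous_intros) (auto simp: max_def intro: less_imp_neq[symmetric] order.strict_trans2[OF exp_gt_zero])

lemma trunc_log_eq: "trunc_log L r = (if r = 0 then L else min L (- ln \<bar>r\<bar>))"
proof (cases "r = 0")
  case False
  then have r: "\<bar>r\<bar> > 0" by simp
  have "trunc_log L r = - max (ln \<bar>r\<bar>) (- L)"
  proof (cases "\<bar>r\<bar> \<le> exp (- L)")
    case True
    then have "ln \<bar>r\<bar> \<le> - L" using r ln_le_cancel_iff[of "\<bar>r\<bar>" "exp (- L)"] by simp
    then show ?thesis using True by (simp add: trunc_log_def max_def)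
  next
    case nle: False
    then have "- L < ln \<bar>r\<bar>" using r ln_less_cancel_iff[of "exp (- L)" "\<bar>r\<bar>"] by simp
    then show ?thesis using nle by (simp add: trunc_log_def max_def)
  qed
  then show ?thesis using False by (auto simp: max_def min_def)
qed (simp add: trunc_log_def)

text \<open>The diagonal is included so that averages of powers are polynomials in the empirical
  moments.\<close>

definition pair_mean :: "nat \<Rightarrow> (nat \<Rightarrow> real) \<Rightarrow> (real \<Rightarrow> real) \<Rightarrow> real" where
  "pair_mean n x f = (\<Sum>i<n. \<Sum>j<n. f (x i - x j)) / (real n)\<^sup>2"

lemma pair_mean_power:
  "pair_mean n x (\<lambda>r. r ^ k) = (\<Sum>l\<le>k. real (k choose l) * (-1) ^ (k - l) * emp_moment n x l * emp_moment n x (k - l))"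
proof -
  have "(x i - x j) ^ k = (\<Sum>l\<le>k. real (k choose l) * (-1) ^ (k - l) * (x i ^ l * x j ^ (k - l)))" for i j
  proof -
    have "(x i + - x j) ^ k = (\<Sum>l\<le>k. real (k choose l) * x i ^ l * (- x j) ^ (k - l))" by (rule binomial_ring)
    also have "\<dots> = (\<Sum>l\<le>k. real (k choose l) * (-1) ^ (k - l) * (x i ^ l * x j ^ (k - l)))"
      by (intro sum.cong refl) (simp add: power_minus[of "x j"])
    finally show ?thesis by simp
  qed
  then have "(\<Sum>i<n. \<Sum>j<n. (x i - x j) ^ k) = (\<Sum>i<n. \<Sum>j<n. \<Sum>l\<le>k. real (k choose l) * (-1) ^ (k - l) * (x i ^ l * x j ^ (k - l)))"
    by simp
  also have "\<dots> = (\<Sum>i<n. \<Sum>l\<le>k. \<Sum>j<n. real (k choose l) * (-1) ^ (k - l) * (x i ^ l * x j ^ (k - l)))"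
    by (intro sum.cong refl sum.swap)
  also have "\<dots> = (\<Sum>l\<le>k. \<Sum>i<n. \<Sum>j<n. real (k choose l) * (-1) ^ (k - l) * (x i ^ l * x j ^ (k - l)))"
    by (rule sum.swap)
  also have "\<dots> = (\<Sum>l\<le>k. real (k choose l) * (-1) ^ (k - l) * ((\<Sum>i<n. x i ^ l) * (\<Sum>j<n. x j ^ (k - l))))"
    by (intro sum.cong refl) (simp only: sum_product, simp only: sum_distrib_left)
  finally show ?thesis
    unfolding pair_mean_def emp_moment_def power2_eq_square
    by (simp only: sum_divide_distrib[of _ "{..k}"]) (simp add: mult.assoc)
qed

interpretation sc: real_distribution semicircle_law by (rule real_distribution_semicircle)
interpretation scp: pair_prob_space semicircle_law semicircle_law ..

abbreviation "scpair \<equiv> semicircle_law \<Otimes>\<^sub>M semicircle_law"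

lemma sets_scpair [measurable_cong]: "sets scpair = sets (borel \<Otimes>\<^sub>M borel)"
  by (intro sets_pair_measure_cong) auto

lemma AE_scpair_bounded: "AE z in scpair. \<bar>fst z\<bar> \<le> 2 \<and> \<bar>snd z\<bar> \<le> 2"
proof (rule scp.AE_pair_measure)
  show "{z \<in> space scpair. \<bar>fst z\<bar> \<le> 2 \<and> \<bar>snd z\<bar> \<le> 2} \<in> sets scpair" by measurable
  show "AE x in semicircle_law. AE y in semicircle_law. \<bar>fst (x, y)\<bar> \<le> 2 \<and> \<bar>snd (x, y)\<bar> \<le> 2"
    using AE_semicircle_bounded by eventually_elim (use AE_semicircle_bounded in simp)
qed

definition sc_mean :: "(real \<Rightarrow> real) \<Rightarrow> real" where
  "sc_mean f = integral\<^sup>L scpair (\<lambda>z. f (fst z - snd z))"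

lemma sc_integrable_bounded:
  fixes f :: "real \<Rightarrow> real"
  assumes [measurable]: "f \<in> borel_measurable borel" and B: "\<And>r. \<bar>r\<bar> \<le> 4 \<Longrightarrow> \<bar>f r\<bar> \<le> B"
  shows "integrable scpair (\<lambda>z. f (fst z - snd z))"
proof (rule scp.P.integrable_const_bound[where B = B])
  show "AE z in scpair. norm (f (fst z - snd z)) \<le> B"
    using AE_scpair_bounded by eventually_elim (use B in auto)
qed measurable

lemma sc_integrable_continuous:
  fixes f :: "real \<Rightarrow> real"
  assumes "continuous_on UNIV f"
  shows "integrable scpair (\<lambda>z. f (fst z - snd z))"
proof -
  have "compact (f ` {-4..4})"
    using assms by (intro compact_continuous_image) (auto intro: continuous_on_subset)
  then obtain B where "\<And>y. y \<in> f ` {-4..4} \<Longrightarrow> norm y \<le> B" by (metis compact_imp_bounded bounded_iff)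
  then show ?thesis
    using assms by (intro sc_integrable_bounded[where B = B]) (auto intro: borel_measurable_continuous_onI simp: abs_le_iff)
qed

lemma sc_monomial:
  "integrable scpair (\<lambda>z. fst z ^ l * snd z ^ m)"
  "integral\<^sup>L scpair (\<lambda>z. fst z ^ l * snd z ^ m) = sc_moment l * sc_moment m"
proof -
  show int: "integrable scpair (\<lambda>z. fst z ^ l * snd z ^ m)"
  proof (rule scp.P.integrable_const_bound[where B = "2 ^ l * 2 ^ m"])
    show "AE z in scpair. norm (fst z ^ l * snd z ^ m) \<le> 2 ^ l * 2 ^ m"
      using AE_scpair_bounded
      by eventually_elim (auto simp: abs_mult power_abs intro!: mult_mono power_mono)
  qed measurable
  show "integral\<^sup>L scpair (\<lambda>z. fst z ^ l * snd z ^ m) = sc_moment l * sc_moment m"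
    unfolding scp.integral_fst'[OF int, symmetric] by (simp add: semicircle_moment)
qed

lemma sc_mean_power:
  "sc_mean (\<lambda>r. r ^ k) = (\<Sum>l\<le>k. real (k choose l) * (-1) ^ (k - l) * sc_moment l * sc_moment (k - l))"
proof -
  have "(fst z - snd z) ^ k = (\<Sum>l\<le>k. real (k choose l) * (-1) ^ (k - l) * (fst z ^ l * snd z ^ (k - l)))" for z :: "real \<times> real"
  proof -
    have "(fst z + - snd z) ^ k = (\<Sum>l\<le>k. real (k choose l) * fst z ^ l * (- snd z) ^ (k - l))" by (rule binomial_ring)
    also have "\<dots> = (\<Sum>l\<le>k. real (k choose l) * (-1) ^ (k - l) * (fst z ^ l * snd z ^ (k - l)))"
      by (intro sum.cong refl) (simp add: power_minus[of "snd z"])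
    finally show ?thesis by simp
  qed
  note eq = this
  show ?thesis unfolding sc_mean_def eq by (simp add: sc_monomial mult.assoc)
qed

text \<open>Weierstrass approximation reduces f to powers, whose pair averages are determined by
  moments. The interval of approximation contains the differences of the points as well as those of
  the semicircle support.\<close>

lemma pair_mean_limit:
  fixes x :: "nat \<Rightarrow> nat \<Rightarrow> real"
  assumes mom: "\<And>k. (\<lambda>n. emp_moment n (x n) k) \<longlonglongrightarrow> sc_moment k"
    and R: "\<forall>\<^sub>F n in sequentially. \<forall>i<n. \<bar>x n i\<bar> \<le> R" and f: "continuous_on UNIV f"
  shows "(\<lambda>n. pair_mean n (x n) f) \<longlonglongrightarrow> sc_mean f"
proof (rule tendstoI)
  fix e :: real assume e: "e > 0"
  define R' where "R' = max 2 R"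
  obtain g where g: "real_polynomial_function g" and fg: "\<And>r. r \<in> {-2 * R'..2 * R'} \<Longrightarrow> \<bar>f r - g r\<bar> < e / 4"
    using Stone_Weierstrass_real_polynomial_function[of "{-2 * R'..2 * R'}" f "e / 4"] e f
    by (metis compact_Icc continuous_on_subset divide_pos_pos subset_UNIV zero_less_numeral)
  obtain a N where ga: "g = (\<lambda>r. \<Sum>k\<le>N. a k * r ^ k)"
    using g real_polynomial_function_iff_sum by blast
  have "pair_mean n (x n) g = (\<Sum>k\<le>N. a k * pair_mean n (x n) (\<lambda>r. r ^ k))" for n
  proof -
    have "(\<Sum>i<n. \<Sum>j<n. g (x n i - x n j)) = (\<Sum>i<n. \<Sum>k\<le>N. \<Sum>j<n. a k * (x n i - x n j) ^ k)"
      unfolding ga by (intro sum.cong refl sum.swap)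
    also have "\<dots> = (\<Sum>k\<le>N. \<Sum>i<n. \<Sum>j<n. a k * (x n i - x n j) ^ k)" by (rule sum.swap)
    finally show ?thesis by (simp add: pair_mean_def sum_distrib_left sum_divide_distrib)
  qed
  moreover have "(\<lambda>n. \<Sum>k\<le>N. a k * pair_mean n (x n) (\<lambda>r. r ^ k)) \<longlonglongrightarrow> (\<Sum>k\<le>N. a k * sc_mean (\<lambda>r. r ^ k))"
    unfolding pair_mean_power sc_mean_power by (intro tendsto_intros mom)
  moreover have cont_g: "continuous_on UNIV g" unfolding ga by (intro continuous_intros)
  have "sc_mean g = (\<Sum>k\<le>N. a k * sc_mean (\<lambda>r. r ^ k))"
  proof -
    have "integrable scpair (\<lambda>z. (fst z - snd z) ^ k)" for k
      by (rule sc_integrable_continuous) (intro continuous_intros)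
    then show ?thesis unfolding sc_mean_def ga by simp
  qed
  ultimately have "(\<lambda>n. pair_mean n (x n) g) \<longlonglongrightarrow> sc_mean g" by simp
  then have lim: "\<forall>\<^sub>F n in sequentially. dist (pair_mean n (x n) g) (sc_mean g) < e / 4"
    using e by (intro tendstoD) auto
  have sc: "\<bar>sc_mean f - sc_mean g\<bar> \<le> e / 4"
  proof -
    note i = sc_integrable_continuous[OF f] sc_integrable_continuous[OF cont_g]
    have "sc_mean f - sc_mean g = integral\<^sup>L scpair (\<lambda>z. f (fst z - snd z) - g (fst z - snd z))"
      unfolding sc_mean_def using i by simp
    also have "\<bar>\<dots>\<bar> \<le> integral\<^sup>L scpair (\<lambda>z. \<bar>f (fst z - snd z) - g (fst z - snd z)\<bar>)"
      by (rule integral_abs_bound)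
    also have "\<dots> \<le> integral\<^sup>L scpair (\<lambda>z. e / 4)"
    proof (rule integral_mono_AE)
      show "AE z in scpair. \<bar>f (fst z - snd z) - g (fst z - snd z)\<bar> \<le> e / 4"
        using AE_scpair_bounded
      proof eventually_elim
        case (elim z)
        then have "fst z - snd z \<in> {-2 * R'..2 * R'}" by (auto simp: R'_def abs_le_iff)
        from fg[OF this] show ?case by simp
      qed
    qed (use i in auto)
    finally show ?thesis using scp.P.prob_space by simp
  qed
  show "\<forall>\<^sub>F n in sequentially. dist (pair_mean n (x n) f) (sc_mean f) < e"
    using lim R eventually_gt_at_top[of 0]
  proof eventually_elim
    case (elim n)
    have "\<bar>f (x n i - x n j) - g (x n i - x n j)\<bar> \<le> e / 4" if "i < n" "j < n" for i j
    proof -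
      have "\<bar>x n i\<bar> \<le> R'" "\<bar>x n j\<bar> \<le> R'" using elim(2) that by (auto simp: R'_def max_def)
      then have "x n i - x n j \<in> {-2 * R'..2 * R'}" by auto
      from fg[OF this] show ?thesis by simp
    qed
    then have "(\<Sum>i<n. \<Sum>j<n. \<bar>f (x n i - x n j) - g (x n i - x n j)\<bar>) \<le> (\<Sum>i<n. \<Sum>j<n. e / 4)"
      by (intro sum_mono) auto
    moreover have "(\<Sum>i<n. \<Sum>j<n. e / 4) = e / 4 * (real n)\<^sup>2" by (simp add: power2_eq_square)
    moreover have "\<bar>\<Sum>i<n. \<Sum>j<n. f (x n i - x n j) - g (x n i - x n j)\<bar> \<le> (\<Sum>i<n. \<Sum>j<n. \<bar>f (x n i - x n j) - g (x n i - x n j)\<bar>)"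
      by (rule order.trans[OF sum_abs]) (intro sum_mono sum_abs)
    ultimately have "\<bar>(\<Sum>i<n. \<Sum>j<n. f (x n i - x n j)) - (\<Sum>i<n. \<Sum>j<n. g (x n i - x n j))\<bar> \<le> e / 4 * (real n)\<^sup>2"
      unfolding sum_subtractf by linarith
    then have "\<bar>(\<Sum>i<n. \<Sum>j<n. f (x n i - x n j)) - (\<Sum>i<n. \<Sum>j<n. g (x n i - x n j))\<bar> / (real n)\<^sup>2 \<le> e / 4"
      using elim(3) by (simp add: divide_le_eq)
    then have "\<bar>pair_mean n (x n) f - pair_mean n (x n) g\<bar> \<le> e / 4"
      by (simp add: pair_mean_def diff_divide_distrib[symmetric] abs_divide)
    with elim(1) sc e show ?case unfolding dist_real_def by linarith
  qed
qed

text \<open>Off the diagonal the cap only lowers the function, and the n diagonal terms cost L / n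
  in total. The rest is the interaction part of the energy, obtained by subtracting half of the
  second moment.\<close>

lemma pair_mean_trunc_log_le:
  assumes n: "n \<ge> 2" and inj: "inj_on x {..<n}"
  shows "pair_mean n x (trunc_log L) \<le> L / real n + (real n - 1) / real n * (discrete_energy n x - emp_moment n x 2 / 2)"
proof -
  have ne: "x j \<noteq> x k" if "k < n" "j < k" for j k using inj_onD[OF inj, of j k] that by auto
  have sym: "trunc_log L (x j - x k) = trunc_log L (x k - x j)" for j k
    by (simp add: trunc_log_def abs_minus_commute)
  have "2 * (\<Sum>k<n. \<Sum>j<k. trunc_log L (x j - x k)) \<le> 2 * (\<Sum>k<n. \<Sum>j<k. - ln \<bar>x j - x k\<bar>)"
    using ne by (intro mult_left_mono sum_mono) (auto simp: trunc_log_eq)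
  moreover have "(\<Sum>j<n. trunc_log L (x j - x j)) = L * real n" by (simp add: trunc_log_def)
  moreover have "2 * (\<Sum>k<n. \<Sum>j<k. trunc_log L (x j - x k)) =
      (\<Sum>j<n. \<Sum>k<n. trunc_log L (x j - x k)) - (\<Sum>j<n. trunc_log L (x j - x j))"
    by (rule sum_triangle_symmetric) (rule sym)
  moreover have "2 * (\<Sum>k<n. \<Sum>j<k. - ln \<bar>x j - x k\<bar>) = - 2 * (\<Sum>k<n. \<Sum>j<k. ln \<bar>x j - x k\<bar>)"
    by (simp add: sum_negf)
  ultimately have "(\<Sum>j<n. \<Sum>k<n. trunc_log L (x j - x k)) \<le> L * real n - 2 * (\<Sum>k<n. \<Sum>j<k. ln \<bar>x j - x k\<bar>)"
    by linarith
  then have "pair_mean n x (trunc_log L) \<le> (L * real n - 2 * (\<Sum>k<n. \<Sum>j<k. ln \<bar>x j - x k\<bar>)) / (real n)\<^sup>2"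
    unfolding pair_mean_def by (rule divide_right_mono) simp
  also have "\<dots> = L / real n + (real n - 1) / real n * (discrete_energy n x - emp_moment n x 2 / 2)"
  proof -
    have eq: "(L * N - 2 * S) / N\<^sup>2 = L / N + D / N * (1 / (2 * N) * T - 2 / (N * D) * S - T / N / 2)"
      if "N \<noteq> 0" "D \<noteq> 0" for N D S T :: real
      using that by (simp add: field_simps power2_eq_square)
    show ?thesis unfolding discrete_energy_def emp_moment_def by (rule eq) (use n in auto)
  qed
  finally show ?thesis .
qed

lemma sc_moment_2: "sc_moment 2 = 1"
  using sc_moment_Suc[of 1] by (simp add: sc_moment_0 numeral_2_eq_2)

lemma measurable_neg_part_log [measurable]: "neg_part_log \<in> borel_measurable borel"
proof -
  have "(\<lambda>r::real. if r = 0 then \<infinity> else ennreal (- ln r)) \<in> borel_measurable borel" by measurable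
  then show ?thesis by (simp add: neg_part_log_def[abs_def])
qed

text \<open>Away from 0 the sequence is eventually constant; at 0 it grows like m, which matches the
  infinite value of \<open>neg_part_log\<close>.\<close>

lemma trunc_log_tendsto:
  "(\<lambda>m. ennreal (trunc_log (real m) r + max 0 (ln \<bar>r\<bar>))) \<longlonglongrightarrow> neg_part_log \<bar>r\<bar>"
proof (cases "r = 0")
  case True
  have "(\<lambda>m. ennreal (real m)) \<longlonglongrightarrow> \<infinity>"
    using of_nat_tendsto_top_ennreal by (simp add: ennreal_of_nat_eq_real_of_nat)
  then show ?thesis using True by (simp add: trunc_log_def neg_part_log_def)
next
  case False
  obtain M :: nat where M: "- ln \<bar>r\<bar> \<le> real M" using real_arch_simple by blast
  have "\<forall>\<^sub>F m in sequentially. neg_part_log \<bar>r\<bar> = ennreal (trunc_log (real m) r + max 0 (ln \<bar>r\<bar>))"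
    using eventually_ge_at_top[of M]
  proof eventually_elim
    case (elim m)
    then have "- ln \<bar>r\<bar> \<le> real m" using M by linarith
    then have "trunc_log (real m) r = - ln \<bar>r\<bar>" using False by (simp add: trunc_log_eq)
    then show ?case using False by (simp add: neg_part_log_def max_def ennreal_neg)
  qed
  from Lim_transform_eventually[OF tendsto_const this] show ?thesis .
qed

text \<open>The deterministic situation that almost every outcome satisfies; both the weak limit and
  the energy of the semicircle law follow from it alone.\<close>

locale asymptotic_fekete =
  fixes x :: "nat \<Rightarrow> nat \<Rightarrow> real" and R :: real
  assumes energy: "(\<lambda>n. discrete_energy n (x n)) \<longlonglongrightarrow> 3 / 4"
    and inj: "\<forall>\<^sub>F n in sequentially. inj_on (x n) {..<n}"
    and bounded: "\<forall>\<^sub>F n in sequentially. \<forall>i<n. \<bar>x n i\<bar> \<le> R"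
begin

lemma moments: "(\<lambda>n. emp_moment n (x n) k) \<longlonglongrightarrow> sc_moment k"
  using energy inj bounded sc_moment_0 sc_moment_Suc by (rule emp_moments_converge)

lemma sc_mean_trunc_log_le: "sc_mean (trunc_log L) \<le> 1 / 4"
proof (rule tendsto_le[OF sequentially_bot])
  show "(\<lambda>n. pair_mean n (x n) (trunc_log L)) \<longlonglongrightarrow> sc_mean (trunc_log L)"
    by (rule pair_mean_limit[OF moments bounded continuous_trunc_log])
  have "(\<lambda>n. L / real n) \<longlonglongrightarrow> 0" "(\<lambda>n. (real n - 1) / real n) \<longlonglongrightarrow> 1" by real_asymp+
  then have "(\<lambda>n. L / real n + (real n - 1) / real n * (discrete_energy n (x n) - emp_moment n (x n) 2 / 2))
      \<longlonglongrightarrow> 0 + 1 * (3 / 4 - sc_moment 2 / 2)"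
    by (intro tendsto_intros energy moments) auto
  then show "(\<lambda>n. L / real n + (real n - 1) / real n * (discrete_energy n (x n) - emp_moment n (x n) 2 / 2)) \<longlonglongrightarrow> 1 / 4"
    by (simp add: sc_moment_2)
  show "\<forall>\<^sub>F n in sequentially. pair_mean n (x n) (trunc_log L)
      \<le> L / real n + (real n - 1) / real n * (discrete_energy n (x n) - emp_moment n (x n) 2 / 2)"
    using inj eventually_ge_at_top[of 2] by eventually_elim (rule pair_mean_trunc_log_le)
qed

end

lemma sc_pos_log_integrable: "integrable scpair (\<lambda>z. max 0 (ln \<bar>fst z - snd z\<bar>))"
proof (rule sc_integrable_bounded[where f = "\<lambda>r. max 0 (ln \<bar>r\<bar>)" and B = "ln 4"])
  fix r :: real assume "\<bar>r\<bar> \<le> 4"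
  then show "\<bar>max 0 (ln \<bar>r\<bar>)\<bar> \<le> ln 4" by (cases "r = 0") auto
qed measurable

text \<open>Fatou's lemma over the truncation levels. The positive part of the logarithm is added to
  make the integrands nonnegative; its integral is finite because distances in the support are at
  most 4.\<close>

lemma (in asymptotic_fekete) sc_neg_log_le:
  "(\<integral>\<^sup>+ z. neg_part_log \<bar>fst z - snd z\<bar> \<partial>scpair) \<le> ennreal (1 / 4 + integral\<^sup>L scpair (\<lambda>z. max 0 (ln \<bar>fst z - snd z\<bar>)))"
proof -
  let ?u = "\<lambda>m z. ennreal (trunc_log (real m) (fst z - snd z) + max 0 (ln \<bar>fst z - snd z\<bar>))"
  have tm [measurable]: "trunc_log L \<in> borel_measurable borel" for L
    by (rule borel_measurable_continuous_onI[OF continuous_trunc_log])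
  have "(\<integral>\<^sup>+ z. neg_part_log \<bar>fst z - snd z\<bar> \<partial>scpair) = (\<integral>\<^sup>+ z. liminf (\<lambda>m. ?u m z) \<partial>scpair)"
    by (intro nn_integral_cong) (simp add: lim_imp_Liminf[OF _ trunc_log_tendsto])
  also have "\<dots> \<le> liminf (\<lambda>m. \<integral>\<^sup>+ z. ?u m z \<partial>scpair)"
    by (rule nn_integral_liminf) measurable
  also have "\<dots> \<le> liminf (\<lambda>m. ennreal (1 / 4 + integral\<^sup>L scpair (\<lambda>z. max 0 (ln \<bar>fst z - snd z\<bar>))))"
  proof (intro Liminf_mono always_eventually allI)
    fix m
    have i: "integrable scpair (\<lambda>z. trunc_log (real m) (fst z - snd z))"
      by (rule sc_integrable_continuous[OF continuous_trunc_log])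
    have nn: "0 \<le> trunc_log (real m) r + max 0 (ln \<bar>r\<bar>)" for r
      by (auto simp: trunc_log_eq)
    have "(\<integral>\<^sup>+ z. ?u m z \<partial>scpair) = ennreal (integral\<^sup>L scpair (\<lambda>z. trunc_log (real m) (fst z - snd z) + max 0 (ln \<bar>fst z - snd z\<bar>)))"
      using i sc_pos_log_integrable nn by (intro nn_integral_eq_integral) auto
    also have "integral\<^sup>L scpair (\<lambda>z. trunc_log (real m) (fst z - snd z) + max 0 (ln \<bar>fst z - snd z\<bar>)) =
        sc_mean (trunc_log (real m)) + integral\<^sup>L scpair (\<lambda>z. max 0 (ln \<bar>fst z - snd z\<bar>))"
      unfolding sc_mean_def using i sc_pos_log_integrable by simp
    also have "ennreal \<dots> \<le> ennreal (1 / 4 + integral\<^sup>L scpair (\<lambda>z. max 0 (ln \<bar>fst z - snd z\<bar>)))"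
      using sc_mean_trunc_log_le by (intro ennreal_leI) simp
    finally show "(\<integral>\<^sup>+ z. ?u m z \<partial>scpair) \<le> ennreal (1 / 4 + integral\<^sup>L scpair (\<lambda>z. max 0 (ln \<bar>fst z - snd z\<bar>)))" .
  qed
  finally show ?thesis by (simp add: Liminf_const)
qed

section \<open>Lower bound for the energy by averaging over independent points\<close>

lemma PiM_pair_distr:
  assumes "prob_space N" "j \<in> I" "k \<in> I" "j \<noteq> k"
  shows "distr (PiM I (\<lambda>_. N)) (N \<Otimes>\<^sub>M N) (\<lambda>\<omega>. (\<omega> j, \<omega> k)) = N \<Otimes>\<^sub>M N"
proof -
  interpret N: prob_space N by fact
  interpret P: product_prob_space "\<lambda>_. N" I ..
  show ?thesis
  proof (rule pair_measure_eqI[symmetric])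
    fix A B assume AB: "A \<in> sets N" "B \<in> sets N"
    have m: "(\<lambda>\<omega>. (\<omega> j, \<omega> k)) \<in> PiM I (\<lambda>_. N) \<rightarrow>\<^sub>M N \<Otimes>\<^sub>M N" using assms by measurable
    have "emeasure (distr (PiM I (\<lambda>_. N)) (N \<Otimes>\<^sub>M N) (\<lambda>\<omega>. (\<omega> j, \<omega> k))) (A \<times> B) =
        emeasure (PiM I (\<lambda>_. N)) ((\<lambda>\<omega>. (\<omega> j, \<omega> k)) -` (A \<times> B) \<inter> space (PiM I (\<lambda>_. N)))"
      using AB by (intro emeasure_distr m) auto
    also have "(\<lambda>\<omega>. (\<omega> j, \<omega> k)) -` (A \<times> B) \<inter> space (PiM I (\<lambda>_. N)) =
        {\<omega> \<in> space (PiM I (\<lambda>_. N)). \<forall>i\<in>{j, k}. \<omega> i \<in> (if i = j then A else B)}"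
      using assms by auto
    also have "emeasure (PiM I (\<lambda>_. N)) \<dots> = (\<Prod>i\<in>{j, k}. emeasure N (if i = j then A else B))"
      using AB assms by (intro P.emeasure_PiM_Collect) auto
    also have "\<dots> = emeasure N A * emeasure N B" using assms by simp
    finally show "emeasure N A * emeasure N B = emeasure (distr (PiM I (\<lambda>_. N)) (N \<Otimes>\<^sub>M N) (\<lambda>\<omega>. (\<omega> j, \<omega> k))) (A \<times> B)" ..
  qed (use N.sigma_finite_measure_axioms in auto)
qed

text \<open>For n independent semicircular points the second moments are 1 and each of the n (n - 1)
  / 2 pairs has the same expected logarithm, so the expected discrete energy is the left-hand side
  for every n. Almost surely the points are distinct and the universal bound applies.\<close>

lemma sc_log_energy_ge_fekete:
  assumes int: "integrable scpair (\<lambda>z. ln \<bar>fst z - snd z\<bar>)"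
    and ne: "AE z in scpair. fst z \<noteq> snd z" and n: "n \<ge> 2"
  shows "1 / 2 - integral\<^sup>L scpair (\<lambda>z. ln \<bar>fst z - snd z\<bar>) \<ge> fekete_bound n"
proof -
  define Q where "Q = PiM {..<n} (\<lambda>_. semicircle_law)"
  interpret Q: prob_space Q unfolding Q_def by (intro prob_space_PiM sc.prob_space_axioms)
  define T where "T = integral\<^sup>L scpair (\<lambda>z. ln \<bar>fst z - snd z\<bar>)"
  have D: "distr Q scpair (\<lambda>\<omega>. (\<omega> j, \<omega> k)) = scpair" if "j < n" "k < n" "j \<noteq> k" for j k
    unfolding Q_def by (rule PiM_pair_distr[OF sc.prob_space_axioms]) (use that in auto)
  have m: "(\<lambda>\<omega>. (\<omega> j, \<omega> k)) \<in> Q \<rightarrow>\<^sub>M scpair" if "j < n" "k < n" for j k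
    unfolding Q_def using that by (intro measurable_Pair measurable_component_singleton) auto
  have lm: "(\<lambda>z. ln \<bar>fst z - snd z\<bar>) \<in> borel_measurable scpair" using int by (rule borel_measurable_integrable)
  have L: "integrable Q (\<lambda>\<omega>. ln \<bar>\<omega> j - \<omega> k\<bar>)" "integral\<^sup>L Q (\<lambda>\<omega>. ln \<bar>\<omega> j - \<omega> k\<bar>) = T"
    if "j < n" "k < n" "j \<noteq> k" for j k
    using integrable_distr_eq[OF m[OF that(1,2)] lm] integral_distr[OF m[OF that(1,2)] lm] int
    by (simp_all add: D[OF that] T_def)
  have D1: "distr Q semicircle_law (\<lambda>\<omega>. \<omega> k) = semicircle_law" if "k < n" for k
    unfolding Q_def by (rule distr_PiM_component) (use that sc.prob_space_axioms in auto)
  have m1: "(\<lambda>\<omega>. \<omega> k) \<in> Q \<rightarrow>\<^sub>M semicircle_law" if "k < n" for k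
    unfolding Q_def using that by (intro measurable_component_singleton) auto
  have S: "integrable Q (\<lambda>\<omega>. (\<omega> k)\<^sup>2)" "integral\<^sup>L Q (\<lambda>\<omega>. (\<omega> k)\<^sup>2) = 1" if "k < n" for k
    using integrable_distr_eq[OF m1[OF that], of "\<lambda>x. x\<^sup>2"] integral_distr[OF m1[OF that], of "\<lambda>x. x\<^sup>2"]
      semicircle_moment[of 2] by (simp_all add: D1[OF that] sc_moment_2)
  have "AE \<omega> in Q. \<forall>j\<in>{..<n}. \<forall>k\<in>{..<n}. j \<noteq> k \<longrightarrow> \<omega> j \<noteq> \<omega> k"
  proof (intro AE_finite_allI finite_lessThan)
    fix j k assume jk: "j \<in> {..<n}" "k \<in> {..<n}"
    show "AE \<omega> in Q. j \<noteq> k \<longrightarrow> \<omega> j \<noteq> \<omega> k"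
    proof (cases "j = k")
      case False
      have "AE z in distr Q scpair (\<lambda>\<omega>. (\<omega> j, \<omega> k)). fst z \<noteq> snd z"
        by (subst D) (use jk False ne in auto)
      from AE_distrD[OF _ this] m[of j k] jk show ?thesis by simp
    qed simp
  qed
  then have "AE \<omega> in Q. fekete_bound n \<le> discrete_energy n \<omega>"
  proof eventually_elim
    case (elim \<omega>)
    then have "inj_on \<omega> {..<n}" by (auto simp: inj_on_def)
    then show ?case by (rule discrete_energy_ge_fekete[OF n])
  qed
  moreover have i1: "integrable Q (\<lambda>\<omega>. \<Sum>k<n. (\<omega> k)\<^sup>2)" using S by (intro Bochner_Integration.integrable_sum) auto
  moreover have i2: "integrable Q (\<lambda>\<omega>. \<Sum>k<n. \<Sum>j<k. ln \<bar>\<omega> j - \<omega> k\<bar>)"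
    using L by (intro Bochner_Integration.integrable_sum) auto
  ultimately have "fekete_bound n \<le> integral\<^sup>L Q (\<lambda>\<omega>. discrete_energy n \<omega>)"
    unfolding discrete_energy_def
    using integral_mono_AE[of Q "\<lambda>_. fekete_bound n" "\<lambda>\<omega>. discrete_energy n \<omega>"] Q.prob_space
    by (simp add: discrete_energy_def)
  also have "\<dots> = 1 / (2 * real n) * integral\<^sup>L Q (\<lambda>\<omega>. \<Sum>k<n. (\<omega> k)\<^sup>2)
      - 2 / (real n * (real n - 1)) * integral\<^sup>L Q (\<lambda>\<omega>. \<Sum>k<n. \<Sum>j<k. ln \<bar>\<omega> j - \<omega> k\<bar>)"
    unfolding discrete_energy_def using i1 i2 by (subst Bochner_Integration.integral_diff) auto
  also have "integral\<^sup>L Q (\<lambda>\<omega>. \<Sum>k<n. (\<omega> k)\<^sup>2) = (\<Sum>k<n. 1)"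
    using S by (subst Bochner_Integration.integral_sum) auto
  also have "integral\<^sup>L Q (\<lambda>\<omega>. \<Sum>k<n. \<Sum>j<k. ln \<bar>\<omega> j - \<omega> k\<bar>) = (\<Sum>k<n. \<Sum>j<k. T)"
  proof -
    have "integral\<^sup>L Q (\<lambda>\<omega>. \<Sum>k<n. \<Sum>j<k. ln \<bar>\<omega> j - \<omega> k\<bar>) = (\<Sum>k<n. integral\<^sup>L Q (\<lambda>\<omega>. \<Sum>j<k. ln \<bar>\<omega> j - \<omega> k\<bar>))"
      using L by (intro Bochner_Integration.integral_sum Bochner_Integration.integrable_sum) auto
    also have "\<dots> = (\<Sum>k<n. \<Sum>j<k. integral\<^sup>L Q (\<lambda>\<omega>. ln \<bar>\<omega> j - \<omega> k\<bar>))"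
      using L by (intro sum.cong refl Bochner_Integration.integral_sum) auto
    also have "\<dots> = (\<Sum>k<n. \<Sum>j<k. T)" using L by (intro sum.cong) auto
    finally show ?thesis .
  qed
  also have "(\<Sum>k<n. \<Sum>j<k. T) = real n * (real n - 1) / 2 * T"
    by (induction n) (auto simp: field_simps)
  finally show ?thesis using n unfolding T_def[symmetric] by simp
qed

text \<open>The order matters: the truncated upper bound first shows that the logarithm is
  integrable and the diagonal is null, and only then can the lower bound be averaged. Together they
  pin the difference of the two logarithmic integrals.\<close>

lemma (in asymptotic_fekete) energy_semicircle: "energy semicircle_law = ereal (3 / 4)"
proof -
  define Pos where "Pos = integral\<^sup>L scpair (\<lambda>z. max 0 (ln \<bar>fst z - snd z\<bar>))"
  define N where "N = (\<integral>\<^sup>+ z. neg_part_log \<bar>fst z - snd z\<bar> \<partial>scpair)"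
  have Pos0: "Pos \<ge> 0" unfolding Pos_def by (intro integral_nonneg_AE) auto
  have N_le: "N \<le> ennreal (1 / 4 + Pos)" unfolding N_def Pos_def by (rule sc_neg_log_le)
  then have N_fin: "N \<noteq> \<infinity>" by (auto simp: top_unique)
  obtain r where r: "N = ennreal r" "r \<ge> 0" using N_fin by (cases N) auto
  have r_le: "r \<le> 1 / 4 + Pos" using N_le Pos0 unfolding r(1) by (subst (asm) ennreal_le_iff) auto
  have "AE z in scpair. neg_part_log \<bar>fst z - snd z\<bar> \<noteq> \<infinity>"
  proof (rule nn_integral_PInf_AE)
    show "(\<integral>\<^sup>+ z. neg_part_log \<bar>fst z - snd z\<bar> \<partial>scpair) \<noteq> \<infinity>" using N_fin by (simp add: N_def)
  qed measurable
  \<comment> \<open>\<open>neg_part_log 0\<close> is infinite, so a finite integral leaves no mass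
    on the diagonal.\<close>
  then have ne: "AE z in scpair. fst z \<noteq> snd z"
    by eventually_elim (auto simp: neg_part_log_def)
  have P: "(\<integral>\<^sup>+ z. ennreal (ln \<bar>fst z - snd z\<bar>) \<partial>scpair) = ennreal Pos"
  proof -
    have "(\<integral>\<^sup>+ z. ennreal (ln \<bar>fst z - snd z\<bar>) \<partial>scpair) = (\<integral>\<^sup>+ z. ennreal (max 0 (ln \<bar>fst z - snd z\<bar>)) \<partial>scpair)"
      by (intro nn_integral_cong) (simp add: max_def ennreal_neg)
    also have "\<dots> = ennreal Pos" unfolding Pos_def
      by (intro nn_integral_eq_integral sc_pos_log_integrable) auto
    finally show ?thesis .
  qed
  have Nn: "(\<integral>\<^sup>+ z. ennreal (- ln \<bar>fst z - snd z\<bar>) \<partial>scpair) = ennreal r"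
    unfolding r(1)[symmetric] N_def
    by (rule nn_integral_cong_AE) (use ne in \<open>eventually_elim, simp add: neg_part_log_def\<close>)
  have int: "integrable scpair (\<lambda>z. ln \<bar>fst z - snd z\<bar>)"
    unfolding real_integrable_def using P Nn by auto
  have T: "integral\<^sup>L scpair (\<lambda>z. ln \<bar>fst z - snd z\<bar>) = Pos - r"
    unfolding real_lebesgue_integral_def[OF int] P Nn using Pos0 r by simp
  have "3 / 4 \<le> 1 / 2 - (Pos - r)"
  proof (rule tendsto_upperbound[OF fekete_bound_limit])
    show "\<forall>\<^sub>F n in sequentially. fekete_bound n \<le> 1 / 2 - (Pos - r)"
      using eventually_ge_at_top[of 2]
      by eventually_elim (use sc_log_energy_ge_fekete[OF int ne] T in auto)
  qed simp
  with r_le have eq: "1 / 2 + r - Pos = 3 / 4" by simp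
  have E1: "(\<integral>\<^sup>+ x. ennreal (x\<^sup>2) \<partial>semicircle_law) = ennreal 1"
    using semicircle_moment[of 2] by (subst nn_integral_eq_integral) (auto simp: sc_moment_2)
  have E2: "(\<integral>\<^sup>+ x. (\<integral>\<^sup>+ y. neg_part_log \<bar>x - y\<bar> \<partial>semicircle_law) \<partial>semicircle_law) = ennreal r"
    unfolding r(1)[symmetric] N_def by (subst sc.nn_integral_fst[symmetric]) auto
  have E3: "(\<integral>\<^sup>+ x. (\<integral>\<^sup>+ y. ennreal (ln \<bar>x - y\<bar>) \<partial>semicircle_law) \<partial>semicircle_law) = ennreal Pos"
    unfolding P[symmetric] by (subst sc.nn_integral_fst[symmetric]) auto
  show ?thesis
    unfolding energy_def E1 E2 E3 using r(2) Pos0 eq by (simp add: enn2ereal_ennreal del: ennreal_1)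
qed

section \<open>Almost sure convergence\<close>

text \<open>Division by sqrt (\<beta> n) turns the tolerances into the hypotheses of
  \<open>discrete_energy_jacobi_le\<close> with \<alpha> = \<kappa> / \<beta>, and bounds the
  squared superdiagonal entries by 1 + \<kappa>.\<close>

lemma entries_good_spectrum:
  assumes X: "X \<in> carrier_mat n n" "\<And>i j. i < n \<Longrightarrow> j < n \<Longrightarrow> X $$ (j, i) = X $$ (i, j)"
      "\<And>i j. i < n \<Longrightarrow> j < n \<Longrightarrow> Suc i < j \<Longrightarrow> X $$ (i, j) = 0"
    and good: "entries_good \<beta> \<kappa> n X" and n: "n \<ge> 2" and \<beta>: "\<beta> > 0" and \<kappa>: "\<kappa> > 0"
  defines "x \<equiv> \<lambda>i. eigenvalue_list ((1 / sqrt (\<beta> * real n)) \<cdot>\<^sub>m X) ! i"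
  shows "inj_on x {..<n}"
    and "i < n \<Longrightarrow> \<bar>x i\<bar> \<le> sqrt (\<kappa> / \<beta>) + 2 * sqrt (1 + \<kappa>)"
    and "discrete_energy n x \<le> 1 / 2 - xlogx_mean n (real n) + \<kappa> / \<beta> / 2 + 2 * \<kappa>"
proof -
  let ?A = "(1 / sqrt (\<beta> * real n)) \<cdot>\<^sub>m X"
  define s where "s = sqrt (\<beta> * real n)"
  have s: "s > 0" "s\<^sup>2 = \<beta> * real n" using \<beta> n by (auto simp: s_def)
  have A: "?A $$ (i, j) = X $$ (i, j) / s" if "i < n" "j < n" for i j
    using X(1) that by (simp add: s_def)
  define a where "a i = ?A $$ (i, i)" for i
  define b where "b i = ?A $$ (i, Suc i)" for i
  have lo: "real (n - Suc i) / real n * exp (- \<kappa> * real n / real (n - Suc i)) \<le> (b i)\<^sup>2"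
    and bpos: "b i > 0" and up: "(b i)\<^sup>2 \<le> real (n - Suc i) / real n + \<kappa>" if i: "Suc i < n" for i
  proof -
    have b: "b i = X $$ (i, Suc i) / s" using A[of i "Suc i"] i by (simp add: b_def)
    have l: "sqrt (\<beta> * real (n - Suc i)) * exp (- \<kappa> * n / (2 * real (n - Suc i))) \<le> X $$ (i, Suc i)"
      and u: "X $$ (i, Suc i) \<le> sqrt (\<beta> * real (n - Suc i) + \<kappa> * \<beta> * n)"
      using good i by (auto simp: entries_good_def)
    have l0: "sqrt (\<beta> * real (n - Suc i)) * exp (- \<kappa> * n / (2 * real (n - Suc i))) > 0"
      using i \<beta> by simp
    then have pos: "X $$ (i, Suc i) > 0" using l by linarith
    then show "b i > 0" using s by (simp add: b)
    have "(sqrt (\<beta> * real (n - Suc i)) * exp (- \<kappa> * n / (2 * real (n - Suc i))))\<^sup>2 \<le> (X $$ (i, Suc i))\<^sup>2"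
      using l l0 by (intro power_mono) auto
    also have "(sqrt (\<beta> * real (n - Suc i)) * exp (- \<kappa> * n / (2 * real (n - Suc i))))\<^sup>2
        = \<beta> * real (n - Suc i) * exp (- \<kappa> * real n / real (n - Suc i))"
    proof -
      have e: "(exp (- \<kappa> * n / (2 * y)))\<^sup>2 = exp (- \<kappa> * n / y)" for y :: real
        by (simp add: exp_double[symmetric])
      show ?thesis unfolding power_mult_distrib e using \<beta> by simp
    qed
    finally show "real (n - Suc i) / real n * exp (- \<kappa> * real n / real (n - Suc i)) \<le> (b i)\<^sup>2"
      unfolding b power_divide s(2) using \<beta> n by (simp add: field_simps)
    have "(X $$ (i, Suc i))\<^sup>2 \<le> (sqrt (\<beta> * real (n - Suc i) + \<kappa> * \<beta> * n))\<^sup>2"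
      using u pos by (intro power_mono) auto
    also have "\<dots> = \<beta> * real (n - Suc i) + \<kappa> * \<beta> * n" using \<beta> \<kappa> by simp
    finally show "(b i)\<^sup>2 \<le> real (n - Suc i) / real n + \<kappa>"
      unfolding b power_divide s(2) using \<beta> n by (simp add: field_simps)
  qed
  have asq: "(a i)\<^sup>2 \<le> \<kappa> / \<beta>" if "i < n" for i
  proof -
    have "(X $$ (i, i))\<^sup>2 \<le> \<kappa> * n" using good that by (auto simp: entries_good_def)
    then show ?thesis unfolding a_def A[OF that that] power_divide s(2) using \<beta> n by (simp add: field_simps)
  qed
  have car: "?A \<in> carrier_mat n n" using X(1) by simp
  have symA: "?A $$ (j, i) = ?A $$ (i, j)" if "i < n" "j < n" for i j using A X(2) that by simp
  have triA: "?A $$ (i, j) = 0" if "i < n" "j < n" "Suc i < j" for i j using A X(3) that by simp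
  have neA: "?A $$ (i, Suc i) \<noteq> 0" if "Suc i < n" for i using bpos[OF that] by (simp add: b_def)
  show inj: "inj_on x {..<n}" unfolding x_def by (rule eigenvalue_list_tridiagonal(1)[OF car symA triA neA])
  have root: "poly (jacobi_poly a (\<lambda>i. (b i)\<^sup>2) n) (x i) = 0" if "i < n" for i
    unfolding x_def a_def b_def by (rule eigenvalue_list_tridiagonal(2)[OF car symA triA neA that])
  show "\<bar>x i\<bar> \<le> sqrt (\<kappa> / \<beta>) + 2 * sqrt (1 + \<kappa>)" if "i < n"
  proof (rule jacobi_root_bound[of n b a])
    show "b i \<noteq> 0" if "Suc i < n" for i using bpos[OF that] by simp
    show "\<bar>a i\<bar> \<le> sqrt (\<kappa> / \<beta>)" if "i < n" for i using asq[OF that] by (intro real_le_rsqrt) simp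
    show "\<bar>b i\<bar> \<le> sqrt (1 + \<kappa>)" if "Suc i < n" for i
    proof (rule real_le_rsqrt)
      have "real (n - Suc i) / real n \<le> 1" using n by simp
      then show "\<bar>b i\<bar>\<^sup>2 \<le> 1 + \<kappa>" using up[OF that] by simp
    qed
  qed (use n \<kappa> root that in auto)
  show "discrete_energy n x \<le> 1 / 2 - xlogx_mean n (real n) + \<kappa> / \<beta> / 2 + 2 * \<kappa>"
    by (rule discrete_energy_jacobi_le[OF n inj root asq]) (use lo up \<kappa> in auto)
qed

lemma empirical_moment:
  assumes "n > 0"
  shows "real_distribution (empirical_measure n x)"
    and "integral\<^sup>L (empirical_measure n x) (\<lambda>y. y ^ k) = emp_moment n x k"
    and "(\<And>i. i < n \<Longrightarrow> \<bar>x i\<bar> \<le> R) \<Longrightarrow> AE y in empirical_measure n x. \<bar>y\<bar> \<le> R"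
proof -
  interpret U: prob_space "uniform_count_measure {..<n}"
    using assms by (intro prob_space_uniform_count_measure) auto
  have m: "x \<in> borel_measurable (uniform_count_measure {..<n})" by simp
  show "real_distribution (empirical_measure n x)"
    unfolding empirical_measure_def by (rule U.real_distribution_distr[OF m])
  show "integral\<^sup>L (empirical_measure n x) (\<lambda>y. y ^ k) = emp_moment n x k"
    unfolding empirical_measure_def emp_moment_def
    by (subst integral_distr[OF m]) (auto simp: integral_uniform_count_measure)
  show "AE y in empirical_measure n x. \<bar>y\<bar> \<le> R" if "\<And>i. i < n \<Longrightarrow> \<bar>x i\<bar> \<le> R"
    unfolding empirical_measure_def
  proof (subst AE_distr_iff[OF m])
    show "AE i in uniform_count_measure {..<n}. \<bar>x i\<bar> \<le> R" using that by (intro AE_I2) (auto simp: space_uniform_count_measure)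
  qed measurable
qed

lemma (in asymptotic_fekete) empirical_weak_conv:
  "weak_conv_m (\<lambda>n. empirical_measure n (x n)) semicircle_law"
proof -
  define R' where "R' = max 2 R"
  define ok where "ok n \<longleftrightarrow> n > 0 \<and> (\<forall>i<n. \<bar>x n i\<bar> \<le> R)" for n
  \<comment> \<open>For finitely many n the points may be unbounded or absent; replacing those
    measures by the semicircle law gives uniform support without affecting the limit.\<close>
  define \<mu> where "\<mu> n = (if ok n then empirical_measure n (x n) else semicircle_law)" for n
  have ok: "\<forall>\<^sub>F n in sequentially. ok n"
    using bounded eventually_gt_at_top[of 0] by eventually_elim (simp add: ok_def)
  have "weak_conv_m \<mu> semicircle_law"
  proof (rule moments_imp_weak_conv)
    show "real_distribution (\<mu> n)" for n
      using real_distribution_semicircle empirical_moment(1) by (auto simp: \<mu>_def ok_def)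
    show "AE y in semicircle_law. \<bar>y\<bar> \<le> R'"
      using AE_semicircle_bounded by eventually_elim (simp add: R'_def)
    then show "AE y in \<mu> n. \<bar>y\<bar> \<le> R'" for n
    proof (cases "ok n")
      case True
      have "AE y in empirical_measure n (x n). \<bar>y\<bar> \<le> R'"
        by (rule empirical_moment(3)) (use True in \<open>auto simp: ok_def R'_def le_max_iff_disj\<close>)
      moreover have "\<mu> n = empirical_measure n (x n)" using True by (simp add: \<mu>_def)
      ultimately show ?thesis by (simp only:)
    next
      case False
      then have "\<mu> n = semicircle_law" by (simp add: \<mu>_def)
      then show ?thesis using \<open>AE y in semicircle_law. \<bar>y\<bar> \<le> R'\<close> by (simp only:)
    qed
    have "\<forall>\<^sub>F n in sequentially. emp_moment n (x n) k = integral\<^sup>L (\<mu> n) (\<lambda>y. y ^ k)" for k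
      using ok by eventually_elim (auto simp: \<mu>_def ok_def empirical_moment(2))
    from Lim_transform_eventually[OF moments this]
    show "(\<lambda>n. integral\<^sup>L (\<mu> n) (\<lambda>y. y ^ k)) \<longlonglongrightarrow> integral\<^sup>L semicircle_law (\<lambda>y. y ^ k)" for k
      by (simp add: semicircle_moment(2))
  qed (rule real_distribution_semicircle)
  moreover have "\<forall>\<^sub>F n in sequentially. cdf (\<mu> n) y = cdf (empirical_measure n (x n)) y" for y
    using ok by eventually_elim (simp add: \<mu>_def)
  ultimately show ?thesis
    unfolding weak_conv_m_def weak_conv_def by (blast intro: Lim_transform_eventually)
qed

text \<open>The tolerance of index 0, that is \<kappa> = 1, already bounds the spectra. The energy
  bound from below is universal; from above the tolerance is sent to 0 after n.\<close>

lemma asymptotic_fekete_spectra: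
  fixes x :: "nat \<Rightarrow> nat \<Rightarrow> real"
  assumes \<beta>: "\<beta> > 0"
    and ev: "\<And>m::nat. \<forall>\<^sub>F n in sequentially. inj_on (x n) {..<n} \<and>
      (\<forall>i<n. \<bar>x n i\<bar> \<le> sqrt (1 / Suc m / \<beta>) + 2 * sqrt (1 + 1 / Suc m)) \<and>
      discrete_energy n (x n) \<le> 1 / 2 - xlogx_mean n (real n) + 1 / Suc m / \<beta> / 2 + 2 * (1 / Suc m)"
  shows "asymptotic_fekete x (sqrt (1 / \<beta>) + 2 * sqrt 2)"
proof
  show "\<forall>\<^sub>F n in sequentially. inj_on (x n) {..<n}"
    using ev[of 0] by eventually_elim simp
  show "\<forall>\<^sub>F n in sequentially. \<forall>i<n. \<bar>x n i\<bar> \<le> sqrt (1 / \<beta>) + 2 * sqrt 2"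
    using ev[of 0] by eventually_elim simp
  show "(\<lambda>n. discrete_energy n (x n)) \<longlonglongrightarrow> 3 / 4"
  proof (rule order_tendstoI)
    fix c :: real assume "c < 3 / 4"
    then have "\<forall>\<^sub>F n in sequentially. fekete_bound n > c"
      by (rule order_tendstoD[OF fekete_bound_limit])
    then show "\<forall>\<^sub>F n in sequentially. discrete_energy n (x n) > c"
      using ev[of 0] eventually_ge_at_top[of 2]
    proof eventually_elim
      case (elim n)
      then show ?case using discrete_energy_ge_fekete[of n "x n"] by simp
    qed
  next
    fix c :: real assume c: "c > 3 / 4"
    \<comment> \<open>Total coefficient of \<kappa> in the upper bound; m is then taken so large
      that the tolerance uses up less than half of the gap to c.\<close>
    define K where "K = 1 / \<beta> / 2 + 2"
    have K: "K > 0" using \<beta> by (simp add: K_def add_pos_pos)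
    obtain m where m: "inverse (real (Suc m)) < (c - 3 / 4) / (2 * K)"
      using reals_Archimedean[of "(c - 3 / 4) / (2 * K)"] c K by auto
    have Km: "K * (1 / Suc m) < (c - 3 / 4) / 2"
      using m K by (simp add: field_simps)
    have "(\<lambda>n. xlogx_mean n (real n)) \<longlonglongrightarrow> -1/4"
    proof (rule xlogx_mean_limit)
      show "(\<lambda>n. ln (real n - 1) - ln (real n)) \<longlonglongrightarrow> 0" by real_asymp
    qed simp
    then have "(\<lambda>n. 1 / 2 - xlogx_mean n (real n)) \<longlonglongrightarrow> 1 / 2 - (-1/4)" by (intro tendsto_intros)
    then have "\<forall>\<^sub>F n in sequentially. 1 / 2 - xlogx_mean n (real n) < 3 / 4 + (c - 3 / 4) / 2"
      using c by (intro order_tendstoD) auto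
    then show "\<forall>\<^sub>F n in sequentially. discrete_energy n (x n) < c"
      using ev[of m]
    proof eventually_elim
      case (elim n)
      define u where "u = 1 / real (Suc m)"
      have "u / \<beta> / 2 + 2 * u = K * u" by (simp add: K_def distrib_right)
      moreover have "discrete_energy n (x n) \<le> 1 / 2 - xlogx_mean n (real n) + u / \<beta> / 2 + 2 * u"
        using elim(2) unfolding u_def by blast
      moreover have "K * u < (c - 3 / 4) / 2" using Km unfolding u_def .
      ultimately show ?case using elim(1) by argo
    qed
  qed
qed

theorem corollary3p5:
  fixes P :: "'a measure" and \<beta> :: real and M A :: "nat \<Rightarrow> 'a \<Rightarrow> real mat"
    and eig :: "nat \<Rightarrow> 'a \<Rightarrow> nat \<Rightarrow> real"
  defines "A \<equiv> \<lambda>n \<omega>. (1 / sqrt (\<beta> * real n)) \<cdot>\<^sub>m M n \<omega>"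
    and "eig \<equiv> \<lambda>n \<omega> k. eigenvalue_list (A n \<omega>) ! k"
  assumes "prob_space P"
    and "\<beta> > 0"
    and "\<And>n. n \<ge> 2 \<Longrightarrow> beta_ensemble P \<beta> n (M n)"
  shows "(AE \<omega> in P. (\<lambda>n. discrete_energy n (eig n \<omega>)) \<longlonglongrightarrow> 3 / 4)
       \<and> energy semicircle_law = ereal (3 / 4)
       \<and> (AE \<omega> in P. weak_conv_m (\<lambda>n. empirical_measure n (eig n \<omega>)) semicircle_law)"
proof -
  interpret P: prob_space P by fact
  note \<beta> = \<open>\<beta> > 0\<close>
  \<comment> \<open>Tolerances are restricted to the countable family 1 / (m + 1), so one null set
    works for all of them.\<close>
  have "AE \<omega> in P. \<forall>m. \<forall>\<^sub>F n in sequentially. entries_good \<beta> (1 / Suc m) n (M n \<omega>)"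
    unfolding AE_all_countable
    by (intro allI P.AE_eventually_entries_good assms) auto
  then have AE: "AE \<omega> in P. asymptotic_fekete (\<lambda>n. eig n \<omega>) (sqrt (1 / \<beta>) + 2 * sqrt 2)"
    using AE_space
  proof eventually_elim
    case (elim \<omega>)
    show ?case
    proof (rule asymptotic_fekete_spectra[OF \<beta>])
      fix m :: nat
      have good: "\<forall>\<^sub>F n in sequentially. entries_good \<beta> (1 / Suc m) n (M n \<omega>)" using elim(1) by blast
      show "\<forall>\<^sub>F n in sequentially. inj_on (eig n \<omega>) {..<n} \<and>
        (\<forall>i<n. \<bar>eig n \<omega> i\<bar> \<le> sqrt (1 / Suc m / \<beta>) + 2 * sqrt (1 + 1 / Suc m)) \<and>
        discrete_energy n (eig n \<omega>) \<le> 1 / 2 - xlogx_mean n (real n) + 1 / Suc m / \<beta> / 2 + 2 * (1 / Suc m)"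
        using good eventually_ge_at_top[of 2]
      proof eventually_elim
        case n: (elim n)
        have X: "M n \<omega> \<in> carrier_mat n n" "\<forall>i<n. \<forall>j<n. M n \<omega> $$ (j, i) = M n \<omega> $$ (i, j)"
          "\<forall>i<n. \<forall>j<n. Suc i < j \<longrightarrow> M n \<omega> $$ (i, j) = 0"
          using assms(5)[OF n(2)] elim(2) unfolding beta_ensemble_def by blast+
        have \<kappa>: "1 / real (Suc m) > 0" by simp
        note S = entries_good_spectrum[OF X(1) _ _ n(1,2) \<beta> \<kappa>]
        show ?case
          unfolding eig_def A_def using S X(2,3) by blast
      qed
    qed
  qed
  \<comment> \<open>The energy of the semicircle law does not involve the outcome, so a single good
    outcome suffices; one exists because the whole space is not a null set.\<close>
  have "\<exists>\<omega>. asymptotic_fekete (\<lambda>n. eig n \<omega>) (sqrt (1 / \<beta>) + 2 * sqrt 2)"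
  proof (rule ccontr)
    assume "\<not> ?thesis"
    then have "AE \<omega> in P. False" using AE by simp
    then show False by simp
  qed
  then have "energy semicircle_law = ereal (3 / 4)"
    by (blast intro: asymptotic_fekete.energy_semicircle)
  moreover have "AE \<omega> in P. (\<lambda>n. discrete_energy n (eig n \<omega>)) \<longlonglongrightarrow> 3 / 4"
    using AE by eventually_elim (rule asymptotic_fekete.energy)
  moreover have "AE \<omega> in P. weak_conv_m (\<lambda>n. empirical_measure n (eig n \<omega>)) semicircle_law"
    using AE by eventually_elim (rule asymptotic_fekete.empirical_weak_conv)
  ultimately show ?thesis by blast
qed

end
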